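(* For every integer $N \geq 2$, \[ B_N(q)= \frac{1}{(q;q)_{\infty}^2\, \overline{J}_{0,N(N+2)}} \sum_{r=0}^{N-1} \sum_{s=0}^{N-1} \frac{(-1)^{r+s+1}\,q^{\binom{r}{2} +\binom{s+1}{2} + r(s+1)(N+1)+r+s+1}\, J_{N^2(N+2)}^3\; j\!\left(-q^{N(s-r)};q^{N^2}\right)\, j\!\left(q^{N(N+2)(r+s)+N(N+3)};q^{N^2(N+2)}\right)}{j\!\left((-1)^Nq^{N(N+2)r+N(N+3)/2};q^{N^2(N+2)}\right)\; j\!\left((-1)^Nq^{N(N+2)s+N(N+3)/2};q^{N^2(N+2)}\right)}, \] where \[ B_N(q) :=\sum_{\substack{k_2, \dots , k_N \geq 0\\ N \mid K_2+\dots+K_N}} \frac{q^{K_2^2 + \cdots + K_N^2 - (K_2 + \cdots +K_N)^2/N}}{(q;q)_{k_2} \cdots (q;q)_{k_N}}, \qquad K_i := \sum_{j=2}^i k_j . \]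
   Context: Here $q$ is a complex number with $|q|<1$ (equivalently, the identity may be read as one of formal power series in $q$). The sum defining $B_N(q)$ runs over all tuples of nonnegative integers $(k_2,\dots,k_N)$ such that $N$ divides $K_2+\cdots+K_N$. Notation: $(a;q)_n := \prod_{k=0}^{n-1}(1-aq^k)$ for $n \in \mathbb{N}\cup\{\infty\}$; $j(x;q) := (x;q)_\infty (q/x;q)_\infty (q;q)_\infty$; $J_{a,m} := j(q^a;q^m)$; $\overline{J}_{a,m} := j(-q^a;q^m)$, so $\overline{J}_{0,m} = j(-1;q^m)$; and $J_m := J_{m,3m} = (q^m;q^m)_\infty$. Binomial coefficients $\binom{x}{2} = x(x-1)/2$. *)

theory Defs
  imports "HOL-Analysis.Analysis"
begin

definition qpoch :: "complex \<Rightarrow> complex \<Rightarrow> nat \<Rightarrow> complex" where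
  "qpoch a q n = (\<Prod>k<n. 1 - a * q ^ k)"

definition qpoch_inf :: "complex \<Rightarrow> complex \<Rightarrow> complex" where
  "qpoch_inf a q = (\<Prod>k. 1 - a * q ^ k)"

definition jtp :: "complex \<Rightarrow> complex \<Rightarrow> complex" where
  "jtp x q = qpoch_inf x q * qpoch_inf (q / x) q * qpoch_inf q q"

definition Jm :: "complex \<Rightarrow> nat \<Rightarrow> complex" where
  "Jm q m = qpoch_inf (q ^ m) (q ^ m)"

definition Kpart :: "(nat \<Rightarrow> nat) \<Rightarrow> nat \<Rightarrow> nat" where
  "Kpart k i = (\<Sum>j\<in>{2..i}. k j)"

text \<open>Index set: tuples (k_2,...,k_N) of nonnegative integers, encoded as functions
  nat => nat vanishing outside {2..N}, with N dividing K_2 + ... + K_N.\<close>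
definition Bindex :: "nat \<Rightarrow> (nat \<Rightarrow> nat) set" where
  "Bindex N = {k. (\<forall>i. i \<notin> {2..N} \<longrightarrow> k i = 0) \<and> N dvd (\<Sum>i\<in>{2..N}. Kpart k i)}"

definition Bexp :: "nat \<Rightarrow> (nat \<Rightarrow> nat) \<Rightarrow> int" where
  "Bexp N k = (\<Sum>i\<in>{2..N}. (int (Kpart k i))\<^sup>2) - (int (\<Sum>i\<in>{2..N}. Kpart k i))\<^sup>2 div int N"

definition BN :: "nat \<Rightarrow> complex \<Rightarrow> complex" where
  "BN N q = (\<Sum>\<^sub>\<infinity>k\<in>Bindex N. q powi (Bexp N k) / (\<Prod>i\<in>{2..N}. qpoch q q (k i)))"

end

theory Submission
  imports Defs
begin

text \<open>
  Both sides are compared with the Hecke-type double sum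
  D = (sum over U, T \<ge> 0 minus sum over U, T < 0) of
  (-1)^(U+T) q^(U(U+1)/2 + T(T+1)/2 + (N+1)UT).

  Left side: in the variables 0 \<le> K_1 \<le> ... \<le> K_N \<le> 2M, the N-fold Bailey chain on the unit
  Bailey pair (relative to a free parameter a) evaluates the sum of
  a^(K_1+...+K_N) q^(K_1^2+...+K_N^2) / ((q)_(2M-K_N) ... (q)_(K_1)) as a single sum of rational
  functions of a. The tuples of B_N are the chains with K_1+...+K_N = NM, so the coefficient of a^(NM),
  read off on a circle after a partial fraction expansion, is a truncation of B_N. After
  symmetrisation it is also a truncation of D, and M \<rightarrow> \<infinity> gives (q)_\<infinity>^2 B_N = D.

  Right side: Kronecker's formula expands J^3 j(xy)/(j(x) j(y)) as a double sum over a, b of equal sign.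
  With R = r + Na and S = s + Nb the sums over r and s become sums over all R, S of equal sign, and the
  remaining theta function contributes a third index n. The substitution R = U - n, S = T + n - 1
  decouples n, except that the quadrants are shifted by n; the shift is harmless because every
  row and column of the double sum vanishes. What remains is j(-1; q^(N(N+2))) D.
\<close>

section \<open>Finite q-series\<close>

text \<open>The exponent in B_N is the sum of the squared deviations of 0, K_2, ..., K_N from their
  mean, and the mean is an integer exactly when N divides the sum. Deviations do not change when a
  common number is added, so a further index K_1 can be introduced to move the mean to M; the side
  condition then becomes K_1 + ... + K_N = NM, the coefficient of a power of a. The obstacle is that
  the Bailey chain gives rational functions of a, whose constant terms depend on the circle. On |a|
  = |q|^(1/2 - 2M) the enclosed poles are those with T < U in suitable coordinates, and this
  condition cancels when the sum is averaged with its image under swapping U and T. No contour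
  integral occurs: a constant term is the limit of averages over n equally spaced points, each
  computed exactly. Every passage M -> infinity is dominated convergence, resting on the boundedness
  of 1/(q;q)_n. On the B_N side the two end factors (q;q)_(k_1) and (q;q)_(2M - K_N) tend to
  (q;q)_infinity, on the Hecke side four such factors do; this accounts for the power
  (q;q)_infinity^2.\<close>

definition tri :: "int \<Rightarrow> int" where
  "tri n = n * (n + 1) div 2"

lemma two_tri: "2 * tri n = n * (n + 1)"
  unfolding tri_def by (simp add: dvd_mult_div_cancel)

lemma tri_mult_two: "tri n * 2 = n + n * n"
  using two_tri[of n] by (simp add: algebra_simps)

lemma tri_eqI: "2 * m = n * (n + 1) \<Longrightarrow> tri n = m"
  using two_tri[of n] by linarith

lemma tri_add: "tri (m + n) = tri m + tri n + m * n"
  by (rule tri_eqI) (simp add: algebra_simps tri_mult_two)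

lemma tri_minus: "tri (- n) = tri n - n"
  by (rule tri_eqI) (simp add: algebra_simps tri_mult_two)

lemma tri_diff: "tri (m - n) = tri m + tri n - n - m * n"
  using tri_add[of m "- n"] by (simp add: tri_minus)

lemma tri_0 [simp]: "tri 0 = 0" and tri_1 [simp]: "tri 1 = 1" and tri_m1 [simp]: "tri (- 1) = 0"
  by (simp_all add: tri_def)

lemma tri_nonneg: "tri n \<ge> 0"
proof -
  have "n * (n + 1) \<ge> 0"
    by (cases "n \<ge> 0") (auto intro: mult_nonpos_nonpos)
  then show ?thesis by (simp add: tri_def)
qed

lemma tri_ge: "n \<le> tri n" "- n - 1 \<le> tri n"
proof -
  have "0 \<le> tri (n - 1)" "0 \<le> tri (n + 1)"
    by (rule tri_nonneg)+
  then show "n \<le> tri n" "- n - 1 \<le> tri n"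
    by (simp_all add: tri_diff tri_add)
qed

lemma qpoch_0 [simp]: "qpoch a q 0 = 1"
  by (simp add: qpoch_def)

lemma qpoch_Suc: "qpoch a q (Suc n) = qpoch a q n * (1 - a * q ^ n)"
  by (simp add: qpoch_def)

lemma qpoch_add: "qpoch a q (m + n) = qpoch a q m * qpoch (a * q ^ m) q n"
  by (induction n) (simp_all add: qpoch_Suc power_add mult.assoc)

lemma qpoch_Suc_left: "qpoch a q (Suc n) = (1 - a) * qpoch (a * q) q n"
  using qpoch_add[of a q 1 n] by (simp add: qpoch_Suc)

lemma qpoch_eq_0_iff: "qpoch a q n = 0 \<longleftrightarrow> (\<exists>k<n. a * q ^ k = 1)"
  by (auto simp: qpoch_def)

lemma power_norm_less_1_neq_1:
  fixes q :: complex
  assumes "norm q < 1"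
  shows "q * q ^ n \<noteq> 1"
proof
  assume "q * q ^ n = 1"
  then have "norm q ^ Suc n = 1"
    by (metis norm_one norm_power power_Suc)
  then show False using assms
    by (metis norm_ge_zero power_Suc_less_one less_irrefl power_0_Suc zero_neq_one
        order_le_less)
qed

lemma qpoch_self_neq_0: "norm q < 1 \<Longrightarrow> qpoch q q n \<noteq> 0"
  by (auto simp: qpoch_eq_0_iff power_norm_less_1_neq_1)

text \<open>Pulling -x q^(-j) out of each factor 1 - x q^(-j), for 1 <= j <= n, leaves 1 - q^j / x.
  This recentres a product of length 2M, turning one product into a pair in x and q / x.\<close>

lemma qpoch_reflect:
  assumes "q \<noteq> 0" "x \<noteq> 0"
  shows "qpoch (x / q ^ n) q n = (- x) ^ n / q powi tri (int n) * qpoch (q / x) q n"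
proof (induction n)
  case 0
  then show ?case by simp
next
  case (Suc n)
  have tri: "q powi tri (int (Suc n)) = q powi tri (int n) * q ^ Suc n"
    using assms by (simp add: tri_add power_int_add algebra_simps)
  have "x / q ^ Suc n * q = x / q ^ n"
    using assms by simp
  then have "qpoch (x / q ^ Suc n) q (Suc n) = (1 - x / q ^ Suc n) * qpoch (x / q ^ n) q n"
    unfolding qpoch_Suc_left by (simp only:)
  also have "\<dots> = (1 - x / q ^ Suc n) * ((- x) ^ n / q powi tri (int n) * qpoch (q / x) q n)"
    by (simp only: Suc)
  also have "1 - x / q ^ Suc n = - x / q ^ Suc n * (1 - q / x * q ^ n)"
    using assms by (simp add: field_simps)
  finally show ?case
    unfolding tri qpoch_Suc
    by (simp only: power_Suc times_divide_eq_left times_divide_eq_right divide_divide_eq_left mult_ac)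
qed

context
  fixes q :: complex
  assumes q0: "q \<noteq> 0" and q1: "norm q < 1"
begin

lemma q_neq_1: "q * q ^ n \<noteq> 1"
  using q1 by (rule power_norm_less_1_neq_1)

lemma qq_nz [simp]: "qpoch q q n \<noteq> 0"
  using q1 by (rule qpoch_self_neq_0)

text \<open>The two q-Pascal rules: 1 - q^(n+1) is written as q^i (1 - q^(n+1-i)) + (1 - q^i) or as
  (1 - q^(n+1-i)) + q^(n+1-i) (1 - q^i), and each difference cancels the last factor of one
  q-factorial. They drive the inductions on n in \<open>q_binomial\<close>,
  \<open>q_vandermonde\<close> and \<open>qpoch_partial_fractions\<close>.\<close>

lemma gauss_sum_rec:
  fixes g :: "nat \<Rightarrow> complex"
  shows "(1 - q ^ Suc n) * (\<Sum>i\<le>Suc n. g i / (qpoch q q i * qpoch q q (Suc n - i)))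
       = (\<Sum>i\<le>n. (q ^ i * g i + g (Suc i)) / (qpoch q q i * qpoch q q (n - i)))"
    and gauss_sum_rec': "(1 - q ^ Suc n) * (\<Sum>i\<le>Suc n. g i / (qpoch q q i * qpoch q q (Suc n - i)))
       = (\<Sum>i\<le>n. (g i + q ^ (n - i) * g (Suc i)) / (qpoch q q i * qpoch q q (n - i)))"
proof -
  define w where "w i = g i / (qpoch q q i * qpoch q q (Suc n - i))" for i
  have left: "(1 - q ^ (Suc n - i)) * w i = g i / (qpoch q q i * qpoch q q (n - i))" if "i \<le> n" for i
    using that q_neq_1[of "n - i"] by (simp add: w_def Suc_diff_le qpoch_Suc)
  have right: "(1 - q ^ Suc i) * w (Suc i) = g (Suc i) / (qpoch q q i * qpoch q q (n - i))" for i
    using q_neq_1[of i] by (simp add: w_def qpoch_Suc)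
  \<comment> \<open>The term i = n + 1 of the first sum and the term i = 0 of the second vanish. The
    weights stay free so that one reindexing serves both rules.\<close>
  have split: "(\<Sum>i\<le>Suc n. \<alpha> i * (1 - q ^ (Suc n - i)) * w i) + (\<Sum>i\<le>Suc n. \<beta> i * (1 - q ^ i) * w i)
     = (\<Sum>i\<le>n. (\<alpha> i * g i + \<beta> (Suc i) * g (Suc i)) / (qpoch q q i * qpoch q q (n - i)))" for \<alpha> \<beta>
  proof -
    have "(\<Sum>i\<le>Suc n. \<alpha> i * (1 - q ^ (Suc n - i)) * w i)
        = (\<Sum>i\<le>n. \<alpha> i * (g i / (qpoch q q i * qpoch q q (n - i))))"
      by (simp add: left mult.assoc)
    moreover have "(\<Sum>i\<le>Suc n. \<beta> i * (1 - q ^ i) * w i)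
        = (\<Sum>i\<le>n. \<beta> (Suc i) * (g (Suc i) / (qpoch q q i * qpoch q q (n - i))))"
      unfolding sum.atMost_Suc_shift by (simp add: right[simplified] mult.assoc)
    ultimately show ?thesis
      by (simp add: sum.distrib[symmetric] add_divide_distrib)
  qed
  have "(1 - q ^ Suc n) * (\<Sum>i\<le>Suc n. w i)
      = (\<Sum>i\<le>Suc n. q ^ i * (1 - q ^ (Suc n - i)) * w i) + (\<Sum>i\<le>Suc n. 1 * (1 - q ^ i) * w i)"
    unfolding sum.distrib[symmetric] sum_distrib_left
  proof (rule sum.cong)
    fix i assume "i \<in> {..Suc n}"
    then have "q ^ Suc n = q ^ i * q ^ (Suc n - i)"
      by (simp flip: power_add)
    then show "(1 - q ^ Suc n) * w i
        = q ^ i * (1 - q ^ (Suc n - i)) * w i + 1 * (1 - q ^ i) * w i"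
      by (simp only:) (simp add: algebra_simps)
  qed simp
  then show "(1 - q ^ Suc n) * (\<Sum>i\<le>Suc n. g i / (qpoch q q i * qpoch q q (Suc n - i)))
       = (\<Sum>i\<le>n. (q ^ i * g i + g (Suc i)) / (qpoch q q i * qpoch q q (n - i)))"
    unfolding split by (simp add: w_def)
  have "(1 - q ^ Suc n) * (\<Sum>i\<le>Suc n. w i)
      = (\<Sum>i\<le>Suc n. 1 * (1 - q ^ (Suc n - i)) * w i) + (\<Sum>i\<le>Suc n. q ^ (Suc n - i) * (1 - q ^ i) * w i)"
    unfolding sum.distrib[symmetric] sum_distrib_left
  proof (rule sum.cong)
    fix i assume "i \<in> {..Suc n}"
    then have "q ^ Suc n = q ^ i * q ^ (Suc n - i)"
      by (simp flip: power_add)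
    then show "(1 - q ^ Suc n) * w i
        = 1 * (1 - q ^ (Suc n - i)) * w i + q ^ (Suc n - i) * (1 - q ^ i) * w i"
      by (simp only:) (simp add: algebra_simps)
  qed simp
  then show "(1 - q ^ Suc n) * (\<Sum>i\<le>Suc n. g i / (qpoch q q i * qpoch q q (Suc n - i)))
       = (\<Sum>i\<le>n. (g i + q ^ (n - i) * g (Suc i)) / (qpoch q q i * qpoch q q (n - i)))"
    unfolding split by (simp add: w_def)
qed

lemma one_minus_power_Suc_neq_0: "1 - q ^ Suc n \<noteq> 0"
  using q_neq_1[of n] by simp

text \<open>With this weight \<open>g\<close>, q^(n-i) g (i+1) = -x q^n g i, so the second Pascal
  rule turns the sum for n + 1 into 1 - x q^n times the sum for n.\<close>

lemma q_binomial:
  "(\<Sum>i\<le>n. (- x) ^ i * q powi tri (int i - 1) / (qpoch q q i * qpoch q q (n - i)))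
     = qpoch x q n / qpoch q q n"
proof (induction n)
  case 0
  then show ?case by simp
next
  case (Suc n)
  define g where "g i = (- x) ^ i * q powi tri (int i - 1)" for i
  have g: "g i + q ^ (n - i) * g (Suc i) = (1 - x * q ^ n) * g i" if "i \<le> n" for i
  proof -
    have "q ^ (n - i) * q powi tri (int (Suc i) - 1) = q ^ n * q powi tri (int i - 1)"
      using that q0 by (simp add: tri_diff power_int_diff power_diff)
    then show ?thesis
      unfolding g_def by (simp add: algebra_simps)
  qed
  have "(1 - q ^ Suc n) * (\<Sum>i\<le>Suc n. g i / (qpoch q q i * qpoch q q (Suc n - i)))
      = (\<Sum>i\<le>n. (1 - x * q ^ n) * (g i / (qpoch q q i * qpoch q q (n - i))))"
    unfolding gauss_sum_rec' using g by (intro sum.cong) auto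
  also have "\<dots> = (1 - x * q ^ n) * (qpoch x q n / qpoch q q n)"
    unfolding sum_distrib_left[symmetric] using Suc by (simp only: g_def)
  also have "\<dots> = (1 - q ^ Suc n) * (qpoch x q (Suc n) / qpoch q q (Suc n))"
    using one_minus_power_Suc_neq_0[of n] by (simp add: qpoch_Suc field_simps)
  finally show ?case
    unfolding mult_left_cancel[OF one_minus_power_Suc_neq_0[of n]] g_def .
qed

text \<open>A limiting case of the q-Chu-Vandermonde sum. The parameter a must vary in the
  induction, because the shifted summand has the same shape with a q in place of a.\<close>

lemma q_vandermonde:
  assumes "\<And>k. a * q ^ Suc k \<noteq> 1"
  shows "(\<Sum>k\<le>n. a ^ k * q ^ (k\<^sup>2) / qpoch (a * q) q k / (qpoch q q k * qpoch q q (n - k)))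
     = 1 / (qpoch q q n * qpoch (a * q) q n)"
  using assms
proof (induction n arbitrary: a)
  case 0
  then show ?case by simp
next
  case (Suc n)
  define g where "g a k = a ^ k * q ^ (k\<^sup>2) / qpoch (a * q) q k" for a k
  have nz1: "1 - a * q \<noteq> 0"
    using Suc.prems[of 0] by simp
  have nz: "a * q * q ^ Suc k \<noteq> 1" for k
    using Suc.prems[of "Suc k"] by (simp add: mult.assoc)
  have nz2: "qpoch (a * q) q m \<noteq> 0" for m
    using Suc.prems by (auto simp: qpoch_eq_0_iff mult.assoc)
  have nz3: "1 - a * q * q ^ n \<noteq> 0"
    using Suc.prems[of n] by (auto simp: mult.assoc)
  have g: "q ^ (n - k) * g a (Suc k) = a * q ^ Suc n / (1 - a * q) * g (a * q) k" if "k \<le> n" for k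
  proof -
    have "(n - k) + (Suc k)\<^sup>2 = Suc n + (k + k\<^sup>2)"
      using that by (simp add: power2_eq_square)
    then have "q ^ (n - k) * q ^ ((Suc k)\<^sup>2) = q ^ Suc n * (q ^ k * q ^ (k\<^sup>2))"
      by (simp only: power_add[symmetric])
    then have "q ^ (n - k) * (a ^ Suc k * q ^ ((Suc k)\<^sup>2))
        = a * q ^ Suc n * ((a * q) ^ k * q ^ (k\<^sup>2))"
      by (simp add: power_mult_distrib mult_ac)
    then show ?thesis
      unfolding g_def qpoch_Suc_left[of "a * q"]
      by (metis (no_types, opaque_lifting) times_divide_eq_right times_divide_times_eq)
  qed
  have "(1 - q ^ Suc n) * (\<Sum>k\<le>Suc n. g a k / (qpoch q q k * qpoch q q (Suc n - k)))
     = (\<Sum>k\<le>n. g a k / (qpoch q q k * qpoch q q (n - k))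
         + a * q ^ Suc n / (1 - a * q) * (g (a * q) k / (qpoch q q k * qpoch q q (n - k))))"
    unfolding gauss_sum_rec' using g by (intro sum.cong) (auto simp: add_divide_distrib)
  also have "\<dots> = 1 / (qpoch q q n * qpoch (a * q) q n)
        + a * q ^ Suc n / (1 - a * q) * (1 / (qpoch q q n * qpoch (a * q * q) q n))"
    unfolding sum.distrib sum_distrib_left[symmetric]
    by (simp only: Suc.IH[OF Suc.prems, folded g_def] Suc.IH[OF nz, folded g_def])
  also have "a * q ^ Suc n / (1 - a * q) * (1 / (qpoch q q n * qpoch (a * q * q) q n))
      = a * q ^ Suc n / (qpoch q q n * qpoch (a * q) q (Suc n))"
    unfolding qpoch_Suc_left[of "a * q"] by simp
  also have "1 / (qpoch q q n * qpoch (a * q) q n) + a * q ^ Suc n / (qpoch q q n * qpoch (a * q) q (Suc n))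
      = (1 - q ^ Suc n) * (1 / (qpoch q q (Suc n) * qpoch (a * q) q (Suc n)))"
    using nz2[of n] nz3 one_minus_power_Suc_neq_0[of n] by (simp add: qpoch_Suc divide_simps)
  finally show ?case
    unfolding mult_left_cancel[OF one_minus_power_Suc_neq_0[of n]] g_def .
qed

text \<open>Partial fractions at the simple poles x = q^(-k). The bound i <= n keeps the numerator
  of smaller degree than the denominator, so no polynomial part arises. The freedom in i is used
  later, both to adjust powers of a and to treat polynomial numerators.\<close>

lemma qpoch_partial_fractions:
  assumes "\<And>k. x * q ^ k \<noteq> 1" and "i \<le> n"
  shows "(\<Sum>k\<le>n. (- 1) ^ k * q powi (tri (int k) - int k * int i) / (1 - x * q ^ k)
             / (qpoch q q k * qpoch q q (n - k)))
     = x ^ i / qpoch x q (Suc n)"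
  using assms
proof (induction n arbitrary: x i)
  case 0
  then show ?case by (simp add: qpoch_Suc)
next
  case (Suc n)
  define g where "g x i k = (- 1) ^ k * q powi (tri (int k) - int k * int i) / (1 - x * q ^ k)" for x i k
  have nz: "x * q * q ^ k \<noteq> 1" for k
    using Suc.prems(1)[of "Suc k"] by (simp add: mult.assoc)
  have nz0: "1 - x * q ^ k \<noteq> 0" for k
    using Suc.prems(1)[of k] by simp
  have nz2: "qpoch x q m \<noteq> 0" for m
    using Suc.prems(1) by (auto simp: qpoch_eq_0_iff)
  have IH: "(\<Sum>k\<le>n. g y l k / (qpoch q q k * qpoch q q (n - k))) = y ^ l / qpoch y q (Suc n)"
    if "y = x \<or> y = x * q" "l \<le> n" for y l
    using Suc.IH[of y l] that nz Suc.prems(1) unfolding g_def by metis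
  have shift: "qpoch (x * q) q (Suc n) = qpoch x q (Suc n) * (1 - x * q ^ Suc n) / (1 - x)"
    using nz0[of 0] qpoch_Suc_left[of x q "Suc n"] qpoch_Suc[of x q "Suc n"] by (simp add: field_simps)
  have "(1 - q ^ Suc n) * (\<Sum>k\<le>Suc n. g x i k / (qpoch q q k * qpoch q q (Suc n - k)))
      = (1 - q ^ Suc n) * (x ^ i / qpoch x q (Suc (Suc n)))"
  \<comment> \<open>The second Pascal rule keeps the exponent i, the first lowers it by one.
    Lowering is needed for i = n + 1, which the induction hypothesis for n does not cover; i = 0
    cannot be lowered.\<close>
  proof (cases i)
    case 0
    have "q ^ (n - k) * g x 0 (Suc k) = - (q ^ Suc n * g (x * q) 0 k)" if "k \<le> n" for k
    proof -
      have "q ^ (n - k) * q powi (tri (int (Suc k))) = q ^ Suc n * q powi tri (int k)"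
        using that q0 by (simp add: tri_add power_int_add power_diff)
      then show ?thesis
        unfolding g_def by (simp add: field_simps)
    qed
    then have "(1 - q ^ Suc n) * (\<Sum>k\<le>Suc n. g x 0 k / (qpoch q q k * qpoch q q (Suc n - k)))
      = (\<Sum>k\<le>n. g x 0 k / (qpoch q q k * qpoch q q (n - k))
         - q ^ Suc n * (g (x * q) 0 k / (qpoch q q k * qpoch q q (n - k))))"
      unfolding gauss_sum_rec' by (intro sum.cong) (auto simp: diff_divide_distrib)
    also have "\<dots> = 1 / qpoch x q (Suc n) - q ^ Suc n * (1 / qpoch (x * q) q (Suc n))"
      using IH[of x 0] IH[of "x * q" 0] unfolding sum_subtractf sum_distrib_left[symmetric] by simp
    also have "\<dots> = (1 - q ^ Suc n) * (1 / qpoch x q (Suc (Suc n)))"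
      unfolding shift qpoch_Suc[of x q "Suc n"] using nz2[of "Suc n"] nz0[of 0] nz0[of "Suc n"]
      by (simp add: divide_simps) (simp add: algebra_simps)
    finally show ?thesis using 0 by simp
  next
    case (Suc l)
    then have l: "l \<le> n" using Suc.prems(2) by simp
    have g1: "q ^ k * g x (Suc l) k = g x l k" for k
    proof -
      have "tri (int k) - int k * int l = int k + (tri (int k) - int k * int (Suc l))"
        by (simp add: algebra_simps)
      then have "q powi (tri (int k) - int k * int l) = q ^ k * q powi (tri (int k) - int k * int (Suc l))"
        using q0 by (simp only: power_int_add[OF disjI1[OF q0]] power_int_of_nat)
      then show ?thesis
        unfolding g_def by simp
    qed
    have g2: "g x (Suc l) (Suc k) = - (g (x * q) l k / q ^ l)" for k
    proof -
      have "q powi (tri (int (Suc k)) - int (Suc k) * int (Suc l)) = q powi (tri (int k) - int k * int l) / q ^ l"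
        using q0 by (simp add: tri_add power_int_add power_int_diff algebra_simps)
      then show ?thesis
        unfolding g_def by (simp add: mult_ac)
    qed
    have "(1 - q ^ Suc n) * (\<Sum>k\<le>Suc n. g x (Suc l) k / (qpoch q q k * qpoch q q (Suc n - k)))
      = (\<Sum>k\<le>n. g x l k / (qpoch q q k * qpoch q q (n - k))
         - (1 / q ^ l) * (g (x * q) l k / (qpoch q q k * qpoch q q (n - k))))"
      unfolding gauss_sum_rec g1 g2 by (intro sum.cong) (auto simp: diff_divide_distrib mult_ac)
    also have "\<dots> = x ^ l / qpoch x q (Suc n) - (1 / q ^ l) * ((x * q) ^ l / qpoch (x * q) q (Suc n))"
      using IH[of x l] IH[of "x * q" l] l unfolding sum_subtractf sum_distrib_left[symmetric] by simp
    also have "\<dots> = x ^ l / qpoch x q (Suc n) - x ^ l / qpoch (x * q) q (Suc n)"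
      using q0 by (simp add: power_mult_distrib)
    also have "\<dots> = (1 - q ^ Suc n) * (x ^ Suc l / qpoch x q (Suc (Suc n)))"
      unfolding shift qpoch_Suc[of x q "Suc n"] using nz2[of "Suc n"] nz0[of 0] nz0[of "Suc n"]
      by (simp add: divide_simps) (simp add: algebra_simps)
    finally show ?thesis using Suc by simp
  qed
  then show ?case
    unfolding mult_left_cancel[OF one_minus_power_Suc_neq_0[of n]] g_def .
qed

end

section \<open>The Bailey chain\<close>

text \<open>The outermost summation index is K_N and the innermost K_1; the base case supplies the
  factor 1 / (q;q)_(K_1).\<close>

primrec chain_sum :: "complex \<Rightarrow> complex \<Rightarrow> nat \<Rightarrow> nat \<Rightarrow> complex" where
  "chain_sum q a 0 L = 1 / qpoch q q L"
| "chain_sum q a (Suc N) L = (\<Sum>K\<le>L. a ^ K * q ^ (K\<^sup>2) * chain_sum q a N K / qpoch q q (L - K))"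

lemma sum_nested_atMost_swap:
  fixes f :: "nat \<Rightarrow> nat \<Rightarrow> 'a::comm_monoid_add"
  shows "(\<Sum>K\<le>L. \<Sum>r\<le>K. f K r) = (\<Sum>r\<le>L. \<Sum>k\<le>L - r. f (r + k) r)"
  unfolding sum.Sigma[OF finite_atMost ballI[OF finite_atMost]]
  by (rule sum.reindex_bij_witness[where i = "\<lambda>(r, k). (r + k, r)" and j = "\<lambda>(K, r). (r, K - r)"]) auto

text \<open>The alpha_r of the unit Bailey pair without its factor (a;q)_r / (1 - a).
  Correspondingly the usual denominator (aq;q)_(L+r) becomes (a q^r;q)_(L+1), which has L + 1
  factors for every r and so fits \<open>qpoch_partial_fractions\<close>.\<close>

definition unit_\<alpha> :: "complex \<Rightarrow> complex \<Rightarrow> nat \<Rightarrow> complex" where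
  "unit_\<alpha> q a r = (- 1) ^ r * q powi tri (int r - 1) * (1 - a * q ^ (2 * r)) / qpoch q q r"

context
  fixes q :: complex
  assumes q0: "q \<noteq> 0" and q1: "norm q < 1"
begin

text \<open>Bailey's lemma with both auxiliary parameters sent to infinity. After the two sums are
  interchanged, the inner one over k = K - r is \<open>q_vandermonde\<close> with a q^(2r) in place
  of a.\<close>

lemma bailey_step:
  assumes a: "\<And>k. a * q ^ k \<noteq> 1"
    and \<beta>: "\<And>L. \<beta> L = (\<Sum>r\<le>L. \<alpha> r / (qpoch q q (L - r) * qpoch (a * q ^ r) q (Suc L)))"
  shows "(\<Sum>K\<le>L. a ^ K * q ^ (K\<^sup>2) * \<beta> K / qpoch q q (L - K))
     = (\<Sum>r\<le>L. a ^ r * q ^ (r\<^sup>2) * \<alpha> r / (qpoch q q (L - r) * qpoch (a * q ^ r) q (Suc L)))"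
proof -
  define f where "f K r = a ^ K * q ^ (K\<^sup>2) * \<alpha> r /
    (qpoch q q (K - r) * qpoch (a * q ^ r) q (Suc K)) / qpoch q q (L - K)" for K r
  have "(\<Sum>K\<le>L. a ^ K * q ^ (K\<^sup>2) * \<beta> K / qpoch q q (L - K)) = (\<Sum>K\<le>L. \<Sum>r\<le>K. f K r)"
    unfolding \<beta> f_def by (simp add: sum_distrib_left sum_divide_distrib mult.assoc)
  also have "\<dots> = (\<Sum>r\<le>L. \<Sum>k\<le>L - r. f (r + k) r)"
    by (rule sum_nested_atMost_swap)
  also have "\<dots> = (\<Sum>r\<le>L. a ^ r * q ^ (r\<^sup>2) * \<alpha> r / (qpoch q q (L - r) * qpoch (a * q ^ r) q (Suc L)))"
  proof (rule sum.cong)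
    fix r assume "r \<in> {..L}"
    then have r: "r \<le> L" by simp
    define c where "c = a * q ^ (2 * r)"
    have c: "c * q ^ Suc k \<noteq> 1" for k
      using a[of "2 * r + Suc k"] by (simp add: c_def power_add mult_ac)
    have sh: "qpoch (a * q ^ r) q (Suc r + k) = qpoch (a * q ^ r) q (Suc r) * qpoch (c * q) q k" for k
      unfolding qpoch_add c_def by (simp add: mult.assoc mult_2_right power_add mult_ac)
    have "f (r + k) r = a ^ r * q ^ (r\<^sup>2) * \<alpha> r / qpoch (a * q ^ r) q (Suc r) *
        (c ^ k * q ^ (k\<^sup>2) / qpoch (c * q) q k / (qpoch q q k * qpoch q q (L - r - k)))" for k
    proof -
      have "a ^ (r + k) * q ^ ((r + k)\<^sup>2) = a ^ r * q ^ (r\<^sup>2) * (c ^ k * q ^ (k\<^sup>2))"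
        by (simp add: c_def power_add power2_sum power_mult_distrib mult_ac flip: power_mult)
      moreover have "Suc (r + k) = Suc r + k" "L - (r + k) = L - r - k" by simp_all
      ultimately show ?thesis
        unfolding f_def by (simp only: sh add_diff_cancel_left') (simp add: mult_ac)
    qed
    then have "(\<Sum>k\<le>L - r. f (r + k) r) = a ^ r * q ^ (r\<^sup>2) * \<alpha> r / qpoch (a * q ^ r) q (Suc r) *
        (\<Sum>k\<le>L - r. c ^ k * q ^ (k\<^sup>2) / qpoch (c * q) q k / (qpoch q q k * qpoch q q (L - r - k)))"
      by (simp only: sum_distrib_left)
    also have "\<dots> = a ^ r * q ^ (r\<^sup>2) * \<alpha> r / qpoch (a * q ^ r) q (Suc r) *
        (1 / (qpoch q q (L - r) * qpoch (c * q) q (L - r)))"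
      using q_vandermonde[OF q0 q1, of c "L - r", OF c] by (simp only:)
    also have "\<dots> = a ^ r * q ^ (r\<^sup>2) * \<alpha> r / (qpoch q q (L - r) * qpoch (a * q ^ r) q (Suc L))"
      using r sh[of "L - r"] by (simp add: mult_ac)
    finally show "(\<Sum>k\<le>L - r. f (r + k) r)
       = a ^ r * q ^ (r\<^sup>2) * \<alpha> r / (qpoch q q (L - r) * qpoch (a * q ^ r) q (Suc L))" .
  qed simp
  finally show ?thesis .
qed

text \<open>The sum defining the unit pair telescopes. Its full value 0 offers nothing to induct on,
  whereas the partial sums have a closed product form; the term r = L + 1 is later seen to be the
  negative of the last one.\<close>

lemma unit_bailey_pair_partial:
  assumes a: "\<And>k. a * q ^ k \<noteq> 1" and "m \<le> L"
  shows "(\<Sum>r\<le>m. unit_\<alpha> q a r / (qpoch q q (Suc L - r) * qpoch (a * q ^ r) q (Suc (Suc L))))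
     = (- 1) ^ m * q powi tri (int m) /
        (qpoch q q m * qpoch q q (L - m) * (1 - q ^ Suc L) * qpoch (a * q ^ Suc m) q (Suc L))"
  using assms(2)
proof (induction m)
  case 0
  have "1 - a \<noteq> 0" using a[of 0] by simp
  then show ?case
    by (simp add: unit_\<alpha>_def qpoch_Suc_left[of a q "Suc L"] qpoch_Suc[of q q L])
next
  case (Suc m)
  let ?A = "qpoch (a * q ^ Suc (Suc m)) q L"
  have p1: "qpoch (a * q ^ Suc m) q (Suc (Suc L)) = (1 - a * q ^ Suc m) * ?A * (1 - a * q ^ (m + L + 2))"
    unfolding qpoch_Suc_left[of "a * q ^ Suc m"] qpoch_Suc[of _ q L] by (simp add: power_add mult_ac power2_eq_square)
  have p2: "qpoch (a * q ^ Suc m) q (Suc L) = (1 - a * q ^ Suc m) * ?A"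
    unfolding qpoch_Suc_left[of "a * q ^ Suc m"] by (simp add: mult_ac)
  have p3: "qpoch (a * q ^ Suc (Suc m)) q (Suc L) = ?A * (1 - a * q ^ (m + L + 2))"
    unfolding qpoch_Suc[of _ q L] by (simp add: power_add mult_ac power2_eq_square)
  obtain d where d: "L = Suc m + d"
    using Suc.prems le_Suc_ex by blast
  have e: "Suc L - Suc m = Suc d" "L - m = Suc d" "L - Suc m = d"
    using d by auto
  have nz: "1 - a * q ^ Suc m \<noteq> 0" "1 - a * q ^ (m + L + 2) \<noteq> 0" "?A \<noteq> 0" "1 - q ^ Suc L \<noteq> 0"
    "1 - q ^ Suc m \<noteq> 0" "1 - q ^ Suc d \<noteq> 0" "qpoch q q m \<noteq> 0" "qpoch q q d \<noteq> 0"
    using a[of "Suc m"] a[of "m + L + 2"] a[of "Suc (Suc m) + _"] one_minus_power_Suc_neq_0[OF q0 q1]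
      qpoch_self_neq_0[OF q1]
    by (auto simp: qpoch_eq_0_iff power_add mult.assoc)
  have t1: "q powi tri (int (Suc m) - 1) = q powi tri (int m)"
    and t2: "q powi tri (int (Suc m)) = q powi tri (int m) * q ^ Suc m"
    using q0 by (simp_all add: tri_add power_int_add algebra_simps)
  \<comment> \<open>With the powers of q named, the induction step is an identity of rational
    functions, settled by clearing denominators.\<close>
  define P where "P = q powi tri (int m)"
  define X where "X = q ^ m"
  define Y where "Y = q ^ d"
  have pw: "q ^ Suc m = q * X" "q ^ (m + L + 2) = q ^ 3 * X\<^sup>2 * Y" "q ^ Suc L = q ^ 2 * X * Y"
    "q ^ Suc d = q * Y" "q ^ (2 * Suc m) = q ^ 2 * X ^ 2"
    by (simp_all add: d X_def Y_def power_add power2_eq_square power3_eq_cube mult_ac mult_2_right)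
  have IH: "(\<Sum>r\<le>m. unit_\<alpha> q a r / (qpoch q q (Suc L - r) * qpoch (a * q ^ r) q (Suc (Suc L))))
     = (- 1) ^ m * q powi tri (int m) /
        (qpoch q q m * qpoch q q (L - m) * (1 - q ^ Suc L) * qpoch (a * q ^ Suc m) q (Suc L))"
    using Suc by simp
  show ?case
    unfolding sum.atMost_Suc IH
    unfolding unit_\<alpha>_def p1 p2 p3 e t1 t2 qpoch_Suc[of q q m] qpoch_Suc[of q q d]
      power_Suc[symmetric]
    using nz unfolding pw P_def[symmetric] 
    by (simp add: divide_simps) (simp add: algebra_simps power2_eq_square power3_eq_cube)
qed

lemma unit_bailey_pair:
  assumes a: "\<And>k. a * q ^ k \<noteq> 1"
  shows "(\<Sum>r\<le>L. unit_\<alpha> q a r / (qpoch q q (L - r) * qpoch (a * q ^ r) q (Suc L)))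
     = (if L = 0 then 1 else 0)"
proof (cases L)
  case 0
  then show ?thesis
    using a[of 0] by (simp add: unit_\<alpha>_def qpoch_Suc)
next
  case (Suc l)
  have p: "qpoch (a * q ^ Suc l) q (Suc (Suc l)) = qpoch (a * q ^ Suc l) q (Suc l) * (1 - a * q ^ (2 * Suc l))"
    unfolding qpoch_Suc[of _ q "Suc l"] by (simp only: power_add mult.assoc mult_2)
  have nz: "1 - a * q ^ (2 * Suc l) \<noteq> 0" "qpoch (a * q ^ Suc l) q (Suc l) \<noteq> 0"
    using a[of "2 * Suc l"] a[of "Suc l + _"] by (auto simp: qpoch_eq_0_iff power_add mult.assoc)
  have "unit_\<alpha> q a (Suc l) / (qpoch q q 0 * qpoch (a * q ^ Suc l) q (Suc (Suc l)))
     = - ((- 1) ^ l * q powi tri (int l) /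
        (qpoch q q l * qpoch q q 0 * (1 - q ^ Suc l) * qpoch (a * q ^ Suc l) q (Suc l)))"
    unfolding p unit_\<alpha>_def qpoch_Suc[of q q l] using nz by simp
  then show ?thesis
    using unit_bailey_pair_partial[OF a, of l l] by (simp add: Suc)
qed

text \<open>The beta of the unit pair is 1 at L = 0 and 0 elsewhere. One Bailey step already turns
  it into 1 / (q;q)_L, the base case of \<open>chain_sum\<close>; hence N nested sums take N + 1
  steps.\<close>

lemma chain_sum_eq:
  assumes a: "\<And>k. a * q ^ k \<noteq> 1"
  shows "chain_sum q a N L = (\<Sum>r\<le>L. (a ^ r * q ^ (r\<^sup>2)) ^ Suc N * unit_\<alpha> q a r /
     (qpoch q q (L - r) * qpoch (a * q ^ r) q (Suc L)))"
proof (induction N arbitrary: L)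
  case 0
  have "1 / qpoch q q L = (\<Sum>K\<le>L. a ^ K * q ^ (K\<^sup>2) * (if K = 0 then 1 else 0) / qpoch q q (L - K))"
    by (simp add: if_distrib if_distribR sum.delta cong: if_cong)
  also have "\<dots> = (\<Sum>r\<le>L. a ^ r * q ^ (r\<^sup>2) * unit_\<alpha> q a r / (qpoch q q (L - r) * qpoch (a * q ^ r) q (Suc L)))"
    by (rule bailey_step[OF a]) (auto simp: unit_bailey_pair[OF a])
  finally show ?case by simp
next
  case (Suc N)
  show ?case
    unfolding chain_sum.simps bailey_step[OF a Suc] by (simp add: mult_ac)
qed

lemma chain_sum_partial_fractions:
  assumes a: "\<And>k. a * q ^ k \<noteq> 1" and a0: "a \<noteq> 0"
  shows "chain_sum q a N L = (\<Sum>r\<le>L. \<Sum>n\<le>L.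
     (- 1) ^ (r + n) * q powi (int (Suc N) * int r ^ 2 + tri (int r - 1) + tri (int n) - (int r + int n) * (int L - int r))
      / (qpoch q q r * qpoch q q (L - r) * qpoch q q n * qpoch q q (L - n)) *
     (a powi (int (N + 2) * int r - int L) * (1 - a * q ^ (2 * r)) / (1 - a * q ^ (r + n))))"
  unfolding chain_sum_eq[OF a]
proof (rule sum.cong)
  fix r assume "r \<in> {..L}"
  then have r: "r \<le> L" by simp
  define x where "x = a * q ^ r"
  have x: "x * q ^ k \<noteq> 1" for k
    using a[of "r + k"] by (simp add: x_def power_add mult.assoc)
  have x0: "x \<noteq> 0" using a0 q0 by (simp add: x_def)
  \<comment> \<open>Inserting x^(L-r) uses the free exponent in
    \<open>qpoch_partial_fractions\<close>. The power of a becomes (N + 2) r - L, which for L = 2M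
    and after division by a^(NM) is (N + 2)(r - M): its sign depends on r - M alone.\<close>
  have "1 / qpoch x q (Suc L) = x ^ (L - r) / qpoch x q (Suc L) / x ^ (L - r)"
    using x0 by simp
  also have "x ^ (L - r) / qpoch x q (Suc L) = (\<Sum>n\<le>L. (- 1) ^ n *
     q powi (tri (int n) - int n * int (L - r)) / (1 - x * q ^ n) / (qpoch q q n * qpoch q q (L - n)))"
    by (rule qpoch_partial_fractions[OF q0 q1 x, symmetric]) simp
  finally have pf: "1 / qpoch x q (Suc L) = (\<Sum>n\<le>L. (- 1) ^ n *
     q powi (tri (int n) - int n * int (L - r)) / (1 - x * q ^ n) / (qpoch q q n * qpoch q q (L - n))) / x ^ (L - r)" .
  have ex: "(a ^ r * q ^ (r\<^sup>2)) ^ Suc N * q powi tri (int r - 1) *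
      (q powi (tri (int n) - int n * int (L - r)) / x ^ (L - r))
    = q powi (int (Suc N) * int r ^ 2 + tri (int r - 1) + tri (int n) - (int r + int n) * (int L - int r))
      * a powi (int (N + 2) * int r - int L)" for n
  proof -
    have 1: "(a ^ r * q ^ (r\<^sup>2)) ^ Suc N = a powi (int (Suc N) * int r) * q powi (int (Suc N) * int r ^ 2)"
      unfolding of_nat_mult[symmetric] of_nat_power[symmetric] power_int_of_nat
      by (simp only: power_mult_distrib power_mult[symmetric] mult.commute)
    have 2: "x ^ (L - r) = a powi (int L - int r) * q powi (int r * (int L - int r))"
      using r by (simp add: x_def power_mult_distrib power_int_of_nat flip: power_mult of_nat_diff of_nat_mult)
    have 3: "int (N + 2) * int r - int L = int (Suc N) * int r - (int L - int r)"
      by (simp add: algebra_simps)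
    have 4: "int (Suc N) * int r ^ 2 + tri (int r - 1) + tri (int n) - (int r + int n) * (int L - int r)
      = (int (Suc N) * int r ^ 2 + tri (int r - 1)) + (tri (int n) - int n * int (L - r)) - int r * (int L - int r)"
      using r by (simp add: algebra_simps of_nat_diff)
    show ?thesis
      unfolding 1 2 3 4 using q0 a0 by (simp add: power_int_add power_int_diff divide_simps)
  qed
  show "(a ^ r * q ^ (r\<^sup>2)) ^ Suc N * unit_\<alpha> q a r / (qpoch q q (L - r) * qpoch (a * q ^ r) q (Suc L)) =
    (\<Sum>n\<le>L. (- 1) ^ (r + n) * q powi (int (Suc N) * int r ^ 2 + tri (int r - 1) + tri (int n) - (int r + int n) * (int L - int r))
      / (qpoch q q r * qpoch q q (L - r) * qpoch q q n * qpoch q q (L - n)) *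
     (a powi (int (N + 2) * int r - int L) * (1 - a * q ^ (2 * r)) / (1 - a * q ^ (r + n))))" (is "?lhs = _")
  proof -
    have "?lhs = (a ^ r * q ^ (r\<^sup>2)) ^ Suc N * unit_\<alpha> q a r / qpoch q q (L - r) * (1 / qpoch x q (Suc L))"
      by (simp add: x_def)
    also have "\<dots> = (\<Sum>n\<le>L. (- 1) ^ (r + n) * ((a ^ r * q ^ (r\<^sup>2)) ^ Suc N * q powi tri (int r - 1) *
      (q powi (tri (int n) - int n * int (L - r)) / x ^ (L - r))) * (1 - a * q ^ (2 * r))
       / (qpoch q q r * qpoch q q (L - r) * (qpoch q q n * qpoch q q (L - n))) / (1 - x * q ^ n))"
      unfolding pf sum_divide_distrib sum_distrib_left unit_\<alpha>_def
      by (intro sum.cong) (simp_all add: power_add mult_ac)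
    finally show ?thesis
      unfolding ex by (simp add: x_def power_add mult_ac)
  qed
qed simp

end

section \<open>Chains and constant terms\<close>

text \<open>The chain 0 <= K_1 <= ... <= K_N <= L is stored by its increments k_i = K_i - K_(i-1),
  to match the tuples in \<open>Bindex\<close>.\<close>

definition chains :: "nat \<Rightarrow> nat \<Rightarrow> (nat \<Rightarrow> nat) set" where
  "chains N L = {k. (\<forall>i. i \<notin> {1..N} \<longrightarrow> k i = 0) \<and> sum k {1..N} \<le> L}"

lemma chains_0: "chains 0 L = {\<lambda>_. 0}"
  by (auto simp: chains_def)

lemma bij_betw_chains_Suc:
  "bij_betw (\<lambda>(K, k). k(Suc N := K - sum k {1..N})) (SIGMA K:{..L}. chains N K) (chains (Suc N) L)"
proof (rule bij_betw_byWitness[where f' = "\<lambda>k. (sum k {1..Suc N}, k(Suc N := 0))"])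
  show "\<forall>x\<in>SIGMA K:{..L}. chains N K. (\<lambda>k. (sum k {1..Suc N}, k(Suc N := 0)))
      ((\<lambda>(K, k). k(Suc N := K - sum k {1..N})) x) = x"
    by (auto simp: chains_def fun_eq_iff)
  show "\<forall>x\<in>chains (Suc N) L. (\<lambda>(K, k). k(Suc N := K - sum k {1..N}))
      ((\<lambda>k. (sum k {1..Suc N}, k(Suc N := 0))) x) = x"
    by (auto simp: chains_def fun_eq_iff)
  show "(\<lambda>(K, k). k(Suc N := K - sum k {1..N})) ` (SIGMA K:{..L}. chains N K) \<subseteq> chains (Suc N) L"
    by (auto simp: chains_def)
  show "(\<lambda>k. (sum k {1..Suc N}, k(Suc N := 0))) ` chains (Suc N) L \<subseteq> (SIGMA K:{..L}. chains N K)"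
    by (auto simp: chains_def)
qed

lemma finite_chains: "finite (chains N L)"
proof (induction N arbitrary: L)
  case 0
  then show ?case by (simp add: chains_0)
next
  case (Suc N)
  then show ?case
    using bij_betw_finite[OF bij_betw_chains_Suc[of N L]] by simp
qed

lemma chain_sum_eq_sum_chains:
  "chain_sum q a N L = (\<Sum>k\<in>chains N L. a ^ (\<Sum>i\<in>{1..N}. sum k {1..i}) *
     (q ^ (\<Sum>i\<in>{1..N}. (sum k {1..i})\<^sup>2) / ((\<Prod>i\<in>{1..N}. qpoch q q (k i)) * qpoch q q (L - sum k {1..N}))))"
proof (induction N arbitrary: L)
  case 0
  then show ?case by (simp add: chains_0)
next
  case (Suc N)
  define f where "f N L k = a ^ (\<Sum>i\<in>{1..N}. sum k {1..i}) *
     (q ^ (\<Sum>i\<in>{1..N}. (sum k {1..i})\<^sup>2) / ((\<Prod>i\<in>{1..N}. qpoch q q (k i)) * qpoch q q (L - sum k {1..N})))"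
    for N L and k :: "nat \<Rightarrow> nat"
  have IH: "chain_sum q a N K = (\<Sum>k\<in>chains N K. f N K k)" for K
    using Suc by (simp add: f_def)
  have "a ^ K * q ^ K\<^sup>2 * f N K k / qpoch q q (L - K) = f (Suc N) L (k(Suc N := K - sum k {1..N}))"
    if "k \<in> chains N K" for K k
  proof -
    let ?k = "k(Suc N := K - sum k {1..N})"
    have s: "sum ?k {1..Suc N} = K"
      using that by (auto simp: chains_def)
    have 1: "(\<Sum>i\<in>{1..Suc N}. sum ?k {1..i}) = (\<Sum>i\<in>{1..N}. sum k {1..i}) + K"
      using s by (simp del: sum.cl_ivl_Suc) simp
    have 2: "(\<Sum>i\<in>{1..Suc N}. (sum ?k {1..i})\<^sup>2) = (\<Sum>i\<in>{1..N}. (sum k {1..i})\<^sup>2) + K\<^sup>2"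
      using s by (simp del: sum.cl_ivl_Suc) simp
    have 3: "(\<Prod>i\<in>{1..Suc N}. qpoch q q (?k i)) = (\<Prod>i\<in>{1..N}. qpoch q q (k i)) * qpoch q q (K - sum k {1..N})"
      by simp
    show ?thesis
      unfolding f_def 1 2 3 s by (simp add: power_add mult_ac)
  qed
  then have "chain_sum q a (Suc N) L
     = (\<Sum>(K, k)\<in>(SIGMA K:{..L}. chains N K). f (Suc N) L (k(Suc N := K - sum k {1..N})))"
    by (simp add: IH sum_distrib_left sum_divide_distrib sum.Sigma finite_chains)
  also have "\<dots> = (\<Sum>k\<in>chains (Suc N) L. f (Suc N) L k)"
    by (subst sum.reindex_bij_betw[OF bij_betw_chains_Suc, symmetric]) (simp add: case_prod_unfold)
  finally show ?case unfolding f_def .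
qed

section \<open>Constant terms as limits of averages over points of a circle\<close>

definition circle_mean :: "real \<Rightarrow> nat \<Rightarrow> (complex \<Rightarrow> complex) \<Rightarrow> complex" where
  "circle_mean \<rho> n f = (\<Sum>k<n. f (of_real \<rho> * cis (2 * pi * real k / real n))) / of_nat n"

lemma circle_mean_sum: "circle_mean \<rho> n (\<lambda>z. \<Sum>i\<in>A. f i z) = (\<Sum>i\<in>A. circle_mean \<rho> n (f i))"
  unfolding circle_mean_def by (subst sum.swap) (simp add: sum_divide_distrib)

lemma circle_mean_cmult: "circle_mean \<rho> n (\<lambda>z. c * f z) = c * circle_mean \<rho> n f"
  by (simp add: circle_mean_def sum_distrib_left)

lemma circle_mean_diff: "circle_mean \<rho> n (\<lambda>z. f z - g z) = circle_mean \<rho> n f - circle_mean \<rho> n g"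
  by (simp add: circle_mean_def sum_subtractf diff_divide_distrib)

lemma circle_mean_cong:
  assumes "\<And>z. norm z = \<rho> \<Longrightarrow> f z = g z" and "\<rho> > 0"
  shows "circle_mean \<rho> n f = circle_mean \<rho> n g"
  unfolding circle_mean_def
  by (intro arg_cong2[where f = "(/)"] sum.cong refl assms(1)) (use assms(2) in \<open>simp add: norm_mult\<close>)

lemma circle_mean_powi:
  assumes "n > 0"
  shows "circle_mean \<rho> n (\<lambda>z. z powi j) = (if int n dvd j then of_real \<rho> powi j else 0)"
proof -
  define w where "w = cis (2 * pi * of_int j / real n)"
  have "circle_mean \<rho> n (\<lambda>z. z powi j) = of_real \<rho> powi j * (\<Sum>k<n. w ^ k) / of_nat n"
  proof -
    have "cis (2 * pi * real k / real n) powi j = w ^ k" for k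
      unfolding w_def Complex.DeMoivre cis_power_int by (simp add: mult_ac)
    then show ?thesis
      unfolding circle_mean_def by (simp add: power_int_mult_distrib sum_distrib_left)
  qed
  also have "\<dots> = (if int n dvd j then of_real \<rho> powi j else 0)"
  proof (cases "int n dvd j")
    case True
    then obtain l where "j = int n * l" by blast
    then have e: "2 * pi * of_int j / real n = 2 * pi * of_int l"
      using assms by simp
    have "w = 1" unfolding w_def e by (rule cis_multiple_2pi) simp
    then show ?thesis using True assms by simp
  next
    case False
    have "w \<noteq> 1"
    proof
      assume "w = 1"
      then have "cos (2 * pi * of_int j / real n) = 1"
        by (metis w_def cis.sel(1) one_complex.sel(1))
      then obtain m :: int where "2 * pi * of_int j / real n = of_int m * 2 * pi"
        by (auto simp: cos_one_2pi_int)
      then have "real_of_int j = of_int m * real n"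
        using assms by (simp add: field_simps)
      then have "j = m * int n"
        by (metis of_int_eq_iff of_int_mult of_int_of_nat_eq)
      then show False using False by simp
    qed
    moreover have "w ^ n = 1"
    proof -
      have "w ^ n = cis (2 * pi * of_int j)"
        unfolding w_def Complex.DeMoivre using assms by simp
      also have "\<dots> = 1" by (metis cis_multiple_2pi Ints_of_int)
      finally show ?thesis .
    qed
    ultimately show ?thesis using False by (simp add: geometric_sum)
  qed
  finally show ?thesis .
qed

lemma circle_mean_powi_tendsto:
  "(\<lambda>n. circle_mean \<rho> n (\<lambda>z. z powi j)) \<longlonglongrightarrow> (if j = 0 then 1 else 0)"
proof (rule tendsto_eventually)
  show "\<forall>\<^sub>F n in sequentially. circle_mean \<rho> n (\<lambda>z. z powi j) = (if j = 0 then 1 else 0)"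
    using eventually_gt_at_top[of "nat \<bar>j\<bar>"]
  proof eventually_elim
    case (elim n)
    then have n: "n > 0" "\<bar>j\<bar> < int n" by auto
    then have "int n dvd j \<longleftrightarrow> j = 0"
      using dvd_imp_le_int[of j "int n"] by auto
    then show ?case using n by (auto simp: circle_mean_powi)
  qed
qed

text \<open>At the n sample points (z c)^n has the constant value y^n, so 1 / (1 - z c) agrees there
  with the polynomial in z obtained by dividing the geometric sum of length n by 1 - y^n. Each
  average is thus known exactly, and only the behaviour of y^n remains: it tends to 0 if the pole
  lies outside the circle and dominates if it lies inside.\<close>

lemma circle_mean_geometric_tendsto:
  assumes "\<rho> > 0" and c: "c \<noteq> 0" and \<rho>c: "\<rho> * norm c \<noteq> 1"
  shows "(\<lambda>n. circle_mean \<rho> n (\<lambda>z. z powi j / (1 - z * c)))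
     \<longlonglongrightarrow> c powi (- j) * ((if j \<le> 0 then 1 else 0) - (if \<rho> * norm c > 1 then 1 else 0))"
proof -
  define y where "y = of_real \<rho> * c"
  have y: "norm y = \<rho> * norm c" "y \<noteq> 0"
    using assms by (simp_all add: y_def norm_mult)
  have yn: "y ^ n \<noteq> 1" if "n > 0" for n
  proof
    assume "y ^ n = 1"
    then have "norm y ^ n = 1" by (metis norm_one norm_power)
    then have "norm y = 1"
      using that power_eq_iff_eq_base[of n "norm y" 1] by simp
    then show False using \<rho>c y by simp
  qed
  have mean: "circle_mean \<rho> n (\<lambda>z. z powi j / (1 - z * c))
      = c powi (- j) * ((if j \<le> 0 then 1 else y ^ n) / (1 - y ^ n))" if n: "n > nat \<bar>j\<bar>" for n
  proof -
    have n0: "n > 0" using n by simp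
    have "circle_mean \<rho> n (\<lambda>z. z powi j / (1 - z * c))
        = circle_mean \<rho> n (\<lambda>z. \<Sum>i<n. (c ^ i / (1 - y ^ n)) * z powi (j + int i))"
      unfolding circle_mean_def
    proof (intro arg_cong2[where f = "(/)"] sum.cong refl)
      fix k assume "k \<in> {..<n}"
      define z where "z = of_real \<rho> * cis (2 * pi * real k / real n)"
      have z0: "z \<noteq> 0" using assms by (simp add: z_def)
      have "cis (2 * pi * real k / real n) ^ n = 1"
      proof -
        have e: "real n * (2 * pi * real k / real n) = 2 * pi * real k"
          using n0 by simp
        show ?thesis
          unfolding Complex.DeMoivre e by (rule cis_multiple_2pi) simp
      qed
      then have zn: "(z * c) ^ n = y ^ n"
        by (simp add: z_def y_def power_mult_distrib)
      have zc: "z * c \<noteq> 1" using yn[OF n0] zn by auto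
      have "1 / (1 - z * c) = (\<Sum>i<n. (z * c) ^ i) / (1 - y ^ n)"
        using geometric_sum[OF zc, of n] zc yn[OF n0] unfolding zn by (simp add: divide_simps) (simp add: algebra_simps)
      then have "z powi j / (1 - z * c) = z powi j * ((\<Sum>i<n. (z * c) ^ i) / (1 - y ^ n))"
        by (metis mult.right_neutral times_divide_eq_right)
      also have "\<dots> = (\<Sum>i<n. (c ^ i / (1 - y ^ n)) * z powi (j + int i))"
        using z0 by (simp add: sum_distrib_left sum_divide_distrib power_int_add power_mult_distrib mult_ac)
      finally show "z powi j / (1 - z * c) = (\<Sum>i<n. (c ^ i / (1 - y ^ n)) * z powi (j + int i))" .
    qed
    also have "\<dots> = (\<Sum>i<n. if int n dvd j + int i then (c ^ i / (1 - y ^ n)) * of_real \<rho> powi (j + int i) else 0)"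
      unfolding circle_mean_sum circle_mean_cmult circle_mean_powi[OF n0] by (simp add: if_distrib cong: if_cong)
    also have "\<dots> = c powi (- j) * ((if j \<le> 0 then 1 else y ^ n) / (1 - y ^ n))"
    proof -
      \<comment> \<open>The unique i < n for which n divides j + i. For j > 0 it is n - j, and the
        surplus n produces the factor y^n in the numerator.\<close>
      define i0 where "i0 = nat (if j \<le> 0 then - j else int n - j)"
      have i0: "i0 < n" using n by (auto simp: i0_def)
      have j0: "int i0 = (if j \<le> 0 then - j else int n - j)" using n by (auto simp: i0_def)
      have uniq: "int n dvd j + int i \<longleftrightarrow> i = i0" if "i < n" for i
      proof
        assume d: "int n dvd j + int i"
        have "int n dvd j + int i0" by (simp add: j0)
        with d have "int n dvd int i - int i0"
          by (metis add_diff_cancel_left dvd_diff)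
        moreover have "\<bar>int i - int i0\<bar> < int n" using that i0 by linarith
        ultimately have "int i - int i0 = 0" 
          by (metis dvd_imp_le_int abs_of_nat not_less)
        then show "i = i0" by simp
      qed (simp add: j0)
      have "(\<Sum>i<n. if int n dvd j + int i then (c ^ i / (1 - y ^ n)) * of_real \<rho> powi (j + int i) else 0)
         = (\<Sum>i<n. if i = i0 then (c ^ i / (1 - y ^ n)) * of_real \<rho> powi (j + int i) else 0)"
        using uniq by (intro sum.cong) auto
      also have "\<dots> = (c ^ i0 / (1 - y ^ n)) * of_real \<rho> powi (j + int i0)"
        using i0 by simp
      also have "c ^ i0 = c powi int i0" by simp
      also have "(c powi int i0 / (1 - y ^ n)) * of_real \<rho> powi (j + int i0)
          = c powi (- j) * ((if j \<le> 0 then 1 else y ^ n) / (1 - y ^ n))"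
        unfolding j0 using c by (simp add: y_def power_mult_distrib power_int_diff power_int_minus field_simps)
      finally show ?thesis .
    qed
    finally show ?thesis .
  qed
  have "(\<lambda>n. c powi (- j) * ((if j \<le> 0 then 1 else y ^ n) / (1 - y ^ n)))
     \<longlonglongrightarrow> c powi (- j) * ((if j \<le> 0 then 1 else 0) - (if norm y > 1 then 1 else 0))"
  proof (cases "norm y > 1")
    case False
    then have "norm y < 1" using y \<rho>c by simp
    then have lim: "(\<lambda>n. y ^ n) \<longlonglongrightarrow> 0" by (rule LIMSEQ_power_zero)
    then have num: "(\<lambda>n. if j \<le> 0 then 1 else y ^ n) \<longlonglongrightarrow> (if j \<le> 0 then 1 else 0)"
      by simp
    have "(\<lambda>n. c powi (- j) * ((if j \<le> 0 then 1 else y ^ n) / (1 - y ^ n)))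
     \<longlonglongrightarrow> c powi (- j) * ((if j \<le> 0 then 1 else 0) / (1 - 0))"
      by (intro tendsto_mult tendsto_divide tendsto_diff tendsto_const num lim) simp
    then show ?thesis using False by simp
  next
    case True
    then have "norm (inverse y) < 1" by (simp add: norm_inverse inverse_less_1_iff)
    then have lim: "(\<lambda>n. inverse y ^ n) \<longlonglongrightarrow> 0" by (rule LIMSEQ_power_zero)
    then have num: "(\<lambda>n. if j \<le> 0 then inverse y ^ n else 1) \<longlonglongrightarrow> (if j \<le> 0 then 0 else 1)"
      by simp
    have inv: "(\<lambda>n. c powi (- j) * ((if j \<le> 0 then inverse y ^ n else 1) / (inverse y ^ n - 1)))
     \<longlonglongrightarrow> c powi (- j) * ((if j \<le> 0 then 0 else 1) / (0 - 1))"
      by (intro tendsto_mult tendsto_divide tendsto_diff tendsto_const num lim) simp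
    have eq: "(if j \<le> 0 then inverse y ^ n else 1) / (inverse y ^ n - 1)
        = (if j \<le> 0 then 1 else y ^ n) / (1 - y ^ n)" if "n > 0" for n
      using y(2) yn[OF that] by (simp add: power_inverse divide_simps)
    have "(\<lambda>n. c powi (- j) * ((if j \<le> 0 then 1 else y ^ n) / (1 - y ^ n)))
     \<longlonglongrightarrow> c powi (- j) * ((if j \<le> 0 then 0 else 1) / (0 - 1))"
      by (rule Lim_transform_eventually[OF inv], rule eventually_mono[OF eventually_gt_at_top[of 0]]) (simp only: eq)
    then show ?thesis using True by (cases "j \<le> 0") simp_all
  qed
  then show ?thesis unfolding y(1)
    by (rule Lim_transform_eventually)
       (auto simp: mean intro: eventually_mono[OF eventually_gt_at_top[of "nat \<bar>j\<bar>"]])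
qed

section \<open>The constant term of the Bailey chain as a truncated Hecke-type sum\<close>

definition hecke_exp :: "nat \<Rightarrow> int \<Rightarrow> int \<Rightarrow> int" where
  "hecke_exp N U T = tri U + tri T + int (N + 1) * U * T"

definition qpoch_pair :: "complex \<Rightarrow> nat \<Rightarrow> int \<Rightarrow> complex" where
  "qpoch_pair q M U = qpoch q q (nat (int M - U)) * qpoch q q (nat (int M + U))"

lemma qpoch_pair_minus: "qpoch_pair q M (- U) = qpoch_pair q M U"
  by (simp add: qpoch_pair_def mult.commute)

text \<open>The K_i have mean M, so the exponent is the sum of (K_i - M)^2. Removing q^(N M^2) from
  the coefficient of a^(NM) is what lets it converge as M grows.\<close>

definition chain_coeff :: "complex \<Rightarrow> nat \<Rightarrow> nat \<Rightarrow> complex" where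
  "chain_coeff q N M = (\<Sum>k\<in>{k \<in> chains N (2 * M). (\<Sum>i\<in>{1..N}. sum k {1..i}) = N * M}.
     q powi ((\<Sum>i\<in>{1..N}. (int (sum k {1..i}))\<^sup>2) - int N * (int M)\<^sup>2) /
     ((\<Prod>i\<in>{1..N}. qpoch q q (k i)) * qpoch q q (2 * M - sum k {1..N})))"

text \<open>The radius x^(1/2 - l) has a half-integral exponent, so it misses every pole modulus
  x^(-m) and encloses exactly those with m < l.\<close>

lemma sqrt_power_quotient:
  fixes x :: real
  assumes "0 < x" "x < 1"
  shows "m < l \<Longrightarrow> sqrt x / x ^ l * x ^ m > 1" and "l \<le> m \<Longrightarrow> sqrt x / x ^ l * x ^ m < 1"
proof -
  have s: "sqrt x < 1" "0 < sqrt x" using assms by simp_all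
  have s2: "x < sqrt x"
    using s assms mult_strict_left_mono[of "sqrt x" 1 "sqrt x"] by simp
  show "sqrt x / x ^ l * x ^ m > 1" if "m < l"
  proof -
    have "x ^ l \<le> x ^ Suc m" using that assms by (intro power_decreasing) auto
    also have "\<dots> < sqrt x * x ^ m" using s2 assms by simp
    finally show ?thesis using assms by simp
  qed
  show "sqrt x / x ^ l * x ^ m < 1" if "l \<le> m"
  proof -
    have "sqrt x * x ^ m < 1 * x ^ m" using s assms by (intro mult_strict_right_mono) auto
    also have "\<dots> \<le> x ^ l" using that assms by simp
    finally show ?thesis using assms by simp
  qed
qed

text \<open>Constant term of z^j / (1 - z q^m) on a circle where |z q^m| > 1 exactly for m < l.\<close>

definition geometric_coeff :: "complex \<Rightarrow> nat \<Rightarrow> int \<Rightarrow> nat \<Rightarrow> complex" where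
  "geometric_coeff q l j m = q powi (- (int m * j)) * (of_bool (j \<le> 0) - of_bool (m < l))"

definition chain_weight :: "complex \<Rightarrow> nat \<Rightarrow> nat \<Rightarrow> nat \<Rightarrow> nat \<Rightarrow> complex" where
  "chain_weight q N L r n =
     (- 1) ^ (r + n) * q powi (int (Suc N) * int r ^ 2 + tri (int r - 1) + tri (int n) - (int r + int n) * (int L - int r))
      / (qpoch q q r * qpoch q q (L - r) * qpoch q q n * qpoch q q (L - n))"

definition hecke_term :: "complex \<Rightarrow> nat \<Rightarrow> int \<Rightarrow> int \<Rightarrow> complex" where
  "hecke_term q N U T = (- 1) powi (U + T) * q powi hecke_exp N U T"

lemma hecke_term_commute: "hecke_term q N U T = hecke_term q N T U"
  by (simp add: hecke_term_def hecke_exp_def algebra_simps)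

lemma sum_symmetric_interval:
  fixes f :: "int \<Rightarrow> 'a::comm_monoid_add"
  shows "(\<Sum>U\<in>{- int M..int M}. f (- U)) = (\<Sum>U\<in>{- int M..int M}. f U)"
  by (rule sum.reindex_bij_witness[where i = uminus and j = uminus]) auto

context
  fixes q :: complex
  assumes q0: "q \<noteq> 0" and q1: "norm q < 1"
begin

text \<open>On the circle, a^(-NM) times the chain sum is both a Laurent polynomial in a and a
  combination of terms a^j / (1 - a q^m). Agreement on the circle suffices to equate the averages,
  and their limits are the two sides.\<close>

lemma chain_coeff_eq_aux:
  "(\<Sum>k\<in>{k \<in> chains N (2 * M). (\<Sum>i\<in>{1..N}. sum k {1..i}) = N * M}.
     q ^ (\<Sum>i\<in>{1..N}. (sum k {1..i})\<^sup>2) / ((\<Prod>i\<in>{1..N}. qpoch q q (k i)) * qpoch q q (2 * M - sum k {1..N})))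
   = (\<Sum>r\<le>2 * M. \<Sum>n\<le>2 * M. chain_weight q N (2 * M) r n *
        (geometric_coeff q (2 * M) (int (N + 2) * (int r - int M)) (r + n)
          - q ^ (2 * r) * geometric_coeff q (2 * M) (int (N + 2) * (int r - int M) + 1) (r + n)))"
proof -
  define L where "L = 2 * M"
  \<comment> \<open>The enclosed poles are those with r + n < 2M, that is T < U once r = M - U and n
    = M + T.\<close>
  define \<rho> where "\<rho> = sqrt (norm q) / norm q ^ L"
  have nq: "0 < norm q" using q0 by simp
  have \<rho>: "\<rho> > 0" using nq by (simp add: \<rho>_def)
  have \<rho>m': "m < L \<Longrightarrow> \<rho> * norm (q ^ m) > 1" "L \<le> m \<Longrightarrow> \<rho> * norm (q ^ m) < 1" for m
    using sqrt_power_quotient[OF nq q1] by (simp_all add: \<rho>_def norm_power)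
  have \<rho>m: "\<rho> * norm (q ^ m) \<noteq> 1" "\<rho> * norm (q ^ m) > 1 \<longleftrightarrow> m < L" for m
    using \<rho>m'[of m] by (cases "m < L"; simp)+
  define v where "v k = q ^ (\<Sum>i\<in>{1..N}. (sum k {1..i})\<^sup>2) /
     ((\<Prod>i\<in>{1..N}. qpoch q q (k i)) * qpoch q q (L - sum k {1..N}))" for k
  define e where "e k = (\<Sum>i\<in>{1..N}. sum k {1..i})" for k :: "nat \<Rightarrow> nat"
  define f where "f a = (\<Sum>k\<in>chains N L. v k * a powi (int (e k) - int (N * M)))" for a
  define h where "h a = (\<Sum>r\<le>L. \<Sum>n\<le>L. chain_weight q N L r n *
     (a powi (int (N + 2) * (int r - int M)) / (1 - a * q ^ (r + n))
      - q ^ (2 * r) * (a powi (int (N + 2) * (int r - int M) + 1) / (1 - a * q ^ (r + n)))))" for a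
  have fh: "f a = h a" if a: "norm a = \<rho>" for a
  proof -
    have a0: "a \<noteq> 0" using a \<rho> by auto
    have aq: "a * q ^ k \<noteq> 1" for k
      using a \<rho>m(1)[of k] by (metis norm_mult norm_one)
    have shift: "w * a powi (int s - x) = a powi (- x) * (a ^ s * w)" for w s x
      using a0 by (simp add: power_int_diff power_int_minus divide_inverse mult_ac)
    have "f a = a powi (- int (N * M)) * chain_sum q a N L"
      unfolding f_def chain_sum_eq_sum_chains sum_distrib_left v_def e_def shift ..
    also have "\<dots> = h a"
      unfolding chain_sum_partial_fractions[OF q0 q1 aq a0] h_def sum_distrib_left
    proof (intro sum.cong refl)
      fix r n assume "r \<in> {..L}" "n \<in> {..L}"
      have 1: "a powi (int (N + 2) * int r - int L) = a powi int (N * M) * a powi (int (N + 2) * (int r - int M))"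
        using a0 by (simp add: L_def algebra_simps flip: power_int_add)
      have 2: "a powi (int (N + 2) * (int r - int M) + 1) = a powi (int (N + 2) * (int r - int M)) * a"
        using a0 by (simp add: power_int_add)
      have 3: "a powi (- int (N * M)) * (w * (a powi int (N * M) * y * (1 - a * z) / x))
          = w * (y / x - z * (y * a / x))" for w x y z
        using a0 by (simp add: power_int_minus field_simps) (simp add: diff_divide_distrib)
      show "a powi - int (N * M) * ((- 1) ^ (r + n) *
          q powi (int (Suc N) * (int r)\<^sup>2 + tri (int r - 1) + tri (int n) - (int r + int n) * (int L - int r)) /
          (qpoch q q r * qpoch q q (L - r) * qpoch q q n * qpoch q q (L - n)) *
          (a powi (int (N + 2) * int r - int L) * (1 - a * q ^ (2 * r)) / (1 - a * q ^ (r + n)))) =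
         chain_weight q N L r n * (a powi (int (N + 2) * (int r - int M)) / (1 - a * q ^ (r + n)) -
          q ^ (2 * r) * (a powi (int (N + 2) * (int r - int M) + 1) / (1 - a * q ^ (r + n))))"
        unfolding 1 2 3 chain_weight_def ..
    qed
    finally show ?thesis .
  qed
  have "(\<lambda>n. circle_mean \<rho> n f) \<longlonglongrightarrow> (\<Sum>k\<in>chains N L. v k * (if int (e k) - int (N * M) = 0 then 1 else 0))"
    unfolding f_def circle_mean_sum circle_mean_cmult
    by (intro tendsto_sum tendsto_mult tendsto_const circle_mean_powi_tendsto)
  also have "(\<lambda>n. circle_mean \<rho> n f) = (\<lambda>n. circle_mean \<rho> n h)"
    using fh \<rho> by (intro ext circle_mean_cong) auto
  finally have lim1: "(\<lambda>n. circle_mean \<rho> n h) \<longlonglongrightarrow>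
      (\<Sum>k\<in>chains N L. v k * (if int (e k) - int (N * M) = 0 then 1 else 0))" .
  have gm: "(\<lambda>k. circle_mean \<rho> k (\<lambda>z. z powi j / (1 - z * q ^ m))) \<longlonglongrightarrow> geometric_coeff q L j m" for j m
  proof -
    have "(q ^ m) powi (- j) = q powi (- (int m * j))"
      by (metis mult_minus_right power_int_mult power_int_of_nat)
    then show ?thesis
      using circle_mean_geometric_tendsto[OF \<rho> _ \<rho>m(1), of m j] q0
      unfolding \<rho>m(2) geometric_coeff_def of_bool_def by simp
  qed
  have "(\<lambda>n. circle_mean \<rho> n h) \<longlonglongrightarrow> (\<Sum>r\<le>L. \<Sum>n\<le>L. chain_weight q N L r n *
        (geometric_coeff q L (int (N + 2) * (int r - int M)) (r + n)
          - q ^ (2 * r) * geometric_coeff q L (int (N + 2) * (int r - int M) + 1) (r + n)))"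
    unfolding h_def circle_mean_sum circle_mean_cmult circle_mean_diff
    by (intro tendsto_sum tendsto_mult tendsto_diff tendsto_const gm)
  from LIMSEQ_unique[OF lim1 this]
  have "(\<Sum>k\<in>chains N L. v k * (if int (e k) - int (N * M) = 0 then 1 else 0)) =
     (\<Sum>r\<le>L. \<Sum>n\<le>L. chain_weight q N L r n *
        (geometric_coeff q L (int (N + 2) * (int r - int M)) (r + n)
          - q ^ (2 * r) * geometric_coeff q L (int (N + 2) * (int r - int M) + 1) (r + n)))" .
  moreover have "(\<Sum>k\<in>chains N L. v k * (if int (e k) - int (N * M) = 0 then 1 else 0))
      = (\<Sum>k\<in>{k \<in> chains N L. e k = N * M}. v k)"
    unfolding sum.inter_filter[OF finite_chains] by (intro sum.cong) (auto simp flip: of_nat_mult)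
  ultimately show ?thesis
    unfolding L_def v_def e_def by simp
qed

text \<open>The two parts of the numerator 1 - a q^(2r) yield a term at (U, T) and one at (-U, -T).
  After reflecting the latter, the sum still contains the comparisons T < U and T > U with opposite
  signs; averaging with the sum in which U and T are swapped cancels them. What remains is twice the
  indicator U >= 0 minus the indicator T < 0.\<close>

lemma chain_coeff_eq:
  "chain_coeff q N M = (\<Sum>U\<in>{- int M..int M}. \<Sum>T\<in>{- int M..int M}.
     (of_bool (U \<ge> 0) - of_bool (T < 0)) * hecke_term q N U T / (qpoch_pair q M U * qpoch_pair q M T))"
proof -
  define I where "I = {- int M..int M}"
  define g where "g U T = hecke_term q N U T / (qpoch_pair q M U * qpoch_pair q M T)" for U T
  have gcomm: "g U T = g T U" for U T
    by (simp add: g_def hecke_term_commute[of q N U T] mult.commute)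
  define Q where "Q = q powi (- (int N * (int M)\<^sup>2))"
  have "chain_coeff q N M = Q * (\<Sum>k\<in>{k \<in> chains N (2 * M). (\<Sum>i\<in>{1..N}. sum k {1..i}) = N * M}.
     q ^ (\<Sum>i\<in>{1..N}. (sum k {1..i})\<^sup>2) / ((\<Prod>i\<in>{1..N}. qpoch q q (k i)) * qpoch q q (2 * M - sum k {1..N})))"
    unfolding chain_coeff_def sum_distrib_left Q_def
  proof (intro sum.cong refl)
    fix k :: "nat \<Rightarrow> nat"
    have 1: "(\<Sum>i\<in>{1..N}. (int (sum k {1..i}))\<^sup>2) = int (\<Sum>i\<in>{1..N}. (sum k {1..i})\<^sup>2)"
      by simp
    have 2: "q powi (int s - x) / d = q powi (- x) * (q ^ s / d)" for s x d
      using q0 by (simp add: power_int_diff power_int_minus divide_inverse mult_ac)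
    show "q powi ((\<Sum>i\<in>{1..N}. (int (sum k {1..i}))\<^sup>2) - int N * (int M)\<^sup>2) /
       ((\<Prod>i\<in>{1..N}. qpoch q q (k i)) * qpoch q q (2 * M - sum k {1..N}))
     = q powi (- (int N * (int M)\<^sup>2)) * (q ^ (\<Sum>i\<in>{1..N}. (sum k {1..i})\<^sup>2) /
       ((\<Prod>i\<in>{1..N}. qpoch q q (k i)) * qpoch q q (2 * M - sum k {1..N})))"
      unfolding 1 by (rule 2)
  qed
  also have "\<dots> = (\<Sum>r\<le>2 * M. \<Sum>n\<le>2 * M. Q * (chain_weight q N (2 * M) r n *
        (geometric_coeff q (2 * M) (int (N + 2) * (int r - int M)) (r + n)
          - q ^ (2 * r) * geometric_coeff q (2 * M) (int (N + 2) * (int r - int M) + 1) (r + n))))"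
    unfolding chain_coeff_eq_aux sum_distrib_left ..
  also have "\<dots> = (\<Sum>U\<in>I. \<Sum>T\<in>I. g U T * (of_bool (U \<ge> 0) - of_bool (T < U))
      - g (- U) (- T) * (of_bool (U \<ge> 1) - of_bool (T < U)))"
  proof (rule sum.reindex_bij_witness[where i = "\<lambda>U. nat (int M - U)" and j = "\<lambda>r. int M - int r"])
    fix r assume r: "r \<in> {..2 * M}"
    define U where "U = int M - int r"
    show "(\<Sum>T\<in>I. g (int M - int r) T * (of_bool (int M - int r \<ge> 0) - of_bool (T < int M - int r))
      - g (- (int M - int r)) (- T) * (of_bool (int M - int r \<ge> 1) - of_bool (T < int M - int r)))
       = (\<Sum>n\<le>2 * M. Q * (chain_weight q N (2 * M) r n *
        (geometric_coeff q (2 * M) (int (N + 2) * (int r - int M)) (r + n)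
          - q ^ (2 * r) * geometric_coeff q (2 * M) (int (N + 2) * (int r - int M) + 1) (r + n))))"
      unfolding U_def[symmetric]
    proof (rule sum.reindex_bij_witness[where j = "\<lambda>T. nat (int M + T)" and i = "\<lambda>n. int n - int M"])
      fix T assume T: "T \<in> I"
      define n where "n = nat (int M + T)"
      have n: "int n = int M + T" using T by (simp add: n_def I_def)
      have r': "int r = int M - U" by (simp add: U_def)
      have pairs: "qpoch q q r * qpoch q q (2 * M - r) * qpoch q q n * qpoch q q (2 * M - n)
          = qpoch_pair q M U * qpoch_pair q M T"
      proof -
        have "nat (int M - U) = r" "nat (int M + U) = 2 * M - r" "nat (int M + T) = n" "nat (int M - T) = 2 * M - n"
          using r T n by (auto simp: U_def I_def)
        then show ?thesis by (simp add: qpoch_pair_def mult_ac)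
      qed
      have sgn: "(- 1) ^ (r + n) = ((- 1) powi (U + T) :: complex)"
      proof -
        have "(- 1) ^ (r + n) = ((- 1) powi (int r + int n) :: complex)"
          by (metis of_nat_add power_int_of_nat)
        also have "int r + int n = (U + T) + 2 * (int M - U)" by (simp add: n r')
        also have "(- 1) powi \<dots> = ((- 1) powi (U + T) :: complex)"
          by (subst power_int_add) (simp_all add: power_int_mult)
        finally show ?thesis .
      qed
      define B where "B = int (Suc N) * int r ^ 2 + tri (int r - 1) + tri (int n) - (int r + int n) * (int (2 * M) - int r)"
      have E1: "- (int N * (int M)\<^sup>2) + B - int (r + n) * (int (N + 2) * (int r - int M)) = hecke_exp N U T"
        unfolding B_def hecke_exp_def of_nat_add n r'
        using two_tri[of "int M"] by (simp add: tri_add tri_diff algebra_simps power2_eq_square)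
      \<comment> \<open>The second part of the numerator brings a further factor a q^(2r). Its
        effect on the exponent is -U - T, which is also the change of \<open>hecke_exp\<close> under
        negating both arguments.\<close>
      have E2: "- (int N * (int M)\<^sup>2) + B + 2 * int r - int (r + n) * (int (N + 2) * (int r - int M) + 1) = hecke_exp N (- U) (- T)"
      proof -
        have "2 * int r - int (r + n) = - U - T"
          by (simp add: n r')
        moreover have "hecke_exp N (- U) (- T) = hecke_exp N U T - U - T"
          by (simp add: hecke_exp_def tri_minus)
        ultimately show ?thesis
          using E1 by (simp add: algebra_simps)
      qed
      have c1: "int (N + 2) * (int r - int M) \<le> 0 \<longleftrightarrow> U \<ge> 0"
        unfolding mult_le_0_iff using r' by auto
      \<comment> \<open>The extra 1 makes the inequality strict. After reflection U >= 1 becomes U <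
        0, the complement of the condition U >= 0 in the first part.\<close>
      have c2: "int (N + 2) * (int r - int M) + 1 \<le> 0 \<longleftrightarrow> U \<ge> 1"
      proof -
        have "int (N + 2) * (int r - int M) + 1 \<le> 0 \<longleftrightarrow> int (N + 2) * (int r - int M) < 0" by linarith
        also have "\<dots> \<longleftrightarrow> U \<ge> 1" unfolding mult_less_0_iff using r' by auto
        finally show ?thesis .
      qed
      have c3: "r + n < 2 * M \<longleftrightarrow> T < U"
        using n r' by linarith
      have t1: "Q * (chain_weight q N (2 * M) r n * geometric_coeff q (2 * M) (int (N + 2) * (int r - int M)) (r + n))
         = g U T * (of_bool (U \<ge> 0) - of_bool (T < U))"
      proof -
        have "Q * q powi B * q powi (- (int (r + n) * (int (N + 2) * (int r - int M)))) = q powi hecke_exp N U T"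
          unfolding E1[symmetric] Q_def using q0 by (simp only: power_int_add[OF disjI1[OF q0], symmetric]) simp
        note E = this[symmetric]
        show ?thesis
          unfolding chain_weight_def geometric_coeff_def B_def[symmetric] c1 c3 pairs sgn g_def hecke_term_def E
          by (simp only: times_divide_eq_left times_divide_eq_right mult_ac)
      qed
      have t2: "Q * (chain_weight q N (2 * M) r n * (q ^ (2 * r) * geometric_coeff q (2 * M) (int (N + 2) * (int r - int M) + 1) (r + n)))
         = g (- U) (- T) * (of_bool (U \<ge> 1) - of_bool (T < U))"
      proof -
        have "q ^ (2 * r) = q powi (2 * int r)"
          by (metis power_int_of_nat of_nat_mult of_nat_numeral)
        then have "Q * q powi B * q ^ (2 * r) * q powi (- (int (r + n) * (int (N + 2) * (int r - int M) + 1))) = q powi hecke_exp N (- U) (- T)"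
          unfolding E2[symmetric] Q_def using q0 by (simp only: power_int_add[OF disjI1[OF q0], symmetric]) simp
        note E = this[symmetric]
        have S: "(- 1) powi (- U + - T) = ((- 1) powi (U + T) :: complex)"
          by (metis minus_add_distrib power_int_minus_one_minus)
        show ?thesis
          unfolding chain_weight_def geometric_coeff_def B_def[symmetric] c2 c3 pairs sgn g_def hecke_term_def
            qpoch_pair_minus E S
          by (simp only: times_divide_eq_left times_divide_eq_right mult_ac)
      qed
      show "Q * (chain_weight q N (2 * M) r (nat (int M + T)) *
        (geometric_coeff q (2 * M) (int (N + 2) * (int r - int M)) (r + nat (int M + T))
          - q ^ (2 * r) * geometric_coeff q (2 * M) (int (N + 2) * (int r - int M) + 1) (r + nat (int M + T))))
        = g U T * (of_bool (U \<ge> 0) - of_bool (T < U)) - g (- U) (- T) * (of_bool (U \<ge> 1) - of_bool (T < U))"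
        unfolding n_def[symmetric] right_diff_distrib[of "chain_weight q N (2 * M) r n"] right_diff_distrib[of Q] t1 t2 ..
    qed (auto simp: I_def)
  qed (auto simp: I_def)
  also have "\<dots> = (\<Sum>U\<in>I. \<Sum>T\<in>I. g U T * (of_bool (U \<ge> 0) - of_bool (T < U)))
      - (\<Sum>U\<in>I. \<Sum>T\<in>I. g (- U) (- T) * (of_bool (U \<ge> 1) - of_bool (T < U)))"
    by (simp add: sum_subtractf)
  also have "(\<Sum>U\<in>I. \<Sum>T\<in>I. g (- U) (- T) * (of_bool (U \<ge> 1) - of_bool (T < U)))
     = (\<Sum>U\<in>I. \<Sum>T\<in>I. g U T * (of_bool (U < 0) - of_bool (T > U)))"
  proof -
    have "(\<Sum>U\<in>I. \<Sum>T\<in>I. g (- U) (- T) * (of_bool (U \<ge> 1) - of_bool (T < U)))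
      = (\<Sum>U\<in>I. \<Sum>T\<in>I. g (- U) (- T) * (of_bool (- U < 0) - of_bool (- T > - U)))"
      by (intro sum.cong refl arg_cong2[where f = "(*)"] arg_cong2[where f = "(-)"]) auto
    also have "\<dots> = (\<Sum>U\<in>I. \<Sum>T\<in>I. g U T * (of_bool (U < 0) - of_bool (T > U)))"
      unfolding I_def
      by (subst sum_symmetric_interval[where f = "\<lambda>T. g (- U) T * (of_bool (- U < 0) - of_bool (T > - U))" for U])
         (rule sum_symmetric_interval)
    finally show ?thesis .
  qed
  also have "(\<Sum>U\<in>I. \<Sum>T\<in>I. g U T * (of_bool (U \<ge> 0) - of_bool (T < U)))
      - (\<Sum>U\<in>I. \<Sum>T\<in>I. g U T * (of_bool (U < 0) - of_bool (T > U)))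
    = (\<Sum>U\<in>I. \<Sum>T\<in>I. g U T * (of_bool (U \<ge> 0) - of_bool (T < U) - of_bool (U < 0) + of_bool (T > U)))"
    (is "_ = ?S")
    unfolding sum_subtractf[symmetric] by (simp add: algebra_simps)
  also have "?S = (\<Sum>U\<in>I. \<Sum>T\<in>I. (of_bool (U \<ge> 0) - of_bool (T < 0)) * g U T)"
  proof -
    have "?S = (\<Sum>U\<in>I. \<Sum>T\<in>I. g U T * (of_bool (T \<ge> 0) - of_bool (U < T) - of_bool (T < 0) + of_bool (U > T)))"
      by (subst sum.swap) (simp add: gcomm)
    then have "2 * ?S = ?S + \<dots>" by simp
    also have "\<dots> = (\<Sum>U\<in>I. \<Sum>T\<in>I. 2 * ((of_bool (U \<ge> 0) - of_bool (T < 0)) * g U T))"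
      unfolding sum.distrib[symmetric] by (intro sum.cong refl) (auto simp: of_bool_def algebra_simps)
    finally show ?thesis by (simp flip: sum_distrib_left)
  qed
  finally show ?thesis unfolding g_def I_def by simp
qed

end

section \<open>Dominated convergence and theta series\<close>

text \<open>Tannery's theorem. The sums \<open>S\<close> are given separately so that a finite
  identity, extended by zero to the whole index set, can enter with its closed form as the
  convergent sequence.\<close>

lemma infsum_dominated_convergence:
  fixes f :: "nat \<Rightarrow> 'a \<Rightarrow> 'b::banach"
  assumes lim: "\<And>k. k \<in> A \<Longrightarrow> (\<lambda>n. f n k) \<longlonglongrightarrow> g k"
    and bound: "\<And>n k. k \<in> A \<Longrightarrow> norm (f n k) \<le> h k"
    and h: "h summable_on A"
    and S: "\<And>n. (f n has_sum S n) A"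
  shows "g summable_on A" and "S \<longlonglongrightarrow> infsum g A"
proof -
  have bound_g: "norm (g k) \<le> h k" if "k \<in> A" for k
    by (rule Lim_bounded[OF tendsto_norm[OF lim[OF that]], of 0]) (use bound that in auto)
  have h0: "h k \<ge> 0" if "k \<in> A" for k
    using bound_g[OF that] norm_ge_zero order_trans by blast
  show g: "g summable_on A"
  proof (rule abs_summable_summable)
    show "(\<lambda>x. norm (g x)) summable_on A"
      by (rule summable_on_comparison_test[OF h]) (use bound_g in auto)
  qed
  show "S \<longlonglongrightarrow> infsum g A"
  proof (rule LIMSEQ_I)
    fix e :: real assume "e > 0"
    then have e3: "e / 3 > 0" by simp
    obtain F where F: "finite F" "F \<subseteq> A" "dist (sum h F) (infsum h A) \<le> e / 3"
      using has_sum_finite_approximation[OF has_sum_infsum[OF h] e3] by auto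
    have tail: "norm (t - sum k F) \<le> e / 3" if k: "(k has_sum t) A" and kh: "\<forall>x\<in>A. norm (k x) \<le> h x"
      for k :: "'a \<Rightarrow> 'b" and t
    proof -
      have 1: "(k has_sum t - sum k F) (A - F)"
        by (intro has_sum_Diff k has_sum_finite F)
      have 2: "(h has_sum infsum h A - sum h F) (A - F)"
        by (intro has_sum_Diff has_sum_finite F has_sum_infsum h)
      have "norm (t - sum k F) \<le> infsum h A - sum h F"
        by (rule norm_infsum_le[OF 1 2]) (use kh in auto)
      then show ?thesis using F(3) unfolding dist_real_def by linarith
    qed
    have "(\<lambda>n. sum (f n) F) \<longlonglongrightarrow> sum g F"
      using F lim by (intro tendsto_sum) auto
    from LIMSEQ_D[OF this e3] obtain n0 where n0: "\<And>n. n \<ge> n0 \<Longrightarrow> norm (sum (f n) F - sum g F) < e / 3"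
      by auto
    show "\<exists>no. \<forall>n\<ge>no. norm (S n - infsum g A) < e"
    proof (intro exI allI impI)
      fix n assume n: "n0 \<le> n"
      have "norm (S n - sum (f n) F) \<le> e / 3" "norm (infsum g A - sum g F) \<le> e / 3"
        by (rule tail[OF S], use bound in blast) (rule tail[OF has_sum_infsum[OF g]], use bound_g in blast)
      moreover have "S n - infsum g A = (S n - sum (f n) F) + (sum (f n) F - sum g F) - (infsum g A - sum g F)"
        by simp
      ultimately show "norm (S n - infsum g A) < e"
        using n0[OF n] norm_triangle_ineq4[of "(S n - sum (f n) F) + (sum (f n) F - sum g F)" "infsum g A - sum g F"]
          norm_triangle_ineq[of "S n - sum (f n) F" "sum (f n) F - sum g F"] by simp
    qed
  qed
qed

lemma filterlim_nat_add_int: "filterlim (\<lambda>M. nat (int M + U)) at_top sequentially"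
  unfolding filterlim_at_top
proof
  fix Z :: nat
  show "\<forall>\<^sub>F M in sequentially. Z \<le> nat (int M + U)"
    by (rule eventually_mono[OF eventually_ge_at_top[of "Z + nat \<bar>U\<bar>"]]) linarith
qed

lemma summable_on_nat_int:
  fixes f :: "int \<Rightarrow> real"
  assumes "(\<lambda>n. f (int n)) summable_on UNIV" "(\<lambda>n. f (- int n - 1)) summable_on UNIV"
  shows "f summable_on UNIV"
proof -
  have "(int ` UNIV) = {0..}"
    by (auto simp: image_iff intro!: exI[of _ "nat _"])
  then have 1: "f summable_on {0..}"
    using summable_on_reindex[of int UNIV f] assms(1) by (simp add: o_def)
  have "(\<lambda>n. - int n - 1) ` UNIV = {..<0}"
    by (auto simp: image_iff intro!: exI[of _ "nat (- _ - 1)"])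
  then have 2: "f summable_on {..<0}"
    using summable_on_reindex[of "\<lambda>n. - int n - 1" UNIV f] assms(2) by (simp add: o_def inj_on_def)
  have "f summable_on {0..} \<union> {..<0}"
    by (rule summable_on_Un_disjoint[OF 1 2]) auto
  also have "{0..} \<union> {..<0} = (UNIV :: int set)" by auto
  finally show ?thesis .
qed

lemma summable_on_geometric_nat:
  fixes x :: real
  assumes "0 \<le> x" "x < 1"
  shows "(\<lambda>n. x ^ n) summable_on (UNIV :: nat set)"
  using assms by (intro summable_nonneg_imp_summable_on summable_geometric) auto

lemma summable_on_geometric_int:
  fixes x :: real
  assumes "0 \<le> x" "x < 1"
  shows "(\<lambda>n. x ^ nat \<bar>n\<bar>) summable_on (UNIV :: int set)"
proof (rule summable_on_nat_int)
  show "(\<lambda>n. x ^ nat \<bar>int n\<bar>) summable_on UNIV"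
    using summable_on_geometric_nat[OF assms] by simp
  have "nat \<bar>- int n - 1\<bar> = Suc n" for n by simp
  then show "(\<lambda>n. x ^ nat \<bar>- int n - 1\<bar>) summable_on UNIV"
    using summable_on_cmult_right[OF summable_on_geometric_nat[OF assms], of x] by simp
qed

lemma summable_on_product_nonneg:
  fixes f :: "'a \<Rightarrow> real" and g :: "'b \<Rightarrow> real"
  assumes "f summable_on A" "g summable_on B" "\<And>x. f x \<ge> 0" "\<And>y. g y \<ge> 0"
  shows "(\<lambda>(x, y). f x * g y) summable_on A \<times> B"
proof -
  have "(\<lambda>p. norm ((\<lambda>(x, y). f x * g y) p)) summable_on A \<times> B"
    unfolding Infinite_Sum.abs_summable_on_Sigma_iff using assms
    by (auto simp: abs_mult infsum_cmult_right' intro!: summable_on_cmult_right summable_on_cmult_left infsum_nonneg)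
  moreover have "norm ((\<lambda>(x, y). f x * g y) p) = (\<lambda>(x, y). f x * g y) p" for p
    using assms(3,4) by (cases p) simp
  ultimately show ?thesis by (simp only:)
qed

lemma summable_on_geometric_int_prod:
  fixes x :: real
  assumes "0 \<le> x" "x < 1"
  shows "(\<lambda>(m, n). x ^ nat \<bar>m\<bar> * x ^ nat \<bar>n\<bar>) summable_on (UNIV :: (int \<times> int) set)"
  using summable_on_product_nonneg[OF summable_on_geometric_int[OF assms] summable_on_geometric_int[OF assms]] assms
  by simp

section \<open>Infinite products and the Jacobi triple product\<close>

context
  fixes q :: complex
  assumes q0: "q \<noteq> 0" and q1: "norm q < 1"
begin

lemma convergent_prod_qpoch: "convergent_prod (\<lambda>k. 1 - a * q ^ k)"
proof (rule abs_convergent_prod_imp_convergent_prod)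
  have "summable (\<lambda>k. norm a * norm q ^ k)"
    using q1 by (intro summable_mult summable_geometric) simp
  then show "abs_convergent_prod (\<lambda>k. 1 - a * q ^ k)"
    unfolding abs_convergent_prod_conv_summable by (simp add: norm_mult norm_power)
qed

lemma qpoch_tendsto: "(\<lambda>n. qpoch a q n) \<longlonglongrightarrow> qpoch_inf a q"
  unfolding qpoch_def qpoch_inf_def
  using convergent_prod_LIMSEQ[OF convergent_prod_qpoch] LIMSEQ_lessThan_iff_atMost by blast

lemma qpoch_tendsto_nat_int: "(\<lambda>M. qpoch a q (nat (int M + U))) \<longlonglongrightarrow> qpoch_inf a q"
  by (rule filterlim_compose[OF qpoch_tendsto filterlim_nat_add_int])

lemma qpoch_pair_tendsto: "(\<lambda>M. qpoch_pair q M U) \<longlonglongrightarrow> qpoch_inf q q * qpoch_inf q q"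
  using tendsto_mult[OF qpoch_tendsto_nat_int[of q "- U"] qpoch_tendsto_nat_int[of q U]]
  by (simp add: qpoch_pair_def)

lemma qpoch_inf_neq_0: "(\<And>k. a * q ^ k \<noteq> 1) \<Longrightarrow> qpoch_inf a q \<noteq> 0"
  unfolding qpoch_inf_def by (rule prodinf_nonzero[OF convergent_prod_qpoch]) auto

lemma qpoch_inf_self_neq_0: "qpoch_inf q q \<noteq> 0"
  by (rule qpoch_inf_neq_0) (rule q_neq_1[OF q0 q1])

lemma qpoch_bounded: "\<exists>C. \<forall>n. norm (qpoch a q n) \<le> C"
  using convergent_imp_Bseq[OF convergentI[OF qpoch_tendsto]] by (auto simp: Bseq_def)

lemma inverse_qpoch_bounded: "\<exists>C. \<forall>n. norm (1 / qpoch q q n) \<le> C"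
proof -
  have "(\<lambda>n. 1 / qpoch q q n) \<longlonglongrightarrow> 1 / qpoch_inf q q"
    by (intro tendsto_divide tendsto_const qpoch_tendsto qpoch_inf_self_neq_0)
  then show ?thesis
    using convergent_imp_Bseq[OF convergentI] by (fastforce simp: Bseq_def)
qed

lemma norm_power_int_antimono: "a \<le> b \<Longrightarrow> norm (q powi b) \<le> norm (q powi a)"
  unfolding norm_power_int using q0 q1 by (intro power_int_decreasing) auto

text \<open>A quadratic exponent beats any geometric growth: m is chosen with max(|c|, 1/|c|) |q|^m
  < 1, and completing a square gives tri n >= m |n| - (m+1)^2. The majorant is then geometric in
  |n|.\<close>

lemma theta_summable:
  assumes c: "c \<noteq> 0"
  shows "(\<lambda>n. norm (c powi n * q powi tri n)) summable_on (UNIV :: int set)"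
proof -
  define d where "d = max (norm c) (norm (inverse c))"
  have d: "d > 0" "norm c \<le> d" "norm (inverse c) \<le> d" using c by (auto simp: d_def less_max_iff_disj)
  have "(\<lambda>m. d * norm q ^ m) \<longlonglongrightarrow> d * 0"
    using q1 by (intro tendsto_mult tendsto_const LIMSEQ_power_zero) simp
  then have "\<forall>\<^sub>F m in sequentially. d * norm q ^ m < 1"
    by (rule order_tendstoD) simp
  then obtain m where m: "d * norm q ^ m < 1"
    by (metis eventually_happens sequentially_bot)
  define x where "x = d * norm q ^ m"
  have x: "0 \<le> x" "x < 1" using m d by (simp_all add: x_def)
  define K where "K = norm (q powi (- ((int m + 1) * (int m + 1))))"
  show ?thesis
  proof (rule summable_on_comparison_test)
    show "(\<lambda>n. K * x ^ nat \<bar>n\<bar>) summable_on (UNIV :: int set)"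
      by (intro summable_on_cmult_right summable_on_geometric_int x)
    fix n :: int
    define l where "l = nat \<bar>n\<bar>"
    have cn: "norm (c powi n) \<le> d ^ l"
    proof (cases "n \<ge> 0")
      case True
      then have "norm (c powi n) = norm c ^ l" by (simp add: power_int_def l_def norm_power)
      then show ?thesis using d by (simp add: power_mono)
    next
      case False
      then have "norm (c powi n) = norm (inverse c) ^ l" by (simp add: power_int_def l_def norm_power)
      then show ?thesis using d by (simp add: power_mono)
    qed
    have "tri n \<ge> int m * int l - (int m + 1) * (int m + 1)"
    proof -
      have l: "int l = \<bar>n\<bar>" by (simp add: l_def)
      have "n \<ge> - int l" unfolding l by simp
      have "int l * int l - int l - 2 * (int m * int l - (int m + 1) * (int m + 1))
          = (int l - (int m + 1)) * (int l - (int m + 1)) + (int l + (int m + 1) * (int m + 1))"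
        by (simp add: algebra_simps)
      also have "\<dots> \<ge> 0"
        by (intro add_nonneg_nonneg) auto
      finally have A: "2 * (int m * int l - (int m + 1) * (int m + 1)) \<le> int l * int l - int l"
        by (simp only: diff_ge_0_iff_ge)
      define A where "A = int m * int l - (int m + 1) * (int m + 1)"
      have "int l * int l = n * n" by (simp add: l)
      moreover have "2 * tri n = n * n + n" using two_tri[of n] by (simp add: algebra_simps)
      moreover have "2 * A \<le> int l * int l - int l" using A by (simp only: A_def)
      ultimately have "A \<le> tri n" using \<open>n \<ge> - int l\<close> by linarith
      then show ?thesis by (simp only: A_def)
    qed
    then have "norm (q powi tri n) \<le> norm (q powi (int m * int l - (int m + 1) * (int m + 1)))"
      by (rule norm_power_int_antimono)
    also have "\<dots> = K * (norm q ^ m) ^ l"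
    proof -
      have "q powi (int m * int l - (int m + 1) * (int m + 1)) = (q ^ m) ^ l * q powi (- ((int m + 1) * (int m + 1)))"
      proof -
        have "q powi (int m * int l) = (q ^ m) ^ l"
          by (simp add: power_int_mult)
        then show ?thesis
          using q0 by (simp only: power_int_diff power_int_minus divide_inverse simp_thms)
      qed
      then show ?thesis by (simp add: K_def norm_mult norm_power)
    qed
    finally have qn: "norm (q powi tri n) \<le> K * (norm q ^ m) ^ l" .
    show "norm (c powi n * q powi tri n) \<le> K * x ^ nat \<bar>n\<bar>"
      unfolding norm_mult x_def power_mult_distrib l_def[symmetric]
      using mult_mono[OF cn qn] d by (simp add: mult_ac)
  qed simp
qed

text \<open>The q-binomial theorem of length 2M at z / q^M, with its index moved by M, is a finite
  triple product. Its terms are bounded by a constant times those of the theta series, so M may tend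
  to infinity.\<close>

lemma jacobi_triple_product:
  assumes z: "z \<noteq> 0"
  shows "((\<lambda>n. (- z) powi n * q powi tri (n - 1)) has_sum jtp z q) (UNIV :: int set)"
proof -
  define t where "t n = (- z) powi n * q powi tri (n - 1)" for n :: int
  define I where "I M = {- int M..int M}" for M :: nat
  define f where "f M n = (if n \<in> I M then t n * qpoch q q (2 * M) / qpoch_pair q M n else 0)" for M n
  have fin: "(f M has_sum qpoch z q M * qpoch (q / z) q M) UNIV" for M
  proof -
    have "(\<Sum>n\<in>I M. f M n) = qpoch z q M * qpoch (q / z) q M"
    proof -
      define x where "x = z / q ^ M"
      have "qpoch x q (2 * M) = qpoch q q (2 * M) *
         (\<Sum>i\<le>2 * M. (- x) ^ i * q powi tri (int i - 1) / (qpoch q q i * qpoch q q (2 * M - i)))"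
        unfolding q_binomial[OF q0 q1] using qq_nz[OF q0 q1] by simp
      also have "qpoch x q (2 * M) = (- z) ^ M / q powi tri (int M) * qpoch (q / z) q M * qpoch z q M"
        unfolding mult_2 qpoch_add x_def qpoch_reflect[OF q0 z] using q0 by simp
      finally have "qpoch z q M * qpoch (q / z) q M = q powi tri (int M) / (- z) ^ M * (qpoch q q (2 * M) *
         (\<Sum>i\<le>2 * M. (- x) ^ i * q powi tri (int i - 1) / (qpoch q q i * qpoch q q (2 * M - i))))"
        using q0 z by (simp add: field_simps)
      also have "\<dots> = (\<Sum>n\<in>I M. f M n)"
        unfolding sum_distrib_left
      proof (rule sum.reindex_bij_witness[where i = "\<lambda>n. nat (int M + n)" and j = "\<lambda>i. int i - int M"])
        fix i assume i: "i \<in> {..2 * M}"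
        define n where "n = int i - int M"
        have nI: "n \<in> I M" using i by (auto simp: I_def n_def)
        have ii: "int i = int M + n" by (simp add: n_def)
        have d: "qpoch q q i * qpoch q q (2 * M - i) = qpoch_pair q M n"
        proof -
          have "nat (int M - n) = 2 * M - i" "nat (int M + n) = i" using i by (auto simp: n_def)
          then show ?thesis by (simp add: qpoch_pair_def mult_ac)
        qed
        have xi: "(- x) ^ i = (- z) ^ M * (- z) powi n * q powi (- (int M * (int M + n)))"
        proof -
          have "(- x) ^ i = (- z) ^ i / (q ^ M) ^ i"
            unfolding x_def by (metis minus_divide_left power_divide)
          also have "(- z) ^ i = (- z) powi (int M + n)"
            unfolding ii[symmetric] by simp
          also have "\<dots> = (- z) ^ M * (- z) powi n"
            using z by (simp add: power_int_add)
          also have "(q ^ M) ^ i = q powi (int M * (int M + n))"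
            unfolding ii[symmetric] by (simp add: power_mult flip: of_nat_mult)
          finally show ?thesis by (simp add: power_int_minus divide_inverse)
        qed
        have ex: "q powi tri (int M) * q powi (- (int M * (int M + n))) * q powi tri (int i - 1) = q powi tri (n - 1)"
        proof -
          have "tri (int M) + (- (int M * (int M + n))) + tri (int i - 1) = tri (n - 1)"
            unfolding ii using two_tri[of "int M"] by (simp add: tri_add tri_diff algebra_simps)
          then show ?thesis
            by (simp only: power_int_add[OF disjI1[OF q0], symmetric])
        qed
        have "f M n = ((- z) powi n * (q powi tri (int M) * q powi (- (int M * (int M + n))) * q powi tri (int i - 1))) *
           qpoch q q (2 * M) / qpoch_pair q M n"
          using nI by (simp add: f_def t_def ex)
        also have "\<dots> = q powi tri (int M) / (- z) ^ M * (qpoch q q (2 * M) * ((- x) ^ i * q powi tri (int i - 1) /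
             (qpoch q q i * qpoch q q (2 * M - i))))"
          unfolding d xi using z by simp
        finally show "f M (int i - int M) = q powi tri (int M) / (- z) ^ M * (qpoch q q (2 * M) * ((- x) ^ i * q powi tri (int i - 1) /
             (qpoch q q i * qpoch q q (2 * M - i))))"
          by (simp add: n_def)
      qed (auto simp: I_def)
      finally show ?thesis ..
    qed
    then show ?thesis
      by (intro has_sum_finite_neutralI[of "I M"]) (auto simp: f_def I_def)
  qed
  obtain C where C: "\<And>n. norm (qpoch q q n) \<le> C" using qpoch_bounded by blast
  obtain D where D: "\<And>n. norm (1 / qpoch q q n) \<le> D" using inverse_qpoch_bounded by blast
  have C0: "C \<ge> 0" and D0: "D \<ge> 0"
    using C[of 0] D[of 0] norm_ge_zero order_trans by blast+
  have bound: "norm (f M n) \<le> norm (t n) * (C * (D * D))" for M n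
  proof -
    have "norm (qpoch q q (2 * M) * (1 / qpoch q q (nat (int M - n)) * (1 / qpoch q q (nat (int M + n))))) \<le> C * (D * D)"
      unfolding norm_mult by (intro mult_mono C D C0 D0 mult_nonneg_nonneg norm_ge_zero)
    then have "norm (t n) * norm (qpoch q q (2 * M) * (1 / qpoch q q (nat (int M - n)) * (1 / qpoch q q (nat (int M + n))))) \<le> norm (t n) * (C * (D * D))"
      by (intro mult_left_mono) auto
    then show ?thesis
      using C0 D0 by (auto simp: f_def qpoch_pair_def norm_mult norm_divide)
  qed
  have t_summable: "(\<lambda>n. norm (t n)) summable_on UNIV"
  proof -
    have "t n = (- z / q) powi n * q powi tri n" for n
      unfolding power_int_divide_distrib using q0 by (simp add: t_def tri_diff power_int_diff)
    then show ?thesis using theta_summable[of "- z / q"] z q0 by simp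
  qed
  \<comment> \<open>One (q;q)_infinity in the numerator meets two in the denominator; the one left
    over is the third factor of \<open>jtp\<close>.\<close>
  have lim: "(\<lambda>M. f M n) \<longlonglongrightarrow> t n * qpoch_inf q q / (qpoch_inf q q * qpoch_inf q q)" for n
  proof (rule Lim_transform_eventually)
    show "(\<lambda>M. t n * qpoch q q (2 * M) / qpoch_pair q M n) \<longlonglongrightarrow> t n * qpoch_inf q q / (qpoch_inf q q * qpoch_inf q q)"
    proof -
      have "(\<lambda>M. qpoch q q (2 * M)) \<longlonglongrightarrow> qpoch_inf q q"
        by (rule filterlim_compose[OF qpoch_tendsto mult_nat_left_at_top]) simp
      moreover have "(\<lambda>M. qpoch_pair q M n) \<longlonglongrightarrow> qpoch_inf q q * qpoch_inf q q"
        by (rule qpoch_pair_tendsto)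
      ultimately show ?thesis
        using qpoch_inf_self_neq_0 by (intro tendsto_divide tendsto_mult tendsto_const) auto
    qed
    show "\<forall>\<^sub>F M in sequentially. t n * qpoch q q (2 * M) / qpoch_pair q M n = f M n"
      by (rule eventually_mono[OF eventually_ge_at_top[of "nat \<bar>n\<bar>"]]) (auto simp: f_def I_def)
  qed
  have lim': "(\<lambda>M. f M n) \<longlonglongrightarrow> t n / qpoch_inf q q" for n
    using lim[of n] qpoch_inf_self_neq_0 by simp
  note tan = infsum_dominated_convergence[where f = f and A = UNIV, OF lim' bound summable_on_cmult_left[OF t_summable] fin]
  have "(\<lambda>M. qpoch z q M * qpoch (q / z) q M) \<longlonglongrightarrow> qpoch_inf z q * qpoch_inf (q / z) q"
    by (intro tendsto_mult qpoch_tendsto)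
  then have "infsum (\<lambda>n. t n / qpoch_inf q q) UNIV = qpoch_inf z q * qpoch_inf (q / z) q"
    using tan(2) LIMSEQ_unique by blast
  then have "((\<lambda>n. t n / qpoch_inf q q) has_sum qpoch_inf z q * qpoch_inf (q / z) q) UNIV"
    using has_sum_infsum[OF tan(1)] by simp
  from has_sum_cmult_left[OF this, of "qpoch_inf q q"] show ?thesis
    using qpoch_inf_self_neq_0 by (simp add: t_def jtp_def)
qed

end

section \<open>Kronecker's formula\<close>

text \<open>The value is 1 if both arguments are nonnegative, -1 if both are negative, and 0 otherwise.\<close>

definition quadrant :: "int \<Rightarrow> int \<Rightarrow> complex" where
  "quadrant a b = of_bool (a \<ge> 0) - of_bool (b < 0)"

context
  fixes q :: complex
  assumes q0: "q \<noteq> 0" and q1: "norm q < 1"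
begin

text \<open>The numerator is a polynomial of degree at most L in y. Expanding it by the q-binomial
  theorem, splitting each y^i / (y;q)_(L+1) and resumming over i evaluates it at the pole y =
  q^(-n), which gives a q-binomial sum at x / q^n.\<close>

lemma qpoch_quotient_partial_fractions:
  assumes "\<And>k. y * q ^ k \<noteq> 1"
  shows "qpoch (x * y) q L / qpoch y q (Suc L)
    = (\<Sum>n\<le>L. (- 1) ^ n * q powi tri (int n) * qpoch (x / q ^ n) q L /
        (qpoch q q n * qpoch q q (L - n) * (1 - y * q ^ n)))"
proof -
  define w where "w i = 1 / (qpoch q q i * qpoch q q (L - i))" for i
  define a where "a i = q powi tri (int i - 1) * w i" for i
  have bin: "qpoch z q L = qpoch q q L * (\<Sum>i\<le>L. (- z) ^ i * a i)" for z
    using q_binomial[OF q0 q1, of z L] qq_nz[OF q0 q1, of L]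
    by (simp add: a_def w_def field_simps)
  have pf: "y ^ i / qpoch y q (Suc L) = (\<Sum>n\<le>L. (- 1) ^ n * q powi tri (int n) / (q ^ n) ^ i / (1 - y * q ^ n) * w n)"
    if "i \<le> L" for i
    unfolding qpoch_partial_fractions[OF q0 q1 assms that, symmetric] w_def
    by (intro sum.cong) (use q0 in \<open>simp_all add: power_int_diff power_mult flip: of_nat_mult\<close>)
  have xy: "(- (x * y)) ^ i = (- x) ^ i * y ^ i" for i
    by (metis mult_minus_left power_mult_distrib)
  have xq: "(- (x / q ^ n)) ^ i = (- x) ^ i / (q ^ n) ^ i" for n i
    by (metis minus_divide_left power_divide)
  have "qpoch (x * y) q L / qpoch y q (Suc L)
      = qpoch q q L * ((\<Sum>i\<le>L. (- (x * y)) ^ i * a i) / qpoch y q (Suc L))"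
    by (simp only: bin[of "x * y"] times_divide_eq_right)
  also have "(\<Sum>i\<le>L. (- (x * y)) ^ i * a i) / qpoch y q (Suc L)
      = (\<Sum>i\<le>L. (- x) ^ i * a i * (y ^ i / qpoch y q (Suc L)))"
    unfolding xy sum_divide_distrib by (simp add: mult_ac)
  also have "\<dots> = (\<Sum>i\<le>L. \<Sum>n\<le>L. (- x) ^ i * a i *
        ((- 1) ^ n * q powi tri (int n) / (q ^ n) ^ i / (1 - y * q ^ n) * w n))"
    by (intro sum.cong refl) (simp only: pf atMost_iff sum_distrib_left)
  also have "\<dots> = (\<Sum>n\<le>L. (- 1) ^ n * q powi tri (int n) / (1 - y * q ^ n) * w n *
        (\<Sum>i\<le>L. (- (x / q ^ n)) ^ i * a i))"
    unfolding sum_distrib_left xq by (subst sum.swap) (simp add: mult_ac)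
  also have "qpoch q q L * \<dots> = (\<Sum>n\<le>L. (- 1) ^ n * q powi tri (int n) / (1 - y * q ^ n) * w n *
        (qpoch q q L * (\<Sum>i\<le>L. (- (x / q ^ n)) ^ i * a i)))"
    by (subst sum_distrib_left) (simp add: mult_ac)
  also have "\<dots> = (\<Sum>n\<le>L. (- 1) ^ n * q powi tri (int n) * qpoch (x / q ^ n) q L /
        (qpoch q q n * qpoch q q (L - n) * (1 - y * q ^ n)))"
    unfolding bin[symmetric] by (simp add: w_def mult_ac)
  finally show ?thesis .
qed

text \<open>The preceding expansion with L = 2M and y / q^M in place of y, so that the poles sit
  symmetrically at nu = -M, ..., M; \<open>qpoch_reflect\<close> folds the long products into pairs
  that converge separately.\<close>

lemma finite_kronecker:
  assumes x: "x \<noteq> 0" and y: "y \<noteq> 0" and yq: "\<And>k. y * q powi k \<noteq> 1"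
  shows "qpoch (x * y) q M * qpoch (q / (x * y)) q M / (qpoch y q (Suc M) * qpoch (q / y) q M)
    = (\<Sum>\<nu>\<in>{- int M..int M}. x powi \<nu> * (qpoch (q / x) q (nat (int M + \<nu>)) * qpoch x q (nat (int M - \<nu>)))
         / qpoch_pair q M \<nu> / (1 - y * q powi \<nu>))"
proof -
  define Y where "Y = y / q ^ M"
  have Y: "Y * q ^ k = y * q powi (int k - int M)" for k
    using q0 by (simp add: Y_def power_int_diff)
  have Y1: "Y * q ^ k \<noteq> 1" for k
    unfolding Y by (rule yq)
  have xY: "x * Y = x * y / q ^ M" by (simp add: Y_def)
  have nz: "(- y) ^ M / q powi tri (int M) \<noteq> 0" using q0 y by simp
  have num: "qpoch (x * Y) q (2 * M) = (- y) ^ M / q powi tri (int M) * (x ^ M * (qpoch (x * y) q M * qpoch (q / (x * y)) q M))"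
  proof -
    have "qpoch (x * Y) q (2 * M) = qpoch (x * y / q ^ M) q M * qpoch (x * y) q M"
      unfolding mult_2 qpoch_add xY using q0 by simp
    also have "qpoch (x * y / q ^ M) q M = (- (x * y)) ^ M / q powi tri (int M) * qpoch (q / (x * y)) q M"
      using x y by (intro qpoch_reflect[OF q0]) simp
    also have "(- (x * y)) ^ M = x ^ M * (- y) ^ M"
      by (metis mult_minus_right power_mult_distrib)
    finally show ?thesis by simp
  qed
  have den: "qpoch Y q (Suc (2 * M)) = (- y) ^ M / q powi tri (int M) * (qpoch y q (Suc M) * qpoch (q / y) q M)"
  proof -
    have "Suc (2 * M) = M + Suc M" by simp
    then have "qpoch Y q (Suc (2 * M)) = qpoch (y / q ^ M) q M * qpoch y q (Suc M)"
      unfolding Y_def using q0 by (simp only: qpoch_add) simp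
    then show ?thesis
      unfolding qpoch_reflect[OF q0 y] by simp
  qed
  have "x ^ M * (qpoch (x * y) q M * qpoch (q / (x * y)) q M / (qpoch y q (Suc M) * qpoch (q / y) q M))
      = qpoch (x * Y) q (2 * M) / qpoch Y q (Suc (2 * M))"
    unfolding num den mult_divide_mult_cancel_left[OF nz] by simp
  also have "\<dots> = (\<Sum>n\<le>2 * M. (- 1) ^ n * q powi tri (int n) * qpoch (x / q ^ n) q (2 * M) /
        (qpoch q q n * qpoch q q (2 * M - n) * (1 - Y * q ^ n)))"
    by (rule qpoch_quotient_partial_fractions[OF Y1])
  also have "\<dots> = (\<Sum>\<nu>\<in>{- int M..int M}. x ^ M * (x powi \<nu> * (qpoch (q / x) q (nat (int M + \<nu>)) * qpoch x q (nat (int M - \<nu>)))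
         / qpoch_pair q M \<nu> / (1 - y * q powi \<nu>)))"
  proof (rule sum.reindex_bij_witness[where i = "\<lambda>\<nu>. nat (int M + \<nu>)" and j = "\<lambda>n. int n - int M"])
    fix n assume n: "n \<in> {..2 * M}"
    define \<nu> where "\<nu> = int n - int M"
    have e: "nat (int M + \<nu>) = n" "nat (int M - \<nu>) = 2 * M - n" using n by (auto simp: \<nu>_def)
    have split: "qpoch (x / q ^ n) q (2 * M) = (- x) ^ n / q powi tri (int n) * qpoch (q / x) q n * qpoch x q (2 * M - n)"
    proof -
      have "qpoch (x / q ^ n) q (n + (2 * M - n)) = qpoch (x / q ^ n) q n * qpoch x q (2 * M - n)"
        unfolding qpoch_add using q0 by simp
      then show ?thesis using n unfolding qpoch_reflect[OF q0 x] by simp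
    qed
    have xn: "x ^ M * x powi \<nu> = x ^ n"
      using x by (simp add: \<nu>_def power_int_diff)
    have "(- 1) ^ n * (- x) ^ n = x ^ n"
      by (simp flip: power_mult_distrib)
    then have "(- 1) ^ n * q powi tri (int n) * qpoch (x / q ^ n) q (2 * M) = x ^ n * (qpoch (q / x) q n * qpoch x q (2 * M - n))"
      unfolding split using q0 by (simp add: mult_ac)
    then show "x ^ M * (x powi (int n - int M) * (qpoch (q / x) q (nat (int M + (int n - int M))) * qpoch x q (nat (int M - (int n - int M))))
         / qpoch_pair q M (int n - int M) / (1 - y * q powi (int n - int M)))
      = (- 1) ^ n * q powi tri (int n) * qpoch (x / q ^ n) q (2 * M) /
        (qpoch q q n * qpoch q q (2 * M - n) * (1 - Y * q ^ n))"
      unfolding Y \<nu>_def[symmetric] e qpoch_pair_def xn[symmetric] by (simp add: mult_ac)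
  qed auto
  finally show ?thesis
    unfolding sum_distrib_left[symmetric] mult_left_cancel[OF power_not_zero[OF x]] .
qed

text \<open>As M grows, \<open>finite_kronecker\<close> becomes the series of x^a / (1 - y q^a). In
  the annulus |y q^a| is below 1 for a >= 0 and above 1 for a < 0, so each term is a geometric
  series over b >= 0 or over b < 0 with a minus sign; this is the origin of \<open>quadrant\<close>.
  The upper bounds on |x| and |y| control the first quadrant, the lower bounds the other.\<close>

lemma kronecker:
  assumes x: "norm q < norm x" "norm x < 1" and y: "norm q < norm y" "norm y < 1"
  shows "((\<lambda>(a, b). quadrant a b * (x powi a * y powi b * q powi (a * b))) has_sum
       (qpoch_inf q q) ^ 3 * jtp (x * y) q / (jtp x q * jtp y q)) UNIV"
    and "(\<lambda>(a, b). norm (quadrant a b * (x powi a * y powi b * q powi (a * b)))) summable_on UNIV"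
proof -
  have x0: "x \<noteq> 0" and y0: "y \<noteq> 0" using x y by auto
  \<comment> \<open>One ratio for both quadrants: x and y govern the nonnegative exponents, q / x
    and q / y the negative ones.\<close>
  define \<rho> where "\<rho> = Max {norm x, norm y, norm q / norm x, norm q / norm y}"
  have \<rho>: "norm x \<le> \<rho>" "norm y \<le> \<rho>" "norm q / norm x \<le> \<rho>" "norm q / norm y \<le> \<rho>"
    by (auto simp: \<rho>_def)
  have \<rho>1: "\<rho> < 1" "\<rho> \<ge> 0"
    using x y x0 y0 \<rho>(1) norm_ge_zero[of x] by (simp add: \<rho>_def, linarith)
  define g where "g a b = quadrant a b * (x powi a * y powi b * q powi (a * b))" for a b
  have g_bound: "norm (g a b) \<le> \<rho> ^ nat \<bar>a\<bar> * \<rho> ^ nat \<bar>b\<bar> / norm q" for a b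
  proof -
    consider "a \<ge> 0" "b \<ge> 0" | "a < 0" "b < 0" | "quadrant a b = 0"
      by (cases "a \<ge> 0"; cases "b \<ge> 0") (auto simp: quadrant_def)
    then show ?thesis
    proof cases
      case 1
      then obtain m n where mn: "a = int m" "b = int n" by (metis nonneg_int_cases)
      have "norm (g a b) = norm x ^ m * norm y ^ n * norm q ^ (m * n)"
        unfolding g_def mn quadrant_def by (simp add: norm_mult norm_power flip: of_nat_mult)
      also have "\<dots> \<le> \<rho> ^ m * \<rho> ^ n * 1"
        using \<rho> \<rho>1 q1 by (intro mult_mono power_mono power_le_one) auto
      also have "\<dots> \<le> \<rho> ^ m * \<rho> ^ n / norm q"
        using \<rho>1 q0 q1 by (simp add: field_simps mult_left_le_one_le)
      finally show ?thesis by (simp add: mn)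
    next
      case 2
      then obtain m n where mn: "a = - int m" "b = - int n" "m > 0" "n > 0"
        by (metis neg_int_cases)
      \<comment> \<open>Equivalent to (m - 1)(n - 1) >= 0. It lets q^(mn) be shared between the two
        negative powers at the cost of one factor q, whence the division by \<open>norm q\<close> in
        the bound.\<close>
      have mn': "m * n \<ge> m + n - 1"
      proof -
        obtain m' n' where "m = Suc m'" "n = Suc n'" using mn by (metis gr0_implies_Suc)
        then show ?thesis by simp
      qed
      have "norm (g a b) = norm q ^ (m * n) / (norm x ^ m * norm y ^ n)"
        using mn unfolding g_def quadrant_def
        by (simp add: norm_mult norm_power power_int_minus norm_inverse divide_inverse flip: of_nat_mult)
      also have "\<dots> \<le> norm q ^ (m + n - 1) / (norm x ^ m * norm y ^ n)"
        using mn' q1 x0 y0 by (intro divide_right_mono power_decreasing) auto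
      also have "norm q ^ (m + n - 1) = norm q ^ m * norm q ^ n / norm q"
        using q0 mn by (simp add: power_diff power_add)
      also have "\<dots> / (norm x ^ m * norm y ^ n) = (norm q / norm x) ^ m * (norm q / norm y) ^ n / norm q"
        by (simp add: power_divide)
      also have "\<dots> \<le> \<rho> ^ m * \<rho> ^ n / norm q"
        using \<rho> \<rho>1 by (intro mult_mono power_mono divide_right_mono) auto
      finally show ?thesis by (simp add: mn)
    next
      case 3
      then show ?thesis using \<rho>1 by (simp add: g_def)
    qed
  qed
  have g_abs: "(\<lambda>(a, b). norm (g a b)) summable_on UNIV"
  proof (rule summable_on_comparison_test)
    show "(\<lambda>p. (case p of (a, b) \<Rightarrow> \<rho> ^ nat \<bar>a\<bar> * \<rho> ^ nat \<bar>b\<bar>) * (1 / norm q)) summable_on UNIV"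
      by (intro summable_on_cmult_left summable_on_geometric_int_prod \<rho>1)
  qed (use g_bound in auto)
  then show "(\<lambda>(a, b). norm (quadrant a b * (x powi a * y powi b * q powi (a * b)))) summable_on UNIV"
    by (simp add: g_def)
  have g_sum: "(\<lambda>(a, b). g a b) summable_on UNIV"
  proof (rule abs_summable_summable)
    have "norm (case p of (a, b) \<Rightarrow> g a b) = (case p of (a, b) \<Rightarrow> norm (g a b))" for p
      by (cases p) simp
    then show "(\<lambda>p. norm (case p of (a, b) \<Rightarrow> g a b)) summable_on UNIV"
      using g_abs by (simp only:)
  qed
  define u where "u a = x powi a / (1 - y * q powi a)" for a
  have yq: "y * q powi a \<noteq> 1" for a
  proof
    assume e: "y * q powi a = 1"
    then have e': "norm y * norm (q powi a) = 1"
      unfolding norm_mult[symmetric] e by simp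
    show False
    proof (cases "a \<ge> 0")
      case True
      then have "norm (q powi a) \<le> 1" using norm_power_int_antimono[OF q0 q1, of 0 a] by simp
      then have "norm y * norm (q powi a) \<le> norm y * 1"
        by (intro mult_left_mono) auto
      then show False using e' y by simp
    next
      case False
      then have "norm (q powi (- 1)) \<le> norm (q powi a)"
        by (intro norm_power_int_antimono[OF q0 q1]) simp
      then have "norm y * (1 / norm q) \<le> norm y * norm (q powi a)"
        by (intro mult_left_mono) (simp_all add: norm_inverse divide_inverse)
      then have "norm y * (1 / norm q) \<le> 1"
        unfolding e' .
      then show False using y q0 by (simp add: divide_simps)
    qed
  qed
  have inner: "(g a has_sum u a) UNIV" for a
  proof (cases "a \<ge> 0")
    case True
    define z where "z = y * q powi a"
    have "norm (q powi a) \<le> 1" using norm_power_int_antimono[OF q0 q1, of 0 a] True by simp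
    then have "norm z \<le> norm y * 1"
      unfolding z_def norm_mult by (intro mult_left_mono) auto
    then have z: "norm z < 1"
      using y by simp
    have "((\<lambda>n. x powi a * z ^ n) has_sum x powi a * (1 / (1 - z))) UNIV"
      by (intro has_sum_cmult_right norm_summable_imp_has_sum geometric_sums z)
         (use z in \<open>simp add: norm_power summable_geometric\<close>)
    also have "?this \<longleftrightarrow> (g a has_sum u a) {0..}"
    proof (rule has_sum_reindex_bij_witness[where i = nat and j = int])
      fix n :: nat
      show "g a (int n) = x powi a * z ^ n"
        using True by (simp add: g_def quadrant_def z_def power_mult_distrib power_int_mult mult_ac)
    qed (auto simp: u_def z_def)
    finally show ?thesis
      by (rule has_sum_cong_neutral[THEN iffD1, rotated -1]) (use True in \<open>auto simp: g_def quadrant_def\<close>)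
  next
    case False
    define z where "z = 1 / (y * q powi a)"
    have "norm (q powi (- 1)) \<le> norm (q powi a)"
      using False by (intro norm_power_int_antimono[OF q0 q1]) simp
    then have "norm y * (1 / norm q) \<le> norm (y * q powi a)"
      unfolding norm_mult by (intro mult_left_mono) (simp_all add: norm_inverse divide_inverse)
    moreover have "norm y * (1 / norm q) > 1" using y q0 by simp
    ultimately have w: "norm (y * q powi a) > 1" by linarith
    have "1 / norm (y * q powi a) < 1"
      using w by (subst divide_less_eq_1_pos) linarith+
    then have z: "norm z < 1" unfolding z_def norm_divide norm_one .
    have z0: "z \<noteq> 0" using y0 q0 by (simp add: z_def)
    have z': "y * q powi a = 1 / z" by (simp add: z_def)
    have "((\<lambda>n. - (x powi a) * z * z ^ n) has_sum - (x powi a) * z * (1 / (1 - z))) UNIV"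
      by (intro has_sum_cmult_right norm_summable_imp_has_sum geometric_sums z)
         (use z in \<open>simp add: norm_power summable_geometric\<close>)
    also have "?this \<longleftrightarrow> (g a has_sum u a) {..<0}"
    proof (rule has_sum_reindex_bij_witness[where i = "\<lambda>b. nat (- b - 1)" and j = "\<lambda>n. - int n - 1"])
      fix n :: nat
      have "y powi b * q powi (a * b) = (1 / z) powi b" for b
        unfolding z'[symmetric] by (simp add: power_int_mult_distrib power_int_mult)
      moreover have "(1 / z) powi (- int n - 1) = z * z ^ n"
      proof -
        have "- int n - 1 = - int (Suc n)" by simp
        then show ?thesis by (simp only: power_int_minus power_int_of_nat power_one_over) simp
      qed
      ultimately show "g a (- int n - 1) = - (x powi a) * z * z ^ n"
        using False by (simp add: g_def quadrant_def mult.assoc)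
    next
      have "1 - z \<noteq> 0" using z by auto
      then have "- z * (1 / (1 - z)) = 1 / (1 - 1 / z)"
        using z0 by (simp add: divide_simps) (simp add: algebra_simps)
      then show "- (x powi a) * z * (1 / (1 - z)) = u a"
        unfolding u_def z' by (metis (no_types, opaque_lifting) minus_mult_commute mult.assoc mult.right_neutral times_divide_eq_right)
    qed auto
    finally show ?thesis
      by (rule has_sum_cong_neutral[THEN iffD1, rotated -1]) (use False in \<open>auto simp: g_def quadrant_def\<close>)
  qed
  \<comment> \<open>The majorant for the limit in M is taken from the double series, whose inner
    sums of norms bound the norms of \<open>u\<close>.\<close>
  have u_abs: "(\<lambda>a. norm (u a)) summable_on UNIV"
  proof -
    have "(\<lambda>a. infsum (\<lambda>b. norm (g a b)) UNIV) summable_on UNIV"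
      using summable_on_Sigma_banach[of "\<lambda>a b. norm (g a b)" UNIV "\<lambda>_. UNIV"] g_abs by simp
    then show ?thesis
    proof (rule summable_on_comparison_test)
      fix a :: int
      have "(\<lambda>b. norm (g a b)) summable_on UNIV"
        using summable_on_SigmaD1[of "\<lambda>a b. norm (g a b)" UNIV "\<lambda>_. UNIV"] g_abs by simp
      then show "norm (u a) \<le> infsum (\<lambda>b. norm (g a b)) UNIV"
        by (intro norm_infsum_le[OF inner has_sum_infsum]) auto
    qed simp
  qed
  have jtp: "(qpoch_inf q q) ^ 3 * jtp (x * y) q / (jtp x q * jtp y q)
      = qpoch_inf (x * y) q * qpoch_inf (q / (x * y)) q / (qpoch_inf y q * qpoch_inf (q / y) q)
        / (qpoch_inf (q / x) q * qpoch_inf x q / (qpoch_inf q q * qpoch_inf q q))"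
    unfolding jtp_def using qpoch_inf_self_neq_0[OF q0 q1] by (simp add: power3_eq_cube mult_ac)
  have nz: "qpoch_inf z q \<noteq> 0" if "norm z < 1" for z
  proof (rule qpoch_inf_neq_0[OF q0 q1])
    fix k
    have "norm (z * q ^ k) \<le> norm z * 1"
      unfolding norm_mult norm_power using q1 by (intro mult_left_mono power_le_one) auto
    then show "z * q ^ k \<noteq> 1" using that by auto
  qed
  have nzs: "qpoch_inf x q \<noteq> 0" "qpoch_inf (q / x) q \<noteq> 0" "qpoch_inf y q \<noteq> 0" "qpoch_inf (q / y) q \<noteq> 0"
    using x y x0 y0 by (auto intro!: nz simp: norm_divide)
  define c where "c = qpoch_inf (q / x) q * qpoch_inf x q / (qpoch_inf q q * qpoch_inf q q)"
  have c0: "c \<noteq> 0" using nzs qpoch_inf_self_neq_0[OF q0 q1] by (simp add: c_def)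
  define I where "I M = {- int M..int M}" for M :: nat
  define f where "f M a = (if a \<in> I M then x powi a * (qpoch (q / x) q (nat (int M + a)) * qpoch x q (nat (int M - a)))
         / qpoch_pair q M a / (1 - y * q powi a) else 0)" for M a
  define S where "S M = qpoch (x * y) q M * qpoch (q / (x * y)) q M / (qpoch y q (Suc M) * qpoch (q / y) q M)" for M
  have fin: "(f M has_sum S M) UNIV" for M
    unfolding S_def finite_kronecker[OF x0 y0 yq]
    by (intro has_sum_finite_neutralI[of "I M"]) (auto simp: f_def I_def)
  obtain A where A: "\<And>n. norm (qpoch (q / x) q n) \<le> A" using qpoch_bounded[OF q0 q1] by blast
  obtain B where B: "\<And>n. norm (qpoch x q n) \<le> B" using qpoch_bounded[OF q0 q1] by blast
  obtain D where D: "\<And>n. norm (1 / qpoch q q n) \<le> D" using inverse_qpoch_bounded[OF q0 q1] by blast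
  have pos: "A \<ge> 0" "B \<ge> 0" "D \<ge> 0"
    using A[of 0] B[of 0] D[of 0] norm_ge_zero order_trans by blast+
  have bound: "norm (f M a) \<le> norm (u a) * (A * B * (D * D))" for M a
  proof -
    have "norm (qpoch (q / x) q (nat (int M + a)) * qpoch x q (nat (int M - a)) *
         (1 / qpoch q q (nat (int M - a)) * (1 / qpoch q q (nat (int M + a))))) \<le> A * B * (D * D)"
      unfolding norm_mult by (intro mult_mono A B D pos mult_nonneg_nonneg norm_ge_zero)
    then have "norm (u a) * norm (qpoch (q / x) q (nat (int M + a)) * qpoch x q (nat (int M - a)) *
         (1 / qpoch q q (nat (int M - a)) * (1 / qpoch q q (nat (int M + a))))) \<le> norm (u a) * (A * B * (D * D))"
      by (intro mult_left_mono) auto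
    then show ?thesis
      using pos by (auto simp: f_def u_def qpoch_pair_def norm_mult norm_divide mult_ac)
  qed
  have lim: "(\<lambda>M. f M a) \<longlonglongrightarrow> u a * c" for a
  proof (rule Lim_transform_eventually)
    have "(\<lambda>M. x powi a * (qpoch (q / x) q (nat (int M + a)) * qpoch x q (nat (int M + - a)))
         / qpoch_pair q M a / (1 - y * q powi a)) \<longlonglongrightarrow> x powi a * (qpoch_inf (q / x) q * qpoch_inf x q) /
           (qpoch_inf q q * qpoch_inf q q) / (1 - y * q powi a)"
      using qpoch_inf_self_neq_0[OF q0 q1] yq[of a]
      by (intro tendsto_divide tendsto_mult tendsto_const qpoch_tendsto_nat_int[OF q0 q1] qpoch_pair_tendsto[OF q0 q1]) auto
    then show "(\<lambda>M. x powi a * (qpoch (q / x) q (nat (int M + a)) * qpoch x q (nat (int M - a)))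
         / qpoch_pair q M a / (1 - y * q powi a)) \<longlonglongrightarrow> u a * c"
      by (simp add: u_def c_def mult_ac)
    show "\<forall>\<^sub>F M in sequentially. x powi a * (qpoch (q / x) q (nat (int M + a)) * qpoch x q (nat (int M - a)))
         / qpoch_pair q M a / (1 - y * q powi a) = f M a"
      by (rule eventually_mono[OF eventually_ge_at_top[of "nat \<bar>a\<bar>"]]) (auto simp: f_def I_def)
  qed
  note tan = infsum_dominated_convergence[where f = f and A = UNIV, OF lim bound summable_on_cmult_left[OF u_abs] fin]
  have "S \<longlonglongrightarrow> qpoch_inf (x * y) q * qpoch_inf (q / (x * y)) q / (qpoch_inf y q * qpoch_inf (q / y) q)"
    unfolding S_def using nzs
    by (intro tendsto_divide tendsto_mult qpoch_tendsto[OF q0 q1] LIMSEQ_Suc) auto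
  from LIMSEQ_unique[OF tan(2) this]
  have "((\<lambda>a. u a * c) has_sum qpoch_inf (x * y) q * qpoch_inf (q / (x * y)) q / (qpoch_inf y q * qpoch_inf (q / y) q)) UNIV"
    using has_sum_infsum[OF tan(1)] by simp
  from has_sum_cmult_left[OF this, of "1 / c"]
  have outer: "(u has_sum (qpoch_inf q q) ^ 3 * jtp (x * y) q / (jtp x q * jtp y q)) UNIV"
    unfolding jtp c_def[symmetric] using c0 by simp
  have "((\<lambda>(a, b). g a b) has_sum (qpoch_inf q q) ^ 3 * jtp (x * y) q / (jtp x q * jtp y q)) (UNIV \<times> UNIV)"
    by (rule has_sum_SigmaI[where g = u]) (use inner outer g_sum in auto)
  then show "((\<lambda>(a, b). quadrant a b * (x powi a * y powi b * q powi (a * b))) has_sum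
       (qpoch_inf q q) ^ 3 * jtp (x * y) q / (jtp x q * jtp y q)) UNIV"
    by (simp add: g_def)
qed

end

section \<open>Shifted Hecke-type double sums\<close>

lemma has_sum_diff:
  fixes f g :: "'a \<Rightarrow> 'b::real_normed_vector"
  assumes "(f has_sum a) A" "(g has_sum b) A"
  shows "((\<lambda>x. f x - g x) has_sum a - b) A"
proof -
  have "((\<lambda>x. - g x) has_sum - b) A"
    using assms(2) by (simp add: has_sum_uminus)
  from has_sum_add[OF assms(1) this] show ?thesis by simp
qed

lemma has_sum_product:
  fixes f :: "'a \<Rightarrow> complex" and g :: "'b \<Rightarrow> complex"
  assumes f: "(f has_sum A) S" "(\<lambda>x. norm (f x)) summable_on S"
    and g: "(g has_sum B) T" "(\<lambda>x. norm (g x)) summable_on T"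
  shows "((\<lambda>(x, y). f x * g y) has_sum A * B) (S \<times> T)"
proof (rule has_sum_SigmaI[where g = "\<lambda>x. f x * B"])
  show "((\<lambda>y. case (x, y) of (x, y) \<Rightarrow> f x * g y) has_sum f x * B) T" for x
    using has_sum_cmult_right[OF g(1)] by simp
  show "((\<lambda>x. f x * B) has_sum A * B) S"
    by (rule has_sum_cmult_left[OF f(1)])
  have "(\<lambda>(x, y). norm (f x) * norm (g y)) summable_on S \<times> T"
    by (rule summable_on_product_nonneg[OF f(2) g(2)]) auto
  moreover have "norm (case p of (x, y) \<Rightarrow> f x * g y) = (case p of (x, y) \<Rightarrow> norm (f x) * norm (g y))" for p
    by (cases p) (simp add: norm_mult)
  ultimately have "(\<lambda>p. norm (case p of (x, y) \<Rightarrow> f x * g y)) summable_on S \<times> T"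
    by (simp only:)
  then show "(\<lambda>(x, y). f x * g y) summable_on S \<times> T"
    by (rule abs_summable_summable)
qed

definition hecke_sum :: "complex \<Rightarrow> nat \<Rightarrow> complex" where
  "hecke_sum q N = (\<Sum>\<^sub>\<infinity>(U, T). quadrant U T * hecke_term q N U T)"

context
  fixes q :: complex
  assumes q0: "q \<noteq> 0" and q1: "norm q < 1"
begin

lemma hecke_abs_summable:
  assumes "N \<ge> 1"
  shows "(\<lambda>p. norm (case p of (U, T) \<Rightarrow> quadrant U T * hecke_term q N U T)) summable_on UNIV"
proof (rule summable_on_comparison_test)
  show "(\<lambda>(U, T). norm q ^ nat \<bar>U\<bar> * norm q ^ nat \<bar>T\<bar>) summable_on (UNIV :: (int \<times> int) set)"
    using q1 by (intro summable_on_geometric_int_prod) auto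
  fix p :: "int \<times> int"
  obtain U T where p: "p = (U, T)" by (cases p)
  have *: "norm (hecke_term q N U T) \<le> norm q ^ nat \<bar>U\<bar> * norm q ^ nat \<bar>T\<bar>" if "\<bar>U\<bar> + \<bar>T\<bar> \<le> hecke_exp N U T"
  proof -
    have "norm (hecke_term q N U T) = norm (q powi hecke_exp N U T)"
      by (simp add: hecke_term_def norm_mult norm_power_int)
    also have "\<dots> \<le> norm (q powi (\<bar>U\<bar> + \<bar>T\<bar>))"
      by (rule norm_power_int_antimono[OF q0 q1 that])
    also have "\<bar>U\<bar> + \<bar>T\<bar> = int (nat \<bar>U\<bar> + nat \<bar>T\<bar>)" by simp
    finally show ?thesis
      by (simp only: power_int_of_nat norm_power power_add norm_mult)
  qed
  consider "U \<ge> 0" "T \<ge> 0" | "U < 0" "T < 0" | "quadrant U T = 0"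
    by (cases "U \<ge> 0"; cases "T \<ge> 0") (auto simp: quadrant_def)
  then have "norm (quadrant U T * hecke_term q N U T) \<le> norm q ^ nat \<bar>U\<bar> * norm q ^ nat \<bar>T\<bar>"
  proof cases
    case 1
    then have "int (N + 1) * U * T \<ge> 0" by simp
    then have "\<bar>U\<bar> + \<bar>T\<bar> \<le> hecke_exp N U T"
      using 1 tri_ge(1)[of U] tri_ge(1)[of T] unfolding hecke_exp_def by linarith
    from *[OF this] 1 show ?thesis by (simp add: quadrant_def)
  next
    case 2
    \<comment> \<open>For negative indices \<open>tri_ge\<close> falls short of the absolute value
      by 1 in each variable; the mixed term is at least 2 and makes up for both.\<close>
    then have "1 * 1 \<le> U * T" 
      using mult_mono[of 1 "- U" 1 "- T"] by simp
    then have "2 * 1 \<le> int (N + 1) * (U * T)"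
      using assms by (intro mult_mono) auto
    then have "\<bar>U\<bar> + \<bar>T\<bar> \<le> hecke_exp N U T"
      using 2 tri_ge(2)[of U] tri_ge(2)[of T] unfolding hecke_exp_def mult.assoc by linarith
    from *[OF this] 2 show ?thesis by (simp add: quadrant_def)
  next
    case 3
    then show ?thesis by simp
  qed
  then show "norm (case p of (U, T) \<Rightarrow> quadrant U T * hecke_term q N U T)
     \<le> (case p of (U, T) \<Rightarrow> norm q ^ nat \<bar>U\<bar> * norm q ^ nat \<bar>T\<bar>)"
    by (simp add: p)
qed simp

text \<open>Up to a constant the exponent is tri (T + c) with c = (N + 1) a, hence invariant under T
  -> -T - 1 - 2c. This reflection changes the parity of T and with it the sign of the term, so the
  sum equals its own negative.\<close>

lemma hecke_line_sum: "((\<lambda>T. hecke_term q N a T) has_sum 0) UNIV"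
proof -
  define c where "c = int (N + 1) * a"
  have eq: "hecke_term q N a T = ((- 1) powi a * q powi tri a) * ((- (q powi c)) powi T * q powi tri T)" for T
  proof -
    have "(- (q powi c)) powi T = (- 1 * q powi c) powi T" by simp
    also have "\<dots> = (- 1) powi T * q powi (c * T)"
      unfolding power_int_mult_distrib power_int_mult ..
    finally have 1: "(- (q powi c)) powi T = (- 1) powi T * q powi (c * T)" .
    have 2: "hecke_exp N a T = tri a + tri T + c * T"
      by (simp only: hecke_exp_def c_def)
    show ?thesis
      unfolding hecke_term_def 1 2 using q0 by (simp add: power_int_add)
  qed
  have "(\<lambda>T. norm ((- (q powi c)) powi T * q powi tri T)) summable_on UNIV"
    using q0 by (intro theta_summable[OF q0 q1]) simp
  then have "(\<lambda>T. (- (q powi c)) powi T * q powi tri T) summable_on UNIV"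
    by (rule abs_summable_summable)
  then have "(\<lambda>T. hecke_term q N a T) summable_on UNIV"
    unfolding eq by (rule summable_on_cmult_right)
  then obtain s where s: "((\<lambda>T. hecke_term q N a T) has_sum s) UNIV"
    by (auto simp: summable_on_def)
  have refl: "hecke_term q N a (- T - 1 - 2 * c) = - hecke_term q N a T" for T
  proof -
    have "hecke_exp N a (- T - 1 - 2 * c) = hecke_exp N a T"
    proof -
      have e: "- T - 1 - 2 * c = - (T + 1 + (c + c))" by simp
      have "tri (- T - 1 - 2 * c) + c * (- T - 1 - 2 * c) = tri T + c * T"
        unfolding e tri_minus tri_add using two_tri[of c] by (simp add: algebra_simps)
      then show ?thesis by (simp add: hecke_exp_def c_def)
    qed
    moreover have "(- 1) powi (a + (- T - 1 - 2 * c)) = - ((- 1) powi (a + T) :: complex)"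
    proof -
      have "a + (- T - 1 - 2 * c) = (a + T) + (2 * (- T - c - 1) + 1)" by simp
      then show ?thesis
        by (simp only: power_int_add[of "- 1 :: complex", OF disjI1[OF neg_one_neq_zero]] power_int_mult) simp
    qed
    ultimately show ?thesis by (simp add: hecke_term_def)
  qed
  have "((\<lambda>T. - hecke_term q N a T) has_sum s) UNIV"
    by (rule has_sum_reindex_bij_witness[THEN iffD1, OF _ _ _ _ _ _ s,
          where ?i1 = "\<lambda>T. - T - 1 - 2 * c" and ?j1 = "\<lambda>T. - T - 1 - 2 * c"])
       (auto simp flip: refl)
  moreover have "((\<lambda>T. - hecke_term q N a T) has_sum - s) UNIV"
    using s by (simp add: has_sum_uminus)
  ultimately have "s = - s" by (rule has_sum_unique)
  then show ?thesis using s by simp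
qed

lemma hecke_row_sum: "((\<lambda>(U, T). of_bool (U = a) * hecke_term q N U T) has_sum 0) UNIV"
proof -
  have "((\<lambda>(U, T). hecke_term q N U T) has_sum 0) ({a} \<times> UNIV)"
    by (rule has_sum_reindex_bij_witness[THEN iffD1, OF _ _ _ _ _ _ hecke_line_sum,
          where ?i1 = snd and ?j1 = "\<lambda>T. (a, T)"]) auto
  then show ?thesis
    by (rule has_sum_cong_neutral[THEN iffD1, rotated -1]) auto
qed

lemma hecke_column_sum: "((\<lambda>(U, T). of_bool (T = b) * hecke_term q N U T) has_sum 0) UNIV"
  by (rule has_sum_reindex_bij_witness[THEN iffD1, OF _ _ _ _ _ _ hecke_row_sum,
        where ?i1 = prod.swap and ?j1 = prod.swap])
     (auto simp: hecke_term_commute[of q N])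

text \<open>Moving a or b by one changes the indicator on a single row or column, and these sum to
  0. This is what later absorbs the quadrants displaced by n.\<close>

lemma hecke_sum_shift:
  assumes "N \<ge> 1"
  shows "((\<lambda>(U, T). (of_bool (U \<ge> a) - of_bool (T < b)) * hecke_term q N U T) has_sum hecke_sum q N) UNIV"
proof -
  define P where "P a b \<longleftrightarrow> ((\<lambda>(U, T). (of_bool (U \<ge> a) - of_bool (T < b)) * hecke_term q N U T) has_sum hecke_sum q N) UNIV" for a b
  have P00: "P 0 0"
    using has_sum_infsum[OF abs_summable_summable[OF hecke_abs_summable[OF assms]]]
    by (simp add: P_def hecke_sum_def quadrant_def)
  have row: "P (a + 1) b \<longleftrightarrow> P a b" for a b
  proof
    assume "P (a + 1) b"
    from has_sum_add[OF this[unfolded P_def] hecke_row_sum[of a N], unfolded add.right_neutral diff_zero]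
    show "P a b" unfolding P_def
      by (rule has_sum_cong[THEN iffD1, rotated]) (auto simp: of_bool_def algebra_simps)
  next
    assume "P a b"
    from has_sum_diff[OF this[unfolded P_def] hecke_row_sum[of a N], unfolded add.right_neutral diff_zero]
    show "P (a + 1) b" unfolding P_def
      by (rule has_sum_cong[THEN iffD1, rotated]) (auto simp: of_bool_def algebra_simps)
  qed
  have col: "P a (b + 1) \<longleftrightarrow> P a b" for a b
  proof
    assume "P a (b + 1)"
    from has_sum_add[OF this[unfolded P_def] hecke_column_sum[of b N], unfolded add.right_neutral diff_zero]
    show "P a b" unfolding P_def
      by (rule has_sum_cong[THEN iffD1, rotated]) (auto simp: of_bool_def algebra_simps)
  next
    assume "P a b"
    from has_sum_diff[OF this[unfolded P_def] hecke_column_sum[of b N], unfolded add.right_neutral diff_zero]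
    show "P a (b + 1)" unfolding P_def
      by (rule has_sum_cong[THEN iffD1, rotated]) (auto simp: of_bool_def algebra_simps)
  qed
  have "P a 0"
    by (induction a rule: int_induct[where k = 0]) (use P00 row row[of "_ - 1"] in auto)
  then have "P a b"
    by (induction b rule: int_induct[where k = 0]) (use col col[of _ "_ - 1"] in auto)
  then show ?thesis unfolding P_def .
qed

end

section \<open>The limit of the truncated sums\<close>

lemma summable_on_prod_powers:
  fixes x :: real
  assumes "finite I" "0 \<le> x" "x < 1"
  shows "(\<lambda>k. \<Prod>i\<in>I. x ^ k i) summable_on {k :: 'a \<Rightarrow> nat. \<forall>i. i \<notin> I \<longrightarrow> k i = 0}"
  using assms(1)
proof (induction I rule: finite_induct)
  case empty
  have "{k :: 'a \<Rightarrow> nat. \<forall>i. k i = 0} = {\<lambda>_. 0}" by auto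
  then show ?case by simp
next
  case (insert j I)
  have "(\<lambda>(n, k). x ^ n * (\<Prod>i\<in>I. x ^ k i)) summable_on (UNIV \<times> {k :: 'a \<Rightarrow> nat. \<forall>i. i \<notin> I \<longrightarrow> k i = 0})"
    using assms by (intro summable_on_product_nonneg summable_on_geometric_nat insert.IH prod_nonneg) auto
  then show ?case
  proof (rule summable_on_reindex_bij_witness[where i = "\<lambda>(n, k). k(j := n)" and j = "\<lambda>k. (k j, k(j := 0))",
        THEN iffD2, rotated -1])
    fix k :: "'a \<Rightarrow> nat"
    show "(case (k j, k(j := 0)) of (n, k) \<Rightarrow> x ^ n * (\<Prod>i\<in>I. x ^ k i)) = (\<Prod>i\<in>insert j I. x ^ k i)"
    proof -
      have "(\<Prod>i\<in>I. x ^ (k(j := 0)) i) = (\<Prod>i\<in>I. x ^ k i)"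
        using insert.hyps by (intro prod.cong) auto
      then show ?thesis using insert.hyps by simp
    qed
  qed (use insert.hyps in \<open>auto simp: fun_eq_iff\<close>)
qed

section \<open>The tuples of B_N through their deviations from the mean\<close>

lemma Kpart_1 [simp]: "Kpart k (Suc 0) = 0"
  by (simp add: Kpart_def)

lemma Kpart_Suc: "i \<ge> 1 \<Longrightarrow> Kpart k (Suc i) = Kpart k i + k (Suc i)"
  by (simp add: Kpart_def atLeastAtMostSuc_conv)

lemma Kpart_fun_upd [simp]: "Kpart (k(Suc 0 := m)) i = Kpart k i"
  unfolding Kpart_def by (intro sum.cong) auto

lemma sum_fun_upd_1: "i \<ge> 1 \<Longrightarrow> sum (k(1 := m)) {1..i} = m + Kpart k i" for k :: "nat \<Rightarrow> nat"
proof -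
  assume "i \<ge> 1"
  then have "{1..i} = insert 1 {2..i}" by auto
  then show ?thesis by (simp add: Kpart_def)
qed

text \<open>The mean of the N numbers K_1 = 0, K_2, ..., K_N; on \<open>Bindex N\<close> the
  division is exact.\<close>

definition Bshift :: "nat \<Rightarrow> (nat \<Rightarrow> nat) \<Rightarrow> nat" where
  "Bshift N k = (\<Sum>i\<in>{2..N}. Kpart k i) div N"

lemma Bshift: "k \<in> Bindex N \<Longrightarrow> (\<Sum>i\<in>{2..N}. Kpart k i) = N * Bshift N k"
  by (simp add: Bindex_def Bshift_def)

lemma sum_split_1: "N \<ge> 1 \<Longrightarrow> (\<Sum>i\<in>{1..N}. f i) = f 1 + (\<Sum>i\<in>{2..N}. f i)" for f :: "nat \<Rightarrow> 'a::comm_monoid_add"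
proof -
  assume "N \<ge> 1"
  then have "{1..N} = insert 1 {2..N}" by auto
  then show ?thesis by simp
qed

lemma Bexp_eq:
  assumes N: "N \<ge> 1" and k: "k \<in> Bindex N"
  shows "Bexp N k = (\<Sum>i\<in>{2..N}. (int (Kpart k i))\<^sup>2) - int N * (int (Bshift N k))\<^sup>2"
  unfolding Bexp_def Bshift[OF k] using N by (simp add: power2_eq_square mult_ac)

text \<open>Squares about any point are the squares about the mean plus N times the squared distance
  to the mean. With m = -\<open>Bshift N k\<close> this shows \<open>Bexp\<close> to be a sum of
  squares; with m = M - \<open>Bshift N k\<close> it gives the exponent of the truncation.\<close>

lemma sum_shift_squares:
  assumes N: "N \<ge> 1" and k: "k \<in> Bindex N"
  shows "(\<Sum>i\<in>{1..N}. (m + int (Kpart k i))\<^sup>2) = Bexp N k + int N * (m + int (Bshift N k))\<^sup>2"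
proof -
  have "(\<Sum>i\<in>{1..N}. (m + int (Kpart k i))\<^sup>2)
      = int N * m\<^sup>2 + 2 * m * int (\<Sum>i\<in>{1..N}. Kpart k i) + (\<Sum>i\<in>{1..N}. (int (Kpart k i))\<^sup>2)"
    by (simp add: power2_sum sum.distrib sum_distrib_left algebra_simps)
  also have "(\<Sum>i\<in>{1..N}. Kpart k i) = N * Bshift N k"
    unfolding sum_split_1[OF N] Bshift[OF k, symmetric] by simp
  also have "(\<Sum>i\<in>{1..N}. (int (Kpart k i))\<^sup>2) = Bexp N k + int N * (int (Bshift N k))\<^sup>2"
    unfolding sum_split_1[OF N] Bexp_eq[OF N k] by simp
  finally show ?thesis by (simp add: power2_sum algebra_simps)
qed

text \<open>Each k_i is a difference of consecutive deviations a_i - a_(i-1), so k_i <= k_i^2 <= 2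
  a_i^2 + 2 a_(i-1)^2, and every a_i^2 is counted at most twice.\<close>

lemma sum_le_4_Bexp:
  assumes N: "N \<ge> 1" and k: "k \<in> Bindex N"
  shows "int (\<Sum>i\<in>{2..N}. k i) \<le> 4 * Bexp N k"
proof -
  define a where "a i = - int (Bshift N k) + int (Kpart k i)" for i
  have B: "Bexp N k = (\<Sum>i\<in>{1..N}. (a i)\<^sup>2)"
    unfolding a_def sum_shift_squares[OF N k] by simp
  have ki: "int (k (Suc i)) \<le> 2 * (a (Suc i))\<^sup>2 + 2 * (a i)\<^sup>2" if "i \<ge> 1" for i
  proof -
    have e: "int (k (Suc i)) = a (Suc i) - a i"
      using Kpart_Suc[OF that, of k] by (simp add: a_def)
    have "int (k (Suc i)) \<le> (int (k (Suc i)))\<^sup>2"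
      by (cases "k (Suc i)") (simp_all add: power2_eq_square)
    also have "\<dots> = 2 * (a (Suc i))\<^sup>2 + 2 * (a i)\<^sup>2 - (a (Suc i) + a i)\<^sup>2"
      unfolding e by (simp add: power2_eq_square algebra_simps)
    also have "\<dots> \<le> 2 * (a (Suc i))\<^sup>2 + 2 * (a i)\<^sup>2" by simp
    finally show ?thesis .
  qed
  obtain n where n: "N = Suc n" using N by (cases N) auto
  have im: "{2..N} = Suc ` {1..n}" by (simp add: n numeral_2_eq_2)
  have "int (\<Sum>i\<in>{2..N}. k i) = (\<Sum>i\<in>{1..n}. int (k (Suc i)))"
    unfolding im by (subst sum.reindex) auto
  also have "\<dots> \<le> (\<Sum>i\<in>{1..n}. 2 * (a (Suc i))\<^sup>2 + 2 * (a i)\<^sup>2)"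
    by (intro sum_mono ki) auto
  also have "\<dots> = 2 * (\<Sum>i\<in>{2..N}. (a i)\<^sup>2) + 2 * (\<Sum>i\<in>{1..n}. (a i)\<^sup>2)"
    unfolding im by (subst sum.reindex) (auto simp: sum.distrib sum_distrib_left)
  also have "\<dots> \<le> 2 * Bexp N k + 2 * Bexp N k"
    unfolding B by (intro add_mono mult_left_mono sum_mono2) (auto simp: n)
  finally show ?thesis by simp
qed

text \<open>The tuples for which a chain started at K_1 = M - \<open>Bshift N k\<close> stays
  between 0 and 2M.\<close>

definition Badm :: "nat \<Rightarrow> nat \<Rightarrow> (nat \<Rightarrow> nat) set" where
  "Badm N M = {k \<in> Bindex N. Bshift N k \<le> M \<and> Kpart k N \<le> M + Bshift N k}"

context
  fixes q :: complex
  assumes q0: "q \<noteq> 0" and q1: "norm q < 1"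
begin

lemma B_abs_summable:
  assumes N: "N \<ge> 1"
  shows "(\<lambda>k. norm (q powi Bexp N k)) summable_on Bindex N"
proof (rule summable_on_comparison_test)
  \<comment> \<open>The fourth root absorbs the constant of \<open>sum_le_4_Bexp\<close>.\<close>
  define x where "x = root 4 (norm q)"
  have x: "0 < x" "x < 1" "x ^ 4 = norm q"
    using q0 q1 by (simp_all add: x_def)
  have "(\<lambda>k. \<Prod>i\<in>{2..N}. x ^ k i) summable_on {k. \<forall>i. i \<notin> {2..N} \<longrightarrow> k i = 0}"
    using x by (intro summable_on_prod_powers) auto
  then show "(\<lambda>k. \<Prod>i\<in>{2..N}. x ^ k i) summable_on Bindex N"
    by (rule summable_on_subset) (auto simp: Bindex_def)
  fix k assume k: "k \<in> Bindex N"
  have "norm (q powi Bexp N k) = x powi (4 * Bexp N k)"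
    unfolding norm_power_int x(3)[symmetric] by (simp add: power_int_mult)
  also have "\<dots> \<le> x powi int (\<Sum>i\<in>{2..N}. k i)"
    using x by (intro power_int_decreasing sum_le_4_Bexp[OF N k]) auto
  also have "\<dots> = (\<Prod>i\<in>{2..N}. x ^ k i)"
    unfolding power_int_of_nat by (rule power_sum)
  finally show "norm (q powi Bexp N k) \<le> (\<Prod>i\<in>{2..N}. x ^ k i)" .
qed simp

text \<open>The condition K_1 + ... + K_N = NM determines k_1 from the other increments, and it
  forces the sum of the K_i - K_1 to be N (M - k_1), so deleting k_1 lands in
  \<open>Bindex N\<close>.\<close>

lemma chain_coeff_eq_sum_Badm:
  assumes N: "N \<ge> 1"
  shows "chain_coeff q N M = (\<Sum>k\<in>Badm N M. q powi Bexp N k / (\<Prod>i\<in>{2..N}. qpoch q q (k i)) /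
     (qpoch q q (M - Bshift N k) * qpoch q q (M + Bshift N k - Kpart k N)))"
    and "finite (Badm N M)"
proof -
  let ?C = "{k \<in> chains N (2 * M). (\<Sum>i\<in>{1..N}. sum k {1..i}) = N * M}"
  let ?j = "\<lambda>k. k(1 := M - Bshift N k)" and ?i = "\<lambda>k :: nat \<Rightarrow> nat. k(1 := 0 :: nat)"
  have j: "?j k \<in> ?C" "?i (?j k) = k" if k: "k \<in> Badm N M" for k
  proof -
    have kB: "k \<in> Bindex N" using k by (simp add: Badm_def)
    have "(\<Sum>i\<in>{1..N}. sum (?j k) {1..i}) = (\<Sum>i\<in>{1..N}. (M - Bshift N k) + Kpart k i)"
      by (intro sum.cong refl sum_fun_upd_1) auto
    also have "\<dots> = N * (M - Bshift N k) + N * Bshift N k"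
      unfolding sum.distrib sum_split_1[OF N, of "Kpart k"] Bshift[OF kB] by simp
    also have "\<dots> = N * M"
      using k by (simp add: Badm_def flip: distrib_left)
    finally show "?j k \<in> ?C"
      using k N by (auto simp: chains_def sum_fun_upd_1[OF N, simplified] Badm_def Bindex_def)
    show "?i (?j k) = k"
      using kB by (auto simp: fun_eq_iff Bindex_def)
  qed
  have i: "?i k \<in> Badm N M" "?j (?i k) = k" if k: "k \<in> ?C" for k
  proof -
    define m where "m = k 1"
    define k' where "k' = k(1 := 0)"
    have k': "k = k'(1 := m)" by (auto simp: k'_def m_def)
    have "(\<Sum>i\<in>{1..N}. sum k {1..i}) = (\<Sum>i\<in>{1..N}. m + Kpart k' i)"
      unfolding k' by (intro sum.cong refl sum_fun_upd_1) auto
    then have e: "N * m + (\<Sum>i\<in>{2..N}. Kpart k' i) = N * M"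
      using k unfolding sum.distrib sum_split_1[OF N, of "Kpart k'"] by simp
    have mM: "m \<le> M"
    proof -
      have "N * m \<le> N * M" using e by linarith
      then show ?thesis using N by simp
    qed
    have s: "(\<Sum>i\<in>{2..N}. Kpart k' i) = N * (M - m)"
      using e by (simp add: diff_mult_distrib2)
    have t: "Bshift N k' = M - m" unfolding Bshift_def s using N by simp
    have "m + Kpart k' N \<le> 2 * M"
      using k sum_fun_upd_1[OF N, of k' m] unfolding k'[symmetric] by (simp add: chains_def)
    then have "k' \<in> Badm N M"
      using k N mM t s by (auto simp: Badm_def Bindex_def chains_def k'_def)
    then show "?i k \<in> Badm N M" by (simp add: k'_def)
    show "?j (?i k) = k"
      using t mM unfolding k'_def[symmetric] by (subst k') simp
  qed
  have bij: "bij_betw ?j (Badm N M) ?C"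
    by (rule bij_betw_byWitness[where f' = ?i]) (use i j in auto)
  then show "finite (Badm N M)"
    using bij_betw_finite[OF bij] finite_subset[OF _ finite_chains[of N "2 * M"], of ?C] by blast
  show "chain_coeff q N M = (\<Sum>k\<in>Badm N M. q powi Bexp N k / (\<Prod>i\<in>{2..N}. qpoch q q (k i)) /
     (qpoch q q (M - Bshift N k) * qpoch q q (M + Bshift N k - Kpart k N)))"
    unfolding chain_coeff_def
  proof (rule sum.reindex_bij_betw[OF bij, symmetric, THEN trans], rule sum.cong)
    fix k assume k: "k \<in> Badm N M"
    have kB: "k \<in> Bindex N" and le: "Bshift N k \<le> M" "Kpart k N \<le> M + Bshift N k"
      using k by (auto simp: Badm_def)
    have 1: "(\<Sum>i\<in>{1..N}. (int (sum (?j k) {1..i}))\<^sup>2) - int N * (int M)\<^sup>2 = Bexp N k"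
    proof -
      have "(\<Sum>i\<in>{1..N}. (int (sum (?j k) {1..i}))\<^sup>2)
          = (\<Sum>i\<in>{1..N}. ((int M - int (Bshift N k)) + int (Kpart k i))\<^sup>2)"
        by (intro sum.cong refl) (simp only: sum_fun_upd_1 atLeastAtMost_iff of_nat_add of_nat_diff[OF le(1)])
      then show ?thesis
        unfolding sum_shift_squares[OF N kB] by simp
    qed
    have 2: "(\<Prod>i\<in>{1..N}. qpoch q q (?j k i)) = qpoch q q (M - Bshift N k) * (\<Prod>i\<in>{2..N}. qpoch q q (k i))"
    proof -
      have "{1..N} = insert 1 {2..N}" using N by auto
      then show ?thesis by (auto intro!: prod.cong)
    qed
    have 3: "2 * M - sum (?j k) {1..N} = M + Bshift N k - Kpart k N"
      unfolding sum_fun_upd_1[OF N] using le by simp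
    show "q powi ((\<Sum>i\<in>{1..N}. (int (sum (?j k) {1..i}))\<^sup>2) - int N * (int M)\<^sup>2) /
        ((\<Prod>i\<in>{1..N}. qpoch q q (?j k i)) * qpoch q q (2 * M - sum (?j k) {1..N}))
      = q powi Bexp N k / (\<Prod>i\<in>{2..N}. qpoch q q (k i)) /
         (qpoch q q (M - Bshift N k) * qpoch q q (M + Bshift N k - Kpart k N))"
      unfolding 1 2 3 by (simp add: mult_ac)
  qed simp
qed

text \<open>For a fixed tuple the first increment M - \<open>Bshift N k\<close> and the final gap 2M
  - K_N both grow with M, so the two end factors contribute (q;q)_infinity^2 and every tuple is
  eventually admissible.\<close>

lemma chain_coeff_tendsto_BN:
  assumes N: "N \<ge> 1"
  shows "(\<lambda>M. chain_coeff q N M) \<longlonglongrightarrow> BN N q / (qpoch_inf q q)\<^sup>2"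
proof -
  define t where "t k = q powi Bexp N k / (\<Prod>i\<in>{2..N}. qpoch q q (k i))" for k
  define f where "f M k = (if k \<in> Badm N M then t k /
     (qpoch q q (M - Bshift N k) * qpoch q q (M + Bshift N k - Kpart k N)) else 0)" for M k
  have fin: "(f M has_sum chain_coeff q N M) (Bindex N)" for M
    unfolding chain_coeff_eq_sum_Badm(1)[OF N]
    using chain_coeff_eq_sum_Badm(2)[OF N, of M]
    by (intro has_sum_finite_neutralI[of "Badm N M"]) (auto simp: f_def t_def Badm_def)
  obtain D where D: "\<And>n. norm (1 / qpoch q q n) \<le> D" using inverse_qpoch_bounded[OF q0 q1] by blast
  have D0: "D \<ge> 0" and D1: "D \<ge> 1"
    using D[of 0] by simp_all
  define E where "E = D ^ card {2..N} * (D * D)"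
  have E0: "E \<ge> 0" using D0 by (simp add: E_def)
  have bound: "norm (f M k) \<le> norm (q powi Bexp N k) * E" for M k
  proof -
    have p: "norm (\<Prod>i\<in>{2..N}. 1 / qpoch q q (k i)) \<le> D ^ card {2..N}"
      unfolding prod_norm[symmetric] using D by (intro prod_le_power) (auto simp: D1)
    have "norm ((\<Prod>i\<in>{2..N}. 1 / qpoch q q (k i)) * (1 / qpoch q q (M - Bshift N k) * (1 / qpoch q q (M + Bshift N k - Kpart k N)))) \<le> E"
      unfolding norm_mult E_def by (intro mult_mono p D D0 mult_nonneg_nonneg norm_ge_zero zero_le_power)
    then have "norm (q powi Bexp N k) * norm ((\<Prod>i\<in>{2..N}. 1 / qpoch q q (k i)) * (1 / qpoch q q (M - Bshift N k) * (1 / qpoch q q (M + Bshift N k - Kpart k N)))) \<le> norm (q powi Bexp N k) * E"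
      by (intro mult_left_mono) auto
    then show ?thesis
      using E0 by (auto simp: f_def t_def norm_mult norm_divide prod_dividef)
  qed
  have lim: "(\<lambda>M. f M k) \<longlonglongrightarrow> t k / (qpoch_inf q q)\<^sup>2" if k: "k \<in> Bindex N" for k
  proof (rule Lim_transform_eventually)
    let ?g = "\<lambda>M. t k / (qpoch q q (nat (int M + - int (Bshift N k))) * qpoch q q (nat (int M + (int (Bshift N k) - int (Kpart k N)))))"
    show "?g \<longlonglongrightarrow> t k / (qpoch_inf q q)\<^sup>2"
      unfolding power2_eq_square using qpoch_inf_self_neq_0[OF q0 q1]
      by (intro tendsto_divide tendsto_mult tendsto_const qpoch_tendsto_nat_int[OF q0 q1]) auto
    show "\<forall>\<^sub>F M in sequentially. ?g M = f M k"
    proof (rule eventually_mono[OF eventually_ge_at_top[of "Bshift N k + Kpart k N"]])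
      fix M assume M: "M \<ge> Bshift N k + Kpart k N"
      have "nat (int M + - int (Bshift N k)) = M - Bshift N k"
        "nat (int M + (int (Bshift N k) - int (Kpart k N))) = M + Bshift N k - Kpart k N"
        using M by linarith+
      then show "?g M = f M k"
        using M k by (simp add: f_def Badm_def)
    qed
  qed
  note tan = infsum_dominated_convergence[where f = f and A = "Bindex N", OF lim bound summable_on_cmult_left[OF B_abs_summable[OF N]] fin]
  have "infsum (\<lambda>k. t k / (qpoch_inf q q)\<^sup>2) (Bindex N) = BN N q / (qpoch_inf q q)\<^sup>2"
    unfolding divide_inverse infsum_cmult_left' BN_def t_def ..
  then show ?thesis using tan(2) by simp
qed

lemma chain_coeff_tendsto_hecke_sum:
  assumes N: "N \<ge> 1"
  shows "(\<lambda>M. chain_coeff q N M) \<longlonglongrightarrow> hecke_sum q N / (qpoch_inf q q) ^ 4"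
proof -
  define g where "g p = (case p of (U, T) \<Rightarrow> quadrant U T * hecke_term q N U T)" for p
  define I where "I M = {- int M..int M} \<times> {- int M..int M}" for M :: nat
  define f where "f M p = (if p \<in> I M then g p / (qpoch_pair q M (fst p) * qpoch_pair q M (snd p)) else 0)" for M p
  have fin: "(f M has_sum chain_coeff q N M) UNIV" for M
  proof (rule has_sum_finite_neutralI[of "I M"])
    show "chain_coeff q N M = sum (f M) (I M)"
      unfolding chain_coeff_eq[OF q0 q1] I_def sum.cartesian_product
      by (intro sum.cong) (auto simp: f_def g_def I_def quadrant_def)
  qed (auto simp: f_def I_def)
  obtain D where D: "\<And>n. norm (1 / qpoch q q n) \<le> D" using inverse_qpoch_bounded[OF q0 q1] by blast
  have D0: "D \<ge> 0"
    using D[of 0] norm_ge_zero order_trans by blast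
  have pair: "norm (1 / qpoch_pair q M U) \<le> D * D" for M U
  proof -
    have "norm (1 / qpoch q q (nat (int M - U)) * (1 / qpoch q q (nat (int M + U)))) \<le> D * D"
      unfolding norm_mult by (intro mult_mono D D0 norm_ge_zero)
    then show ?thesis by (simp add: qpoch_pair_def norm_mult norm_divide)
  qed
  have bound: "norm (f M p) \<le> norm (g p) * (D * D * (D * D))" for M p
  proof -
    have "norm (1 / qpoch_pair q M (fst p) * (1 / qpoch_pair q M (snd p))) \<le> D * D * (D * D)"
      unfolding norm_mult by (intro mult_mono pair D0 mult_nonneg_nonneg norm_ge_zero)
    then have "norm (g p) * norm (1 / qpoch_pair q M (fst p) * (1 / qpoch_pair q M (snd p))) \<le> norm (g p) * (D * D * (D * D))"
      by (intro mult_left_mono) auto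
    then show ?thesis
      using D0 by (auto simp: f_def norm_mult norm_divide)
  qed
  have lim: "(\<lambda>M. f M p) \<longlonglongrightarrow> g p / (qpoch_inf q q) ^ 4" for p
  proof (rule Lim_transform_eventually)
    let ?P = "qpoch_inf q q * qpoch_inf q q"
    have "(\<lambda>M. g p / (qpoch_pair q M (fst p) * qpoch_pair q M (snd p))) \<longlonglongrightarrow> g p / (?P * ?P)"
      using qpoch_inf_self_neq_0[OF q0 q1]
      by (intro tendsto_divide tendsto_mult tendsto_const qpoch_pair_tendsto[OF q0 q1]) auto
    also have "?P * ?P = (qpoch_inf q q) ^ 4" by (simp add: power4_eq_xxxx mult_ac)
    finally show "(\<lambda>M. g p / (qpoch_pair q M (fst p) * qpoch_pair q M (snd p))) \<longlonglongrightarrow> g p / (qpoch_inf q q) ^ 4" .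
    show "\<forall>\<^sub>F M in sequentially. g p / (qpoch_pair q M (fst p) * qpoch_pair q M (snd p)) = f M p"
      by (rule eventually_mono[OF eventually_ge_at_top[of "nat \<bar>fst p\<bar> + nat \<bar>snd p\<bar>"]])
         (cases p; auto simp: f_def I_def)
  qed
  have abs: "(\<lambda>p. norm (g p)) summable_on UNIV"
    using hecke_abs_summable[OF q0 q1 N] by (simp add: g_def)
  note tan = infsum_dominated_convergence[where f = f and A = UNIV, OF lim bound summable_on_cmult_left[OF abs] fin]
  have "infsum (\<lambda>p. g p / (qpoch_inf q q) ^ 4) UNIV = hecke_sum q N / (qpoch_inf q q) ^ 4"
    unfolding divide_inverse infsum_cmult_left' hecke_sum_def g_def ..
  then show ?thesis using tan(2) by simp
qed

lemma BN_eq_hecke_sum: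
  assumes "N \<ge> 1"
  shows "BN N q = hecke_sum q N / (qpoch_inf q q)\<^sup>2"
proof -
  have "BN N q / (qpoch_inf q q)\<^sup>2 = hecke_sum q N / (qpoch_inf q q) ^ 4"
    by (rule LIMSEQ_unique[OF chain_coeff_tendsto_BN[OF assms] chain_coeff_tendsto_hecke_sum[OF assms]])
  also have "(qpoch_inf q q) ^ 4 = (qpoch_inf q q)\<^sup>2 * (qpoch_inf q q)\<^sup>2"
    by (simp flip: power_add)
  finally have "BN N q / (qpoch_inf q q)\<^sup>2 = hecke_sum q N / (qpoch_inf q q)\<^sup>2 / (qpoch_inf q q)\<^sup>2"
    by simp
  then show ?thesis
    using qpoch_inf_self_neq_0[OF q0 q1] unfolding divide_cancel_right by simp
qed

end

section \<open>The double sum of theta quotients\<close>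

lemma jtp_series:
  fixes q :: complex
  assumes "q \<noteq> 0" "norm q < 1" "m > 0"
  shows "((\<lambda>n. q powi (c * n) * q powi (int m * tri (n - 1))) has_sum jtp (- (q powi c)) (q ^ m)) (UNIV :: int set)"
    and "(\<lambda>n. norm (q powi (c * n) * q powi (int m * tri (n - 1)))) summable_on (UNIV :: int set)"
proof -
  have Q: "q ^ m \<noteq> 0" "norm (q ^ m) < 1"
    using assms by (simp_all add: norm_power power_less_one_iff)
  have 1: "(- (- (q powi c))) powi n * (q ^ m) powi tri (n - 1) = q powi (c * n) * q powi (int m * tri (n - 1))" for n
    by (simp add: power_int_mult)
  show "((\<lambda>n. q powi (c * n) * q powi (int m * tri (n - 1))) has_sum jtp (- (q powi c)) (q ^ m)) (UNIV :: int set)"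
    using jacobi_triple_product[OF Q, of "- (q powi c)"] assms(1) unfolding 1 by simp
  have 2: "q powi (c * n) * q powi (int m * tri (n - 1)) = (q powi (c - int m)) powi n * (q ^ m) powi tri n" for n
  proof -
    have "c * n + int m * tri (n - 1) = (c - int m) * n + int m * tri n"
      by (simp add: tri_diff algebra_simps)
    then show ?thesis
      using assms(1) by (simp add: power_int_mult[symmetric] power_int_add[symmetric] flip: power_int_of_nat)
  qed
  show "(\<lambda>n. norm (q powi (c * n) * q powi (int m * tri (n - 1)))) summable_on (UNIV :: int set)"
    unfolding 2 using assms(1) by (intro theta_summable[OF Q]) simp
qed

definition theta_quotient_term :: "nat \<Rightarrow> complex \<Rightarrow> nat \<Rightarrow> nat \<Rightarrow> complex" where
  "theta_quotient_term N q r s =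
      (-1) ^ (r + s + 1) *
      q ^ (r * (r - 1) div 2 + (s + 1) * s div 2 + r * (s + 1) * (N + 1) + r + s + 1) *
      (Jm q (N\<^sup>2 * (N + 2))) ^ 3 *
      jtp (- (q powi (int N * (int s - int r)))) (q ^ (N\<^sup>2)) *
      jtp (q ^ (N * (N + 2) * (r + s) + N * (N + 3))) (q ^ (N\<^sup>2 * (N + 2)))
      / (jtp ((-1) ^ N * q ^ (N * (N + 2) * r + N * (N + 3) div 2)) (q ^ (N\<^sup>2 * (N + 2))) *
         jtp ((-1) ^ N * q ^ (N * (N + 2) * s + N * (N + 3) div 2)) (q ^ (N\<^sup>2 * (N + 2))))"

text \<open>T is S + 1 in the notation of the overview: for R = r and T = s + 1 the sign and the
  power of q in front of the theta functions form exactly a Hecke term, which is why the second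
  condition reads T < 1. The last factor is the n-th term of j(-q^(N(S-R)); q^(N^2)).\<close>

definition theta_hecke_term :: "nat \<Rightarrow> complex \<Rightarrow> int \<times> int \<times> int \<Rightarrow> complex" where
  "theta_hecke_term N q = (\<lambda>(R, T, n). (of_bool (R \<ge> 0) - of_bool (T < 1)) * hecke_term q N R T *
      q powi ((int N)\<^sup>2 * tri (n - 1) + int N * (T - 1 - R) * n))"

lemma tri_of_nat: "int (r * (r - 1) div 2) = tri (int r - 1)" "int ((s + 1) * s div 2) = tri (int s)"
proof -
  show "int ((s + 1) * s div 2) = tri (int s)"
    by (simp add: tri_def zdiv_int algebra_simps)
  show "int (r * (r - 1) div 2) = tri (int r - 1)"
    by (cases r) (simp_all add: tri_def zdiv_int algebra_simps)
qed

context
  fixes q :: complex and N :: nat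
  assumes q0: "q \<noteq> 0" and q1: "norm q < 1" and N: "N \<ge> 2"
begin

text \<open>Kronecker's exponent has only the mixed term N^2 (N + 2) ab, whereas
  \<open>hecke_exp\<close> at (r + N a, s + N b + 1) also produces N^2 (a - b)^2 / 2. The theta
  series takes up the difference: replacing n by n - b + a completes the square.\<close>

lemma theta_hecke_exponent:
  fixes r s a b n :: int
  assumes h: "2 * h = int N * (int N + 3)"
  shows "tri (r - 1) + tri s + r * (s + 1) * (int N + 1) + r + s + 1
      + (a * (int N * (int N + 2) * s + h) + b * (int N * (int N + 2) * r + h) + (int N)\<^sup>2 * (int N + 2) * (a * b))
      + (int N * (s - r) * n + (int N)\<^sup>2 * tri (n - 1))
    = hecke_exp N (r + int N * a) (s + int N * b + 1)
      + ((int N)\<^sup>2 * tri (n - b + a - 1) + int N * (s + int N * b + 1 - 1 - (r + int N * a)) * (n - b + a))"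
    (is "?L = ?R")
proof -
  have "2 * ?L = 2 * ?R"
  proof -
    have "2 * tri (n - b + a - 1) = (n - b + a - 1) * (n - b + a)"
      "2 * tri (n - 1) = (n - 1) * n" "2 * tri (r - 1) = (r - 1) * r" "2 * tri s = s * (s + 1)"
      "2 * tri (r + int N * a) = (r + int N * a) * (r + int N * a + 1)"
      "2 * tri (s + int N * b + 1) = (s + int N * b + 1) * (s + int N * b + 1 + 1)"
      by (simp_all add: two_tri)
    then show ?thesis
      using h unfolding hecke_exp_def of_nat_add of_nat_1 power2_eq_square by algebra
  qed
  then show ?thesis by simp
qed

lemma theta_quotient_term_has_sum:
  assumes r: "r < N" and s: "s < N"
  shows "(theta_hecke_term N q has_sum theta_quotient_term N q r s)
    ((\<lambda>((a, b), n). (int r + int N * a, int s + int N * b + 1, n - b + a)) ` UNIV)"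
proof -
  define L where "L = N\<^sup>2 * (N + 2)"
  define Q where "Q = q ^ L"
  define h where "h = N * (N + 3) div 2"
  have h: "2 * h = N * (N + 3)"
  proof -
    have "even (N * (N + 3))" by simp
    then show ?thesis unfolding h_def by simp
  qed
  have hint: "2 * int h = int N * (int N + 3)"
    using arg_cong[OF h, of int] by simp
  define x where "x t = (-1) ^ N * q ^ (N * (N + 2) * t + h)" for t
  have L0: "L > 0" using N by (simp add: L_def)
  have Q0: "Q \<noteq> 0" "norm Q < 1"
    using q0 q1 L0 by (simp_all add: Q_def norm_power power_less_one_iff)
  \<comment> \<open>For t < N the exponent N (N + 2) t + h lies strictly between 0 and L, which puts
    the arguments in the annulus demanded by \<open>kronecker\<close>.\<close>
  have xnorm: "norm Q < norm (x t)" "norm (x t) < 1" if "t < N" for t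
  proof -
    have h0: "h > 0" using h N by (cases h) auto
    have hl: "h < N * (N + 2)"
    proof -
      have "N * (N + 3) < N * (2 * (N + 2))" using N by (intro mult_strict_left_mono) auto
      then show ?thesis using h by linarith
    qed
    have "N * (N + 2) * t + h < N * (N + 2) * (t + 1)" using hl by (simp add: algebra_simps)
    also have "\<dots> \<le> N * (N + 2) * N" using that by (intro mult_left_mono) auto
    also have "\<dots> = L" by (simp add: L_def power2_eq_square algebra_simps)
    finally have lt: "N * (N + 2) * t + h < L" .
    have nx: "norm (x t) = norm q ^ (N * (N + 2) * t + h)"
      by (simp add: x_def norm_mult norm_power)
    show "norm Q < norm (x t)"
      unfolding nx Q_def norm_power using q0 q1 lt by (intro power_strict_decreasing) auto
    show "norm (x t) < 1"
      unfolding nx using q0 q1 h0 by (simp add: power_less_one_iff)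
  qed
  \<comment> \<open>The index a, which extends r to R = r + N a, is attached to the argument built
    from s, as the mixed term of \<open>hecke_exp\<close> dictates; likewise b to the argument built
    from r.\<close>
  note kr = kronecker[OF Q0 xnorm[OF s] xnorm[OF r]]
  define f where "f = (\<lambda>(a, b). quadrant a b * (x s powi a * x r powi b * Q powi (a * b)))"
  define g where "g n = q powi (int N * (int s - int r) * n) * q powi (int (N\<^sup>2) * tri (n - 1))" for n
  define c where "c = (-1) ^ (r + s + 1) *
      q ^ (r * (r - 1) div 2 + (s + 1) * s div 2 + r * (s + 1) * (N + 1) + r + s + 1)"
  have fsum: "(f has_sum (Jm q L) ^ 3 * jtp (x s * x r) Q / (jtp (x s) Q * jtp (x r) Q)) UNIV"
    using kr(1) by (simp add: f_def Jm_def Q_def)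
  have fabs: "(\<lambda>p. norm (f p)) summable_on UNIV"
    using kr(2) by (simp add: f_def case_prod_unfold)
  have N2: "N\<^sup>2 > 0" using N by simp
  have prod: "((\<lambda>p. c * (case p of (p, n) \<Rightarrow> f p * g n)) has_sum
      c * ((Jm q L) ^ 3 * jtp (x s * x r) Q / (jtp (x s) Q * jtp (x r) Q) * jtp (- (q powi (int N * (int s - int r)))) (q ^ N\<^sup>2))) (UNIV \<times> UNIV)"
    unfolding g_def by (intro has_sum_cmult_right has_sum_product fsum fabs jtp_series[OF q0 q1 N2])
  have xx: "x s * x r = q ^ (N * (N + 2) * (r + s) + N * (N + 3))"
  proof -
    have "x s * x r = ((-1) ^ N * (-1) ^ N) * q ^ (N * (N + 2) * (r + s) + 2 * h)"
    proof -
      have "N * (N + 2) * (r + s) + 2 * h = (N * (N + 2) * s + h) + (N * (N + 2) * r + h)"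
        by (simp add: algebra_simps)
      then show ?thesis
        unfolding x_def by (simp only: power_add mult_ac)
    qed
    then show ?thesis unfolding h by (simp flip: power_mult_distrib)
  qed
  have val: "c * ((Jm q L) ^ 3 * jtp (x s * x r) Q / (jtp (x s) Q * jtp (x r) Q) * jtp (- (q powi (int N * (int s - int r)))) (q ^ N\<^sup>2))
      = theta_quotient_term N q r s"
    unfolding theta_quotient_term_def xx c_def[symmetric]
    unfolding x_def L_def Q_def h_def by (simp add: mult_ac)
  let ?j = "\<lambda>((a, b), n). (int r + int N * a, int s + int N * b + 1, n - b + a) :: int \<times> int \<times> int"
  have inj: "inj ?j"
    using N by (auto simp: inj_on_def)
  have eq: "c * (case p of (p, n) \<Rightarrow> f p * g n) = theta_hecke_term N q (?j p)" for p
  proof -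
    obtain a b n where p: "p = ((a, b), n)" by (metis surj_pair)
    define R where "R = int r + int N * a"
    define T where "T = int s + int N * b + 1"
    have "R \<ge> 0 \<longleftrightarrow> a \<ge> 0"
    proof
      assume "R \<ge> 0"
      show "a \<ge> 0"
      proof (rule ccontr)
        assume "\<not> a \<ge> 0"
        then have "int N * a \<le> int N * (- 1)" by (intro mult_left_mono) auto
        then show False using \<open>R \<ge> 0\<close> r by (simp add: R_def)
      qed
    qed (simp add: R_def)
    moreover have "T < 1 \<longleftrightarrow> b < 0"
    proof
      assume "b < 0"
      then have "int N * b \<le> int N * (- 1)" by (intro mult_left_mono) auto
      then show "T < 1" using s by (simp add: T_def)
    next
      assume "T < 1"
      show "b < 0"
      proof (rule ccontr)
        assume "\<not> b < 0"
        then have "int N * b \<ge> 0" by simp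
        then show False using \<open>T < 1\<close> by (simp add: T_def)
      qed
    qed
    ultimately have quad: "quadrant a b = of_bool (R \<ge> 0) - of_bool (T < 1)"
      by (simp add: quadrant_def)
    have m1: "((- 1) ^ N) powi a = ((- 1) powi (int N * a) :: complex)" for a
      by (simp add: power_int_mult)
    have qm: "(q ^ m) powi a = q powi (a * int m)" for a m
      by (metis mult.commute power_int_mult power_int_of_nat)
    have xs: "x t powi a = (- 1) powi (int N * a) * q powi (a * (int N * (int N + 2) * int t + int h))" for t a
      unfolding x_def power_int_mult_distrib m1 qm by (simp add: algebra_simps)
    have Qab: "Q powi (a * b) = q powi ((int N)\<^sup>2 * (int N + 2) * (a * b))"
      unfolding Q_def qm L_def by (simp add: algebra_simps)
    have c': "c = (- 1) powi (int r + int s + 1) * q powi (tri (int r - 1) + tri (int s) + int r * (int s + 1) * (int N + 1) + int r + int s + 1)"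
    proof -
      have "(- 1) ^ (r + s + 1) = ((- 1) powi int (r + s + 1) :: complex)"
        by (rule power_int_of_nat[symmetric])
      moreover have "q ^ m = q powi int m" for m by simp
      ultimately show ?thesis
        unfolding c_def by (simp only: of_nat_add of_nat_mult of_nat_1 tri_of_nat[unfolded of_nat_mult])
    qed
    have "(- 1 :: complex) powi (int r + int s + 1) * (- 1) powi (int N * a) * (- 1) powi (int N * b) = (- 1) powi (R + T)"
    proof -
      have "R + T = int r + int s + 1 + int N * a + int N * b" by (simp add: R_def T_def)
      then show ?thesis by (simp only: power_int_add[of "- 1 :: complex", OF disjI1[OF neg_one_neq_zero]])
    qed
    note sgn = this[symmetric]
    define e0 where "e0 = tri (int r - 1) + tri (int s) + int r * (int s + 1) * (int N + 1) + int r + int s + 1"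
    define e1 where "e1 = a * (int N * (int N + 2) * int s + int h)"
    define e2 where "e2 = b * (int N * (int N + 2) * int r + int h)"
    define e3 where "e3 = (int N)\<^sup>2 * (int N + 2) * (a * b)"
    define e4 where "e4 = int N * (int s - int r) * n"
    define e5 where "e5 = (int N)\<^sup>2 * tri (n - 1)"
    define e6 where "e6 = (int N)\<^sup>2 * tri (n - b + a - 1) + int N * (T - 1 - R) * (n - b + a)"
    have "e0 + (e1 + e2 + e3) + (e4 + e5) = hecke_exp N R T + e6"
      unfolding e0_def e1_def e2_def e3_def e4_def e5_def e6_def R_def T_def
      by (rule theta_hecke_exponent[OF hint])
    then have "q powi (e0 + (e1 + e2 + e3) + (e4 + e5)) = q powi (hecke_exp N R T + e6)"
      by (simp only:)
    then have pw: "q powi hecke_exp N R T * q powi e6 = q powi e0 * (q powi e1 * q powi e2 * q powi e3) * (q powi e4 * q powi e5)"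
      by (simp only: power_int_add[OF disjI1[OF q0]])
    have pj: "?j p = (R, T, n - b + a)" by (simp add: p R_def T_def)
    have lhs: "c * (case p of (p, n) \<Rightarrow> f p * g n) = (- 1) powi (int r + int s + 1) * q powi e0 *
        (quadrant a b * ((- 1) powi (int N * a) * q powi e1 * ((- 1) powi (int N * b) * q powi e2) * q powi e3)
          * (q powi e4 * q powi e5))"
      unfolding p f_def g_def xs c' e0_def e1_def e2_def e3_def e4_def e5_def by (simp add: Qab)
    have rhs: "theta_hecke_term N q (?j p) = quadrant a b * (- 1) powi (R + T) * (q powi hecke_exp N R T * q powi e6)"
      unfolding pj theta_hecke_term_def hecke_term_def quad e6_def by simp
    show ?thesis
      unfolding lhs rhs pw sgn by (simp only: mult_ac)
  qed
  have "((\<lambda>p. theta_hecke_term N q (?j p)) has_sum theta_quotient_term N q r s) UNIV"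
    using prod unfolding val eq by simp
  then show ?thesis
    unfolding has_sum_reindex[OF inj] o_def .
qed

text \<open>The residues of R and T - 1 modulo N recover r and s, and for given a and b the shear n
  - b + a runs over all integers. So the images for different (r, s) partition the set of all
  triples.\<close>

lemma theta_quotient_sum_has_sum:
  "(theta_hecke_term N q has_sum (\<Sum>r<N. \<Sum>s<N. theta_quotient_term N q r s)) UNIV"
proof -
  define B where "B = (\<lambda>(r, s). range (\<lambda>((a, b), n). (int r + int N * a, int s + int N * b + 1, n - b + a) :: int \<times> int \<times> int))"
  have N0: "int N > 0" using N by simp
  have B_iff: "(R, T, m) \<in> B (r, s) \<longleftrightarrow> R mod int N = int r \<and> (T - 1) mod int N = int s" if "r < N" "s < N" for R T m r s
  proof
    assume "(R, T, m) \<in> B (r, s)"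
    then show "R mod int N = int r \<and> (T - 1) mod int N = int s"
      using that by (auto simp: B_def)
  next
    assume e: "R mod int N = int r \<and> (T - 1) mod int N = int s"
    have R: "R = int r + int N * (R div int N)"
      using e mult_div_mod_eq[of "int N" R] by simp
    have T: "T = int s + int N * ((T - 1) div int N) + 1"
      using e mult_div_mod_eq[of "int N" "T - 1"] by simp
    show "(R, T, m) \<in> B (r, s)"
      unfolding B_def prod.case
      by (rule range_eqI[where x = "((R div int N, (T - 1) div int N), m + (T - 1) div int N - R div int N)"])
         (use R T in simp)
  qed
  have "(theta_hecke_term N q has_sum (\<Sum>p\<in>{..<N} \<times> {..<N}. theta_quotient_term N q (fst p) (snd p))) (\<Union>p\<in>{..<N} \<times> {..<N}. B p)"
  proof (rule sum_has_sum)
    fix p assume p: "p \<in> {..<N} \<times> {..<N}"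
    then show "(theta_hecke_term N q has_sum theta_quotient_term N q (fst p) (snd p)) (B p)"
      using theta_quotient_term_has_sum[of "fst p" "snd p"] by (cases p) (simp add: B_def)
    fix p' assume p': "p' \<in> {..<N} \<times> {..<N}" "p \<noteq> p'"
    show "B p \<inter> B p' = {}"
    proof (rule ccontr)
      assume "B p \<inter> B p' \<noteq> {}"
      then obtain R T m where "(R, T, m) \<in> B p" "(R, T, m) \<in> B p'" by auto
      then show False using p p' B_iff by (cases p; cases p') fastforce
    qed
  qed simp
  also have "(\<Union>p\<in>{..<N} \<times> {..<N}. B p) = UNIV"
  proof -
    have "(R, T, m) \<in> (\<Union>p\<in>{..<N} \<times> {..<N}. B p)" for R T m
    proof -
      define r where "r = nat (R mod int N)"
      define s where "s = nat ((T - 1) mod int N)"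
      have rs: "int r = R mod int N" "int s = (T - 1) mod int N"
        using N0 by (simp_all add: r_def s_def)
      have lt: "r < N" "s < N"
        using rs pos_mod_bound[OF N0, of R] pos_mod_bound[OF N0, of "T - 1"] by linarith+
      have "(R, T, m) \<in> B (r, s)"
        unfolding B_iff[OF lt] rs by simp
      then show ?thesis using lt by blast
    qed
    then show ?thesis by auto
  qed
  also have "(\<Sum>p\<in>{..<N} \<times> {..<N}. theta_quotient_term N q (fst p) (snd p)) = (\<Sum>r<N. \<Sum>s<N. theta_quotient_term N q r s)"
    by (simp add: sum.cartesian_product case_prod_unfold)
  finally show ?thesis .
qed

text \<open>The substitution is made so that the terms N n (U - V) from \<open>hecke_exp\<close> and
  N n (V - U) from the theta part cancel. The coefficients of n^2 add up to -N + 2N + N^2 / 2,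
  whence the modulus N (N + 2).\<close>

lemma shifted_exponent:
  "hecke_exp N (U - n) (V + n) + ((int N)\<^sup>2 * tri (n - 1) + int N * (V + n - 1 - (U - n)) * n)
    = hecke_exp N U V + int (N * (N + 2)) * tri (n - 1)" (is "?L = ?R")
proof -
  have "2 * tri n = n * (n + 1)" by (rule two_tri)
  then show ?thesis
    by (simp add: hecke_exp_def tri_add tri_diff algebra_simps power2_eq_square)
qed

text \<open>With n outermost, the inner sum runs over quadrants with corner (n, 1 - n) and has the
  same value for every n by \<open>hecke_sum_shift\<close>. It factors out, and the remaining series
  in n is a triple product at -1.\<close>

lemma theta_quotient_sum_eq:
  "(\<Sum>r<N. \<Sum>s<N. theta_quotient_term N q r s) = hecke_sum q N * jtp (- 1) (q ^ (N * (N + 2)))"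
proof -
  define d where "d n = q powi (int (N * (N + 2)) * tri (n - 1))" for n
  have "((\<lambda>(n, U, V). (of_bool (U \<ge> n) - of_bool (V < 1 - n)) * hecke_term q N U V * d n) has_sum
      (\<Sum>r<N. \<Sum>s<N. theta_quotient_term N q r s)) (UNIV \<times> UNIV)"
  proof (rule has_sum_reindex_bij_witness[where j = "\<lambda>(R, T, n). (n, R + n, T - n)" and i = "\<lambda>(n, U, V). (U - n, V + n, n)",
        THEN iffD1, OF _ _ _ _ _ _ theta_quotient_sum_has_sum])
    fix p :: "int \<times> int \<times> int"
    obtain R T n where p: "p = (R, T, n)" by (cases p)
    have 1: "hecke_exp N R T + ((int N)\<^sup>2 * tri (n - 1) + int N * (T - 1 - R) * n)
       = hecke_exp N (R + n) (T - n) + int (N * (N + 2)) * tri (n - 1)"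
      using shifted_exponent[of "R + n" n "T - n"] by simp
    have "q powi hecke_exp N R T * q powi ((int N)\<^sup>2 * tri (n - 1) + int N * (T - 1 - R) * n)
        = q powi hecke_exp N (R + n) (T - n) * d n"
      unfolding d_def power_int_add[OF disjI1[OF q0], symmetric] 1 ..
    then show "(case (case p of (R, T, n) \<Rightarrow> (n, R + n, T - n)) of (n, U, V) \<Rightarrow>
        (of_bool (U \<ge> n) - of_bool (V < 1 - n)) * hecke_term q N U V * d n) = theta_hecke_term N q p"
      by (simp add: p theta_hecke_term_def hecke_term_def mult.assoc)
  qed auto
  then have "((\<lambda>n. hecke_sum q N * d n) has_sum (\<Sum>r<N. \<Sum>s<N. theta_quotient_term N q r s)) UNIV"
  proof (rule has_sum_SigmaD)
    fix n :: int
    have "N \<ge> 1" using N by simp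
    from has_sum_cmult_left[OF hecke_sum_shift[OF q0 q1 this, of n "1 - n"], of "d n"]
    show "((\<lambda>y. case (n, y) of (n, U, V) \<Rightarrow> (of_bool (U \<ge> n) - of_bool (V < 1 - n)) * hecke_term q N U V * d n) has_sum hecke_sum q N * d n) UNIV"
      by (simp add: case_prod_unfold)
  qed
  moreover have "((\<lambda>n. hecke_sum q N * d n) has_sum hecke_sum q N * jtp (- 1) (q ^ (N * (N + 2)))) UNIV"
    using jtp_series(1)[OF q0 q1, of "N * (N + 2)" 0] N
    by (intro has_sum_cmult_right) (simp add: d_def)
  ultimately show ?thesis by (rule has_sum_unique)
qed

lemma jtp_minus_1_neq_0: "jtp (- 1) (q ^ (N * (N + 2))) \<noteq> 0"
proof -
  define Q where "Q = q ^ (N * (N + 2))"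
  have Q: "Q \<noteq> 0" "norm Q < 1"
    using q0 q1 N by (simp_all add: Q_def norm_power power_less_one_iff)
  have "- 1 * Q ^ k \<noteq> 1" for k
  proof
    assume e: "- 1 * Q ^ k = 1"
    then have "norm Q ^ k = 1" by (metis norm_minus_cancel mult_minus1 norm_one norm_power)
    then have "k = 0" using Q(2) by (metis norm_ge_zero power_less_one_iff less_irrefl gr0I)
    then show False using e by simp
  qed
  moreover have "Q / - 1 * Q ^ k \<noteq> 1" for k
    using calculation[of "Suc k"] by simp
  ultimately show ?thesis
    unfolding jtp_def Q_def[symmetric]
    using qpoch_inf_neq_0[OF Q, of "- 1"] qpoch_inf_neq_0[OF Q, of "Q / - 1"] qpoch_inf_self_neq_0[OF Q] by simp
qed

end

theorem theorem1p1:
  fixes N :: nat and q :: complex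
  assumes "N \<ge> 2" and "q \<noteq> 0" and "norm q < 1"
  shows "BN N q =
    1 / ((qpoch_inf q q)\<^sup>2 * jtp (-1) (q ^ (N * (N + 2)))) *
    (\<Sum>r<N. \<Sum>s<N.
      (-1) ^ (r + s + 1) *
      q ^ (r * (r - 1) div 2 + (s + 1) * s div 2 + r * (s + 1) * (N + 1) + r + s + 1) *
      (Jm q (N\<^sup>2 * (N + 2))) ^ 3 *
      jtp (- (q powi (int N * (int s - int r)))) (q ^ (N\<^sup>2)) *
      jtp (q ^ (N * (N + 2) * (r + s) + N * (N + 3))) (q ^ (N\<^sup>2 * (N + 2)))
      / (jtp ((-1) ^ N * q ^ (N * (N + 2) * r + N * (N + 3) div 2)) (q ^ (N\<^sup>2 * (N + 2))) *
         jtp ((-1) ^ N * q ^ (N * (N + 2) * s + N * (N + 3) div 2)) (q ^ (N\<^sup>2 * (N + 2)))))"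
proof -
  have "BN N q = hecke_sum q N / (qpoch_inf q q)\<^sup>2"
    using assms by (intro BN_eq_hecke_sum) auto
  also have "\<dots> = 1 / ((qpoch_inf q q)\<^sup>2 * jtp (-1) (q ^ (N * (N + 2)))) *
      (\<Sum>r<N. \<Sum>s<N. theta_quotient_term N q r s)"
    unfolding theta_quotient_sum_eq[OF assms(2,3,1)] using jtp_minus_1_neq_0[OF assms(2,3,1)] by simp
  finally show ?thesis unfolding theta_quotient_term_def .
qed

end
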